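(* Let $\mathbb X$ be a virtual equipment and let $j\colon A\to E$ be a dense tight-cell. The partial functor $k_{(-)}\colon\mathbf{RMnd}(j)\to A/\underline{\mathbb X}$, defined on those $j$-relative monads $T$ admitting opalgebra objects and sending $T$ to $k_T\colon A\to\mathbf{Opalg}(T)$, is fully faithful.
   Context: Virtual equipments. A virtual double category has objects; a category of tight-cells $f\colon A\to B$ (the composite of $f\colon A\to B$ and $g\colon B\to C$ is $gf$); loose-cells $p\colon A\nrightarrow B$; and 2-cells, each having as frame a chain of loose-cells $p_1\colon A_1\nrightarrow A_0,\dots,p_n\colon A_n\nrightarrow A_{n-1}$ ($n\ge 0$; chains are always listed in this order, and called a chain from $A_n$ to $A_0$), a loose-cell $q\colon B_n\nrightarrow B_0$, and tight-cells $f_0\colon A_0\to B_0$ (left) and $f_n\colon A_n\to B_n$ (right); 2-cells have identities and associative unital multicategory-style composition. $\phi\colon p_1,\dots,p_n\Rightarrow q$ denotes a 2-cell whose tight-cells are identities; $(\phi_1,\dots,\phi_n)$ denotes juxtaposition. A 2-cell $q_1,\dots,q_m\Rightarrow q$ is opcartesian if every 2-cell (with any tight-cells) with domain $p_1,\dots,p_l,q_1,\dots,q_m,r_1,\dots,r_n$ factors uniquely through it; then $q$ is the loose-composite $q_1\odot\cdots\odot q_m$ (the loose-identity $A(1,1)\colon A\nrightarrow A$ if $m=0$). A unary 2-cell from $p$ to $q$ with left $f$ and right $g$ is cartesian if every 2-cell into $q$ with left $ff'$ and right $gg'$ factors uniquely through it via a 2-cell with left $f'$ and right $g'$; then $p$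 is the restriction $q(f,g)$. A virtual equipment has all loose-identities and restrictions. Write $E(f,g):=E(1,1)(f,g)$; for $f\colon D\to E$, $g\colon A\to E$ it is a loose-cell $A\nrightarrow D$. The canonical isomorphisms $q(f,g)\cong C(f,1)\odot q\odot B(1,g)$ are used implicitly. A 2-cell $f\Rightarrow g$ between tight-cells $A\to B$ is equivalently a 2-cell $B(1,f)\Rightarrow B(1,g)$, or $B(g,1)\Rightarrow B(f,1)$, or $()\Rightarrow B(f,g)$; objects, tight-cells and these 2-cells form a 2-category $\underline{\mathbb X}$. Restriction is functorial in 2-cells (contravariantly in the first argument, covariantly in the second). For $f\colon A\to B$, $\frown_f\colon ()\Rightarrow B(f,f)$ (corresponding to $1_f$) and $\smile_f\colon B(1,f),B(f,1)\Rightarrow B(1,1)$ are the canonical 2-cells. $\phi(f,g)$ denotes the 2-cell obtained from $\phi$ by restricting along $f$ on the left and $g$ on the right; e.g. $\smile_t(x,y)\colon E(x,t),E(t,y)\Rightarrow E(x,y)$ is composition and $\frown_c(x,y)\colon C(x,y)\Rightarrow C'(cx,cy)$ is the action of $c\colon C\to C'$. For $\phi\colon p_1,\dots,p_n\Rightarrow C(x,y)$ and $c\colon C\to C'$, $\phi;c:=\frown_c(x,y)\circ\phi$. $A/\underline{\mathbb X}$ is the category whose objects are tight-cells with domain $A$ and whose morphisms are strictly commuting triangles of tight-cells. Density. $j\colon A\to E$ is dense if $1_j$ exhibits $1_E$ as the pointwise left extension of $j$ along $j$; explicitly, if for every chain $r_1,\dots,r_n$ ($n\ge0$) from $E$ to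 $E$, the assignment sending $\phi\colon r_1,\dots,r_n\Rightarrow E(1,1)$ to $(1_{E(j,1)},\phi)\colon E(j,1),r_1,\dots,r_n\Rightarrow E(j,1)$ is a bijection. Relative monads. A $j$-relative monad $T=(t,\dagger,\eta)$ comprises a tight-cell $t\colon A\to E$, a 2-cell $\dagger\colon E(j,t)\Rightarrow E(t,t)$ and a 2-cell $\eta\colon j\Rightarrow t$ such that: (i) $E(\eta,t)\circ\dagger=1$; (ii) $\dagger\circ E(j,\eta)\circ\frown_j=\frown_t$; (iii) the 2-cells $E(j,t),E(j,t)\Rightarrow E(t,t)$ given by $(\dagger,\dagger)$ followed by $\smile_t(t,t)$, and by $(1,\dagger)$ followed by $\smile_t(j,t)$ followed by $\dagger$, are equal. A morphism is a 2-cell $\tau\colon t\Rightarrow t'$ with $\tau\circ\eta=\eta'$ and $E(t,\tau)\circ\dagger=E(\tau,t')\circ\dagger'\circ E(j,\tau)$. These form $\mathbf{RMnd}(j)$. Opalgebras. A $T$-opalgebra is a tight-cell $a\colon A\to B$ with a 2-cell $\ltimes\colon E(j,t)\Rightarrow B(a,a)$ such that $\ltimes\circ E(j,\eta)\circ\frown_j=\frown_a$ and the 2-cells $E(j,t),E(j,t)\Rightarrow B(a,a)$ given by $(\ltimes,\ltimes)$ followed by $\smile_a(a,a)$, and by $(1,\dagger)$ followed by $\smile_t(j,t)$ followed by $\ltimes$, are equal. For a chain $p_1,\dots,p_n$ from $B$ to $B'$, a $(p_1,\dots,p_n)$-graded $T$-opalgebra morphism from $(a\colon A\to B,\ltimes)$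 to $(a'\colon A\to B',\ltimes')$ is a 2-cell $\alpha\colon p_1,\dots,p_n,B(1,a)\Rightarrow B'(1,a')$ such that the 2-cells $p_1,\dots,p_n,B(1,a),E(j,t)\Rightarrow B'(1,a')$ given by $(1,\dots,1,\rho)$ followed by $\alpha$, and by $(\alpha,1)$ followed by $\rho'$, are equal; here $\rho\colon B(1,a),E(j,t)\Rightarrow B(1,a)$ is $(1,\ltimes)$ followed by $\smile_a(1,a)$, and similarly $\rho'$. Opalgebra object. A $T$-opalgebra $(k_T\colon A\to\mathbf{Opalg}(T),\ltimes_T)$ is an opalgebra object for $T$ when: (1) for every $T$-opalgebra $(a\colon A\to B,\ltimes)$ there is a unique tight-cell $[]_{(a,\ltimes)}\colon\mathbf{Opalg}(T)\to B$ with $[]_{(a,\ltimes)}k_T=a$ and $\ltimes_T;[]_{(a,\ltimes)}=\ltimes$; (2) for every graded $T$-opalgebra morphism $\alpha\colon p_1,\dots,p_n,B(1,a)\Rightarrow B'(1,a')$ there is a unique 2-cell $[]_\alpha\colon p_1,\dots,p_n,B(1,[]_{(a,\ltimes)})\Rightarrow B'(1,[]_{(a',\ltimes')})$ with $\alpha=[]_\alpha(1,k_T)$. The functor $k_{(-)}$. For a morphism $\tau\colon T\to T'$ of $j$-relative monads admitting opalgebra objects, $k_\tau\colon\mathbf{Opalg}(T)\to\mathbf{Opalg}(T')$ is the tight-cell under $A$ induced by the $T$-opalgebra $(k_{T'},\ltimes_{T'}\circ E(j,\tau))$. *)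

theory Defs
  imports Main
begin

section \<open>Categories\<close>

text \<open>
  Hom-sets are indexed by objects and need not be disjoint, so composition, and the action of a
  functor on morphisms, take the objects involved as arguments: \<open>cmp C x y z g f\<close> is the composite of
  \<open>f : x \<rightarrow> y\<close> and \<open>g : y \<rightarrow> z\<close>.
\<close>

record ('a, 'm) cat =
  ob :: "'a set"
  hom :: "'a \<Rightarrow> 'a \<Rightarrow> 'm set"
  idt :: "'a \<Rightarrow> 'm"
  cmp :: "'a \<Rightarrow> 'a \<Rightarrow> 'a \<Rightarrow> 'm \<Rightarrow> 'm \<Rightarrow> 'm"

locale category =
  fixes C :: "('a, 'm) cat"
  assumes idt_in_hom: "x \<in> ob C \<Longrightarrow> idt C x \<in> hom C x x"
    and cmp_in_hom: "\<lbrakk>x \<in> ob C; y \<in> ob C; z \<in> ob C; f \<in> hom C x y; g \<in> hom C y z\<rbrakk>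
      \<Longrightarrow> cmp C x y z g f \<in> hom C x z"
    and cmp_idt_left: "\<lbrakk>x \<in> ob C; y \<in> ob C; f \<in> hom C x y\<rbrakk> \<Longrightarrow> cmp C x y y (idt C y) f = f"
    and cmp_idt_right: "\<lbrakk>x \<in> ob C; y \<in> ob C; f \<in> hom C x y\<rbrakk> \<Longrightarrow> cmp C x x y f (idt C x) = f"
    and cmp_assoc: "\<lbrakk>w \<in> ob C; x \<in> ob C; y \<in> ob C; z \<in> ob C;
        f \<in> hom C w x; g \<in> hom C x y; h \<in> hom C y z\<rbrakk>
      \<Longrightarrow> cmp C w x z (cmp C x y z h g) f = cmp C w y z h (cmp C w x y g f)"

definition full_subcategory :: "('a, 'm) cat \<Rightarrow> ('a \<Rightarrow> bool) \<Rightarrow> ('a, 'm) cat" where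
  "full_subcategory C P = C\<lparr>ob := {x \<in> ob C. P x}\<rparr>"

locale cat_functor = C: category C + D: category D
  for C :: "('a, 'm) cat" and D :: "('b, 'n) cat" +
  fixes F :: "'a \<Rightarrow> 'b" and F' :: "'a \<Rightarrow> 'a \<Rightarrow> 'm \<Rightarrow> 'n"
  assumes F_ob: "x \<in> ob C \<Longrightarrow> F x \<in> ob D"
    and F_hom: "\<lbrakk>x \<in> ob C; y \<in> ob C; f \<in> hom C x y\<rbrakk> \<Longrightarrow> F' x y f \<in> hom D (F x) (F y)"
    and F_idt: "x \<in> ob C \<Longrightarrow> F' x x (idt C x) = idt D (F x)"
    and F_cmp: "\<lbrakk>x \<in> ob C; y \<in> ob C; z \<in> ob C; f \<in> hom C x y; g \<in> hom C y z\<rbrakk>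
      \<Longrightarrow> F' x z (cmp C x y z g f) = cmp D (F x) (F y) (F z) (F' y z g) (F' x y f)"

locale fully_faithful_functor = cat_functor +
  assumes fully_faithful:
    "\<lbrakk>x \<in> ob C; y \<in> ob C\<rbrakk> \<Longrightarrow> bij_betw (F' x y) (hom C x y) (hom D (F x) (F y))"


section \<open>Virtual double categories\<close>

text \<open>
  A 2-cell \<open>\<phi>\<close> has as domain the chain \<open>src X \<phi>\<close>, as codomain the loose-cell \<open>tgt X \<phi>\<close>, and
  left and right tight-cells \<open>cleft X \<phi>\<close> and \<open>cright X \<phi>\<close>. A list \<open>[p\<^sub>1, \<dots>, p\<^sub>n]\<close> with
  \<open>p\<^sub>i : A\<^sub>i \<rightarrow> A\<^bsub>i-1\<^esub>\<close> is a chain from \<open>A\<^sub>n\<close> to \<open>A\<^sub>0\<close>, the object \<open>A\<^sub>0\<close> being the one on the left;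
  in a 2-cell with empty domain, \<open>A\<^sub>0\<close> is recovered as the domain of the left tight-cell.

  A path of 2-cells \<open>\<psi>\<^sub>1, \<dots>, \<psi>\<^sub>m\<close> sharing consecutive tight-cells can be composed with a 2-cell
  \<open>\<phi>\<close> whose domain has length \<open>m\<close>. A path of length \<open>0\<close> is a tight-cell. Hence
  \<open>ccomp X \<phi> f [\<psi>\<^sub>1, \<dots>, \<psi>\<^sub>m]\<close> takes as an additional argument the left tight-cell \<open>f\<close> of the path
  (for \<open>m > 0\<close> necessarily the left tight-cell of \<open>\<psi>\<^sub>1\<close>). The composite has left tight-cell the
  composite of \<open>f\<close> with that of \<open>\<phi>\<close>.
\<close>

record ('o, 't, 'l, 'c) vdc =
  Obj :: "'o set"
  Tight :: "'t set"
  tdom :: "'t \<Rightarrow> 'o"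
  tcod :: "'t \<Rightarrow> 'o"
  tid :: "'o \<Rightarrow> 't"
  tcomp :: "'t \<Rightarrow> 't \<Rightarrow> 't"
  Loose :: "'l set"
  ldom :: "'l \<Rightarrow> 'o"
  lcod :: "'l \<Rightarrow> 'o"
  Cell :: "'c set"
  src :: "'c \<Rightarrow> 'l list"
  tgt :: "'c \<Rightarrow> 'l"
  cleft :: "'c \<Rightarrow> 't"
  cright :: "'c \<Rightarrow> 't"
  cid :: "'l \<Rightarrow> 'c"
  ccomp :: "'c \<Rightarrow> 't \<Rightarrow> 'c list \<Rightarrow> 'c"

context
  fixes X :: "('o, 't, 'l, 'c) vdc"
begin

definition tight :: "'t \<Rightarrow> 'o \<Rightarrow> 'o \<Rightarrow> bool" where
  "tight f A B \<longleftrightarrow> f \<in> Tight X \<and> tdom X f = A \<and> tcod X f = B"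

definition loose :: "'l \<Rightarrow> 'o \<Rightarrow> 'o \<Rightarrow> bool" where
  "loose p A B \<longleftrightarrow> p \<in> Loose X \<and> ldom X p = A \<and> lcod X p = B"

fun chain :: "'l list \<Rightarrow> 'o \<Rightarrow> 'o \<Rightarrow> bool" where
  "chain [] A B \<longleftrightarrow> A \<in> Obj X \<and> A = B"
| "chain (p # ps) A B \<longleftrightarrow> p \<in> Loose X \<and> lcod X p = B \<and> chain ps A (ldom X p)"

definition cell :: "'c \<Rightarrow> 't \<Rightarrow> 'l list \<Rightarrow> 'l \<Rightarrow> 't \<Rightarrow> bool" where
  "cell \<phi> f ps q g \<longleftrightarrow>
    \<phi> \<in> Cell X \<and> cleft X \<phi> = f \<and> src X \<phi> = ps \<and> tgt X \<phi> = q \<and> cright X \<phi> = g"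

fun cell_path :: "'t \<Rightarrow> 'c list \<Rightarrow> 't \<Rightarrow> bool" where
  "cell_path f [] g \<longleftrightarrow> f \<in> Tight X \<and> f = g"
| "cell_path f (\<psi> # \<psi>s) g \<longleftrightarrow> \<psi> \<in> Cell X \<and> cleft X \<psi> = f \<and> cell_path (cright X \<psi>) \<psi>s g"

text \<open>
  \<open>comp_path \<psi>s h \<xi>s\<close> splits the path \<open>\<xi>s\<close>, with left tight-cell \<open>h\<close>, according to the lengths of the
  domains of the 2-cells in \<open>\<psi>s\<close>, and composes componentwise.
\<close>

fun comp_path :: "'c list \<Rightarrow> 't \<Rightarrow> 'c list \<Rightarrow> 'c list" where
  "comp_path [] h \<xi>s = []"
| "comp_path (\<psi> # \<psi>s) h \<xi>s =
    (let n = length (src X \<psi>); \<xi>s' = take n \<xi>s; h' = (if \<xi>s' = [] then h else cright X (last \<xi>s'))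
     in ccomp X \<psi> h \<xi>s' # comp_path \<psi>s h' (drop n \<xi>s))"

end

locale virtual_double_category =
  fixes X :: "('o, 't, 'l, 'c) vdc"
  assumes tight_obj: "f \<in> Tight X \<Longrightarrow> tdom X f \<in> Obj X \<and> tcod X f \<in> Obj X"
    and tid_tight: "A \<in> Obj X \<Longrightarrow> tight X (tid X A) A A"
    and tcomp_tight: "\<lbrakk>tight X f A B; tight X g B C\<rbrakk> \<Longrightarrow> tight X (tcomp X g f) A C"
    and tcomp_tid_left: "tight X f A B \<Longrightarrow> tcomp X (tid X B) f = f"
    and tcomp_tid_right: "tight X f A B \<Longrightarrow> tcomp X f (tid X A) = f"
    and tcomp_assoc: "\<lbrakk>tight X f A B; tight X g B C; tight X h C D\<rbrakk>
      \<Longrightarrow> tcomp X (tcomp X h g) f = tcomp X h (tcomp X g f)"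
    and loose_obj: "p \<in> Loose X \<Longrightarrow> ldom X p \<in> Obj X \<and> lcod X p \<in> Obj X"
    and cell_tight: "\<phi> \<in> Cell X \<Longrightarrow> cleft X \<phi> \<in> Tight X \<and> cright X \<phi> \<in> Tight X"
    and cell_src: "\<phi> \<in> Cell X \<Longrightarrow> chain X (src X \<phi>) (tdom X (cright X \<phi>)) (tdom X (cleft X \<phi>))"
    and cell_tgt: "\<phi> \<in> Cell X \<Longrightarrow> loose X (tgt X \<phi>) (tcod X (cright X \<phi>)) (tcod X (cleft X \<phi>))"
    and cid_cell: "loose X p A B \<Longrightarrow> cell X (cid X p) (tid X B) [p] p (tid X A)"
    and ccomp_cell: "\<lbrakk>\<phi> \<in> Cell X; cell_path X f \<psi>s g; tcod X f = tdom X (cleft X \<phi>);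
        map (tgt X) \<psi>s = src X \<phi>\<rbrakk>
      \<Longrightarrow> cell X (ccomp X \<phi> f \<psi>s) (tcomp X (cleft X \<phi>) f) (concat (map (src X) \<psi>s)) (tgt X \<phi>)
            (tcomp X (cright X \<phi>) g)"
    and ccomp_cid_left: "\<phi> \<in> Cell X \<Longrightarrow> ccomp X (cid X (tgt X \<phi>)) (cleft X \<phi>) [\<phi>] = \<phi>"
    and ccomp_cid_right: "\<phi> \<in> Cell X
      \<Longrightarrow> ccomp X \<phi> (tid X (tdom X (cleft X \<phi>))) (map (cid X) (src X \<phi>)) = \<phi>"
    and ccomp_assoc: "\<lbrakk>\<phi> \<in> Cell X;
        cell_path X f \<psi>s g; tcod X f = tdom X (cleft X \<phi>); map (tgt X) \<psi>s = src X \<phi>;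
        cell_path X h \<xi>s k; tcod X h = tdom X f; map (tgt X) \<xi>s = concat (map (src X) \<psi>s)\<rbrakk>
      \<Longrightarrow> ccomp X (ccomp X \<phi> f \<psi>s) h \<xi>s = ccomp X \<phi> (tcomp X f h) (comp_path X \<psi>s h \<xi>s)"


section \<open>Virtual equipments\<close>

text \<open>Composition with a path of 2-cells whose left tight-cell is an identity.\<close>

definition vcomp :: "('o, 't, 'l, 'c) vdc \<Rightarrow> 'c \<Rightarrow> 'c list \<Rightarrow> 'c" (infixr \<open>\<star>\<index>\<close> 70) where
  "\<phi> \<star>\<^bsub>X\<^esub> \<psi>s = ccomp X \<phi> (tid X (tdom X (cleft X \<phi>))) \<psi>s"

context
  fixes X :: "('o, 't, 'l, 'c) vdc" (structure)
begin

text \<open>2-cells whose tight-cells are identities.\<close>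

definition globular :: "'c \<Rightarrow> 'l list \<Rightarrow> 'l \<Rightarrow> bool" where
  "globular \<phi> ps q \<longleftrightarrow> cell X \<phi> (tid X (lcod X q)) ps q (tid X (ldom X q))"

text \<open>
  If \<open>\<phi>\<close> has empty domain, then the chain condition on \<open>ps\<close> ensures that \<open>\<phi>\<close> is located at the
  object where \<open>ps\<close> and \<open>rs\<close> meet; otherwise it is redundant.
\<close>

definition opcartesian :: "'c \<Rightarrow> bool" where
  "opcartesian \<phi> \<longleftrightarrow> globular \<phi> (src X \<phi>) (tgt X \<phi>) \<and>
    (\<forall>\<chi> ps rs. \<chi> \<in> Cell X \<and> src X \<chi> = ps @ src X \<phi> @ rs
        \<and> chain X ps (lcod X (tgt X \<phi>)) (tdom X (cleft X \<chi>)) \<longrightarrow>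
      (\<exists>!\<psi>. cell X \<psi> (cleft X \<chi>) (ps @ [tgt X \<phi>] @ rs) (tgt X \<chi>) (cright X \<chi>)
        \<and> \<psi> \<star> (map (cid X) ps @ [\<phi>] @ map (cid X) rs) = \<chi>))"

definition cartesian :: "'c \<Rightarrow> bool" where
  "cartesian \<kappa> \<longleftrightarrow> \<kappa> \<in> Cell X \<and> (\<exists>p. src X \<kappa> = [p] \<and>
    (\<forall>\<chi> f' g'. \<chi> \<in> Cell X \<and> tgt X \<chi> = tgt X \<kappa>
        \<and> tight X f' (tdom X (cleft X \<chi>)) (tdom X (cleft X \<kappa>))
        \<and> tight X g' (tdom X (cright X \<chi>)) (tdom X (cright X \<kappa>))
        \<and> cleft X \<chi> = tcomp X (cleft X \<kappa>) f' \<and> cright X \<chi> = tcomp X (cright X \<kappa>) g' \<longrightarrow>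
      (\<exists>!\<psi>. cell X \<psi> f' (src X \<chi>) p g' \<and> ccomp X \<kappa> f' [\<psi>] = \<chi>)))"

end

locale virtual_equipment = virtual_double_category +
  assumes has_loose_identities:
      "A \<in> Obj X \<Longrightarrow> \<exists>\<iota> p. loose X p A A \<and> globular X \<iota> [] p \<and> opcartesian X \<iota>"
    and has_restrictions:
      "\<lbrakk>q \<in> Loose X; f \<in> Tight X; tcod X f = lcod X q; g \<in> Tight X; tcod X g = ldom X q\<rbrakk>
        \<Longrightarrow> \<exists>\<kappa> p. cell X \<kappa> f [p] q g \<and> cartesian X \<kappa>"

text \<open>
  The operations below are meant for a virtual equipment \<open>X\<close>. Loose-identities and restrictions are
  fixed by choice; they are determined up to isomorphism. The 2-cells derived from them
  are determined uniquely by the universal properties.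
\<close>

context
  fixes X :: "('o, 't, 'l, 'c) vdc" (structure)
begin

text \<open>The loose-identity \<open>A(1,1)\<close>, with its opcartesian 2-cell.\<close>

definition lid_cell :: "'o \<Rightarrow> 'c" where
  "lid_cell A = (SOME \<iota>. \<exists>p. loose X p A A \<and> globular X \<iota> [] p \<and> opcartesian X \<iota>)"

definition lid :: "'o \<Rightarrow> 'l" where
  "lid A = tgt X (lid_cell A)"

text \<open>The restriction \<open>q(f,g)\<close>, with its cartesian 2-cell.\<close>

definition restr_cell :: "'l \<Rightarrow> 't \<Rightarrow> 't \<Rightarrow> 'c" where
  "restr_cell q f g = (SOME \<kappa>. \<exists>p. cell X \<kappa> f [p] q g \<and> cartesian X \<kappa>)"

definition restr :: "'l \<Rightarrow> 't \<Rightarrow> 't \<Rightarrow> 'l" where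
  "restr q f g = hd (src X (restr_cell q f g))"

text \<open>\<open>\<langle>f,g\<rangle>\<close> is \<open>E(f,g)\<close>, where \<open>E\<close> is the common codomain of \<open>f\<close> and \<open>g\<close>.\<close>

definition loose_hom :: "'t \<Rightarrow> 't \<Rightarrow> 'l" (\<open>\<langle>_,_\<rangle>\<close>) where
  "\<langle>f,g\<rangle> = restr (lid (tcod X f)) f g"

definition hom_cell :: "'t \<Rightarrow> 't \<Rightarrow> 'c" where
  "hom_cell f g = restr_cell (lid (tcod X f)) f g"

text \<open>\<open>rep f\<close> is \<open>B(1,f)\<close>, where \<open>B\<close> is the codomain of \<open>f\<close>.\<close>

abbreviation rep :: "'t \<Rightarrow> 'l" where
  "rep f \<equiv> \<langle>tid X (tcod X f),f\<rangle>"

text \<open>The canonical 2-cell \<open>p, A(1,1) \<Rightarrow> p\<close>; for \<open>p = A(1,1)\<close> it is the multiplication.\<close>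

definition unitor :: "'l \<Rightarrow> 'c" where
  "unitor p = (THE \<rho>. globular X \<rho> [p, lid (ldom X p)] p
    \<and> \<rho> \<star> [cid X p, lid_cell (ldom X p)] = cid X p)"

text \<open>\<open>frown f\<close> is \<open>\<frown>\<^sub>f : () \<Rightarrow> B(f,f)\<close>.\<close>

definition frown :: "'t \<Rightarrow> 'c" where
  "frown f = (THE \<gamma>. globular X \<gamma> [] \<langle>f,f\<rangle>
    \<and> hom_cell f f \<star> [\<gamma>] = ccomp X (lid_cell (tcod X f)) f [])"

text \<open>\<open>smile x f y\<close> is \<open>\<smile>\<^sub>f(x,y) : E(x,f), E(f,y) \<Rightarrow> E(x,y)\<close>.\<close>

definition smile :: "'t \<Rightarrow> 't \<Rightarrow> 't \<Rightarrow> 'c" where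
  "smile x f y = (THE \<gamma>. globular X \<gamma> [\<langle>x,f\<rangle>, \<langle>f,y\<rangle>] \<langle>x,y\<rangle>
    \<and> hom_cell x y \<star> [\<gamma>] = ccomp X (unitor (lid (tcod X x))) x [hom_cell x f, hom_cell f y])"

text \<open>\<open>lid_map c\<close> is the canonical 2-cell \<open>C(1,1) \<Rightarrow> C'(1,1)\<close> with left and right tight-cells
  \<open>c : C \<rightarrow> C'\<close>, and \<open>act c x y\<close> is \<open>\<frown>\<^sub>c(x,y) : C(x,y) \<Rightarrow> C'(cx,cy)\<close>.\<close>

definition lid_map :: "'t \<Rightarrow> 'c" where
  "lid_map c = (THE \<gamma>. cell X \<gamma> c [lid (tdom X c)] (lid (tcod X c)) c
    \<and> \<gamma> \<star> [lid_cell (tdom X c)] = ccomp X (lid_cell (tcod X c)) c [])"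

definition act :: "'t \<Rightarrow> 't \<Rightarrow> 't \<Rightarrow> 'c" where
  "act c x y = (THE \<gamma>. globular X \<gamma> [\<langle>x,y\<rangle>] \<langle>tcomp X c x,tcomp X c y\<rangle>
    \<and> hom_cell (tcomp X c x) (tcomp X c y) \<star> [\<gamma>] = ccomp X (lid_map c) x [hom_cell x y])"

text \<open>
  A 2-cell \<open>f \<Rightarrow> g\<close> between parallel tight-cells \<open>A \<rightarrow> B\<close> is taken to be a 2-cell \<open>() \<Rightarrow> B(f,g)\<close>.
  \<open>tcell_comp f g h \<tau>' \<tau>\<close> is the composite of \<open>\<tau> : f \<Rightarrow> g\<close> and \<open>\<tau>' : g \<Rightarrow> h\<close>; the identity is
  \<open>frown f\<close>. For \<open>\<tau> : f \<Rightarrow> g\<close>, \<open>covar x f g \<tau>\<close> is \<open>E(x,\<tau>) : E(x,f) \<Rightarrow> E(x,g)\<close> and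
  \<open>contra f g \<tau> y\<close> is \<open>E(\<tau>,y) : E(g,y) \<Rightarrow> E(f,y)\<close>.
\<close>

definition tcell :: "'c \<Rightarrow> 't \<Rightarrow> 't \<Rightarrow> bool" where
  "tcell \<tau> f g \<longleftrightarrow> globular X \<tau> [] \<langle>f,g\<rangle>"

definition tcell_comp :: "'t \<Rightarrow> 't \<Rightarrow> 't \<Rightarrow> 'c \<Rightarrow> 'c \<Rightarrow> 'c" where
  "tcell_comp f g h \<tau>' \<tau> = smile f g h \<star> [\<tau>, \<tau>']"

definition covar :: "'t \<Rightarrow> 't \<Rightarrow> 't \<Rightarrow> 'c \<Rightarrow> 'c" where
  "covar x f g \<tau> = smile x f g \<star> [cid X \<langle>x,f\<rangle>, \<tau>]"

definition contra :: "'t \<Rightarrow> 't \<Rightarrow> 'c \<Rightarrow> 't \<Rightarrow> 'c" where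
  "contra f g \<tau> y = smile f g y \<star> [\<tau>, cid X \<langle>g,y\<rangle>]"

text \<open>
  For \<open>u : C \<rightarrow> B\<close> and \<open>k : A \<rightarrow> C\<close>, \<open>rep_cell u k\<close> is the canonical cartesian 2-cell from \<open>B(1,uk)\<close>
  to \<open>B(1,u)\<close> with left tight-cell an identity and right tight-cell \<open>k\<close>, exhibiting \<open>B(1,uk)\<close> as
  the restriction \<open>B(1,u)(1,k)\<close>. For \<open>\<beta> : p\<^sub>1, \<dots>, p\<^sub>n, B(1,u) \<Rightarrow> B'(1,u')\<close>, \<open>restr_right ps u u' k \<beta>\<close>
  is \<open>\<beta>(1,k) : p\<^sub>1, \<dots>, p\<^sub>n, B(1,uk) \<Rightarrow> B'(1,u'k)\<close>.
\<close>

definition rep_cell :: "'t \<Rightarrow> 't \<Rightarrow> 'c" where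
  "rep_cell u k = (THE \<kappa>. cell X \<kappa> (tid X (tcod X u)) [rep (tcomp X u k)] (rep u) k
    \<and> hom_cell (tid X (tcod X u)) u \<star> [\<kappa>] = hom_cell (tid X (tcod X u)) (tcomp X u k))"

definition restr_right :: "'l list \<Rightarrow> 't \<Rightarrow> 't \<Rightarrow> 't \<Rightarrow> 'c \<Rightarrow> 'c" where
  "restr_right ps u u' k \<beta> =
    (THE \<gamma>. globular X \<gamma> (ps @ [rep (tcomp X u k)]) (rep (tcomp X u' k))
      \<and> rep_cell u' k \<star> [\<gamma>] = \<beta> \<star> (map (cid X) ps @ [rep_cell u k]))"

text \<open>
  The 2-cell \<open>(1,\<phi>) : E(j,1), r\<^sub>1, \<dots>, r\<^sub>n \<Rightarrow> E(j,1)\<close> involves the canonical 2-cell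
  \<open>E(j,1), E(1,1) \<Rightarrow> E(j,1)\<close>.
\<close>

definition dense :: "'t \<Rightarrow> bool" where
  "dense j \<longleftrightarrow> j \<in> Tight X \<and>
    (let E = tcod X j; E_j = \<langle>j,tid X E\<rangle> in
      \<forall>rs. chain X rs E E \<longrightarrow>
        bij_betw (\<lambda>\<phi>. unitor E_j \<star> [cid X E_j, \<phi>])
          {\<phi>. globular X \<phi> rs (lid E)} {\<psi>. globular X \<psi> (E_j # rs) E_j})"


section \<open>Relative monads and opalgebras\<close>

text \<open>
  A \<open>j\<close>-relative monad is a triple \<open>(t, d, e)\<close> of a tight-cell, the extension operator \<open>\<dagger>\<close> and the
  unit \<open>\<eta>\<close>. An opalgebra is a pair \<open>(a, l)\<close> of a tight-cell and the 2-cell \<open>\<ltimes>\<close>.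
\<close>

fun relative_monad :: "'t \<Rightarrow> 't \<times> 'c \<times> 'c \<Rightarrow> bool" where
  "relative_monad j (t, d, e) \<longleftrightarrow>
    tight X t (tdom X j) (tcod X j) \<and> globular X d [\<langle>j,t\<rangle>] \<langle>t,t\<rangle> \<and> tcell e j t
    \<and> contra j t e t \<star> [d] = cid X \<langle>j,t\<rangle>
    \<and> d \<star> [covar j j t e \<star> [frown j]] = frown t
    \<and> smile t t t \<star> [d, d] = d \<star> [smile j t t \<star> [cid X \<langle>j,t\<rangle>, d]]"

fun relative_monad_morphism :: "'t \<Rightarrow> 't \<times> 'c \<times> 'c \<Rightarrow> 't \<times> 'c \<times> 'c \<Rightarrow> 'c \<Rightarrow> bool" where
  "relative_monad_morphism j (t, d, e) (t', d', e') \<tau> \<longleftrightarrow>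
    tcell \<tau> t t'
    \<and> tcell_comp j t t' \<tau> e = e'
    \<and> covar t t t' \<tau> \<star> [d] = contra t t' \<tau> t' \<star> [d' \<star> [covar j t t' \<tau>]]"

definition RMnd :: "'t \<Rightarrow> ('t \<times> 'c \<times> 'c, 'c) cat" where
  "RMnd j = \<lparr>
    ob = {T. relative_monad j T},
    hom = (\<lambda>T T'. {\<tau>. relative_monad_morphism j T T' \<tau>}),
    idt = (\<lambda>(t, d, e). frown t),
    cmp = (\<lambda>(t, d, e) (t', d', e') (t'', d'', e''). tcell_comp t t' t'')\<rparr>"

fun opalgebra :: "'t \<Rightarrow> 't \<times> 'c \<times> 'c \<Rightarrow> 't \<times> 'c \<Rightarrow> bool" where
  "opalgebra j (t, d, e) (a, l) \<longleftrightarrow>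
    tight X a (tdom X j) (tcod X a) \<and> globular X l [\<langle>j,t\<rangle>] \<langle>a,a\<rangle>
    \<and> l \<star> [covar j j t e \<star> [frown j]] = frown a
    \<and> smile a a a \<star> [l, l] = l \<star> [smile j t t \<star> [cid X \<langle>j,t\<rangle>, d]]"

text \<open>The action \<open>\<rho> : B(1,a), E(j,t) \<Rightarrow> B(1,a)\<close>.\<close>

fun opalg_action :: "'t \<times> 'c \<Rightarrow> 'c" where
  "opalg_action (a, l) = smile (tid X (tcod X a)) a a \<star> [cid X (rep a), l]"

fun graded_morphism ::
  "'t \<Rightarrow> 't \<times> 'c \<times> 'c \<Rightarrow> 'l list \<Rightarrow> 't \<times> 'c \<Rightarrow> 't \<times> 'c \<Rightarrow> 'c \<Rightarrow> bool" where
  "graded_morphism j (t, d, e) ps (a, l) (a', l') \<alpha> \<longleftrightarrow>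
    chain X ps (tcod X a) (tcod X a') \<and> globular X \<alpha> (ps @ [rep a]) (rep a')
    \<and> \<alpha> \<star> (map (cid X) ps @ [opalg_action (a, l)]) = opalg_action (a', l') \<star> [\<alpha>, cid X \<langle>j,t\<rangle>]"

text \<open>\<open>mediates K (a, l) u\<close>: \<open>u\<close> is a factorisation of \<open>(a, l)\<close> through \<open>K\<close>; if \<open>K\<close> is an opalgebra
  object, \<open>mediator K (a, l)\<close> is the unique one.\<close>

fun mediates :: "'t \<times> 'c \<Rightarrow> 't \<times> 'c \<Rightarrow> 't \<Rightarrow> bool" where
  "mediates (k, m) (a, l) u \<longleftrightarrow>
    tight X u (tcod X k) (tcod X a) \<and> tcomp X u k = a \<and> act u k k \<star> [m] = l"

definition mediator :: "'t \<times> 'c \<Rightarrow> 't \<times> 'c \<Rightarrow> 't" where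
  "mediator K al = (THE u. mediates K al u)"

definition opalgebra_object :: "'t \<Rightarrow> 't \<times> 'c \<times> 'c \<Rightarrow> 't \<times> 'c \<Rightarrow> bool" where
  "opalgebra_object j T K \<longleftrightarrow> opalgebra j T K
    \<and> (\<forall>al. opalgebra j T al \<longrightarrow> (\<exists>!u. mediates K al u))
    \<and> (\<forall>ps al al' \<alpha>. opalgebra j T al \<and> opalgebra j T al' \<and> graded_morphism j T ps al al' \<alpha> \<longrightarrow>
        (let u = mediator K al; u' = mediator K al' in
          \<exists>!\<beta>. globular X \<beta> (ps @ [rep u]) (rep u') \<and> \<alpha> = restr_right ps u u' (fst K) \<beta>))"

definition admits_opalgebra_object :: "'t \<Rightarrow> 't \<times> 'c \<times> 'c \<Rightarrow> bool" where
  "admits_opalgebra_object j T \<longleftrightarrow> (\<exists>K. opalgebra_object j T K)"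

text \<open>The category \<open>A/X\<close> of tight-cells with domain \<open>A\<close>.\<close>

definition under :: "'o \<Rightarrow> ('t, 't) cat" where
  "under A = \<lparr>
    ob = {f \<in> Tight X. tdom X f = A},
    hom = (\<lambda>f g. {h. tight X h (tcod X f) (tcod X g) \<and> tcomp X h f = g}),
    idt = (\<lambda>f. tid X (tcod X f)),
    cmp = (\<lambda>_ _ _. tcomp X)\<rparr>"

text \<open>The partial functor \<open>k\<close> on objects and morphisms, for a choice \<open>K T = (k\<^sub>T, \<ltimes>\<^sub>T)\<close> of an opalgebra
  object for each relative monad \<open>T\<close> that admits one.\<close>

definition k_ob :: "('t \<times> 'c \<times> 'c \<Rightarrow> 't \<times> 'c) \<Rightarrow> 't \<times> 'c \<times> 'c \<Rightarrow> 't" where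
  "k_ob K T = fst (K T)"

definition k_mor ::
  "('t \<times> 'c \<times> 'c \<Rightarrow> 't \<times> 'c) \<Rightarrow> 't \<Rightarrow> 't \<times> 'c \<times> 'c \<Rightarrow> 't \<times> 'c \<times> 'c \<Rightarrow> 'c \<Rightarrow> 't" where
  "k_mor K j T T' \<tau> =
    mediator (K T) (fst (K T'), snd (K T') \<star> [covar j (fst T) (fst T') \<tau>])"

end

end

theory Submission
  imports Defs
begin

text \<open>
  Density of \<open>j\<close> says that a 2-cell \<open>t \<Rightarrow> t'\<close> is the same as a 2-cell \<open>E(j,t) \<Rightarrow> E(j,t')\<close>. On the other
  hand, the structure 2-cell \<open>\<ltimes>\<^sub>T : E(j,t) \<Rightarrow> Opalg(T)(k,k)\<close> of an opalgebra object is invertible: if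
  \<open>v\<close> is the tight-cell induced by the opalgebra \<open>(t,\<dagger>)\<close>, then the inverse sends \<open>y\<close> to the composite
  of \<open>\<eta>\<close> and \<open>v y\<close>. That this is a retraction of \<open>\<ltimes>\<^sub>T\<close> is the first law of the monad. For a section,
  the graded morphism \<open>Opalg(T)(1,k), E(j,1), E(1,t) \<Rightarrow> Opalg(T)(1,k)\<close> given by \<open>\<ltimes>\<^sub>T\<close> extends along
  \<open>k\<close>, so that \<open>\<ltimes>\<^sub>T\<close> is natural with respect to \<open>Opalg(T)\<close>, and the unit law applies. Hence
  a tight-cell \<open>u\<close> with \<open>u k\<^sub>T = k\<^bsub>T'\<^esub>\<close> induces \<open>E(j,t) \<cong> Opalg(T)(k,k) \<Rightarrow> Opalg(T')(k',k') \<cong> E(j,t')\<close>,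
  and therefore a unique \<open>\<tau> : t \<Rightarrow> t'\<close>, which is a morphism of monads because each of these maps
  preserves identities and composites.
\<close>

text \<open>Composition in an equipment is multicategorical and restrictions are determined only up
  to isomorphism, so equations between 2-cells into \<open>E(f,g)\<close> are awkward to verify
  directly. They are transposed along the cartesian 2-cell to 2-cells into \<open>E(1,1)\<close>,
  where composition becomes one strictly associative and unital operation \<open>\<bullet>\<close>;
  its associativity, and its preservation by tight-cells, come from naturality of the unitor.
  Transposition is injective, so the laws descend to \<open>mul\<close>, and monads and opalgebras
  can be handled by evaluating at generalised elements \<open>x : rs \<Rightarrow> E(j,t)\<close>.

  Density and the universal property of opalgebra objects are available only for globular 2-cells of
  particular shapes, with arguments such as \<open>E(1,f)\<close>, \<open>E(g,1)\<close> or
  \<open>E(1,t)\<close>. Both are used in the same way: compose a given 2-cell with such arguments,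
  apply the property, and undo the step by inserting nullary identities whose tight-cells are not
  identities. For opalgebra objects this needs graded morphisms: the grading by
  \<open>Opalg(T)(1,k)\<close> and \<open>E(j,1)\<close> leaves room for inserting the identities of
  \<open>k\<close> and \<open>j\<close>.\<close>

declare comp_path.simps(2) [simp del] mediates.simps [simp del] relative_monad.simps [simp del]
  opalgebra.simps [simp del] relative_monad_morphism.simps [simp del] graded_morphism.simps [simp del]

section \<open>Composition of paths of 2-cells\<close>

context virtual_double_category
begin

lemma tid_simps [simp]:
  assumes "A \<in> Obj X"
  shows "tid X A \<in> Tight X" "tdom X (tid X A) = A" "tcod X (tid X A) = A"
  using tid_tight[OF assms] by (auto simp: tight_def)

lemma tight_Obj [simp]: "f \<in> Tight X \<Longrightarrow> tdom X f \<in> Obj X" "f \<in> Tight X \<Longrightarrow> tcod X f \<in> Obj X"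
  using tight_obj by auto

lemma loose_Obj [simp]: "p \<in> Loose X \<Longrightarrow> ldom X p \<in> Obj X" "p \<in> Loose X \<Longrightarrow> lcod X p \<in> Obj X"
  using loose_obj by auto

lemma tcomp_simps [simp]:
  assumes "f \<in> Tight X" "g \<in> Tight X" "tcod X f = tdom X g"
  shows "tcomp X g f \<in> Tight X" "tdom X (tcomp X g f) = tdom X f" "tcod X (tcomp X g f) = tcod X g"
  using tcomp_tight[of f "tdom X f" "tdom X g" g "tcod X g"] assms by (auto simp: tight_def)

lemma tcomp_tid [simp]:
  assumes "f \<in> Tight X"
  shows "A = tcod X f \<Longrightarrow> tcomp X (tid X A) f = f" "A = tdom X f \<Longrightarrow> tcomp X f (tid X A) = f"
  using tcomp_tid_left[of f "tdom X f" "tcod X f"] tcomp_tid_right[of f "tdom X f" "tcod X f"] assms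
  by (auto simp: tight_def)

lemma tcomp_assoc':
  assumes "f \<in> Tight X" "g \<in> Tight X" "h \<in> Tight X" "tcod X f = tdom X g" "tcod X g = tdom X h"
  shows "tcomp X (tcomp X h g) f = tcomp X h (tcomp X g f)"
  using tcomp_assoc[of f "tdom X f" "tdom X g" g "tdom X h" h "tcod X h"] assms
  by (auto simp: tight_def)

lemma chain_Obj: "chain X ps A B \<Longrightarrow> A \<in> Obj X \<and> B \<in> Obj X"
  by (induction ps arbitrary: B) auto

lemma chain_append: "chain X (ps @ qs) A B \<longleftrightarrow> (\<exists>C. chain X ps C B \<and> chain X qs A C)"
  by (induction ps arbitrary: B) (auto dest: chain_Obj)

lemma cellD:
  assumes "cell X \<phi> f ps q g"
  shows "\<phi> \<in> Cell X" "cleft X \<phi> = f" "cright X \<phi> = g" "src X \<phi> = ps" "tgt X \<phi> = q"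
    "f \<in> Tight X" "g \<in> Tight X" "tcod X f = lcod X q" "tcod X g = ldom X q"
    "chain X ps (tdom X g) (tdom X f)" "q \<in> Loose X"
  using assms cell_tight[of \<phi>] cell_src[of \<phi>] cell_tgt[of \<phi>] by (auto simp: cell_def loose_def)

lemma cell_cid: "p \<in> Loose X \<Longrightarrow> cell X (cid X p) (tid X (lcod X p)) [p] p (tid X (ldom X p))"
  using cid_cell[of p "ldom X p" "lcod X p"] by (simp add: loose_def)

text \<open>A typing judgement for juxtapositions, parallel to \<open>cell\<close>:
  \<open>rs\<close> is the total domain and \<open>qs\<close> lists the codomains. The end
  \<open>g\<close> is recorded because an empty path still sits on a tight-cell, and because
  consecutive paths are glued there.\<close>

definition path where
  "path f \<psi>s rs qs g \<longleftrightarrow>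
    f \<in> Tight X \<and> cell_path X f \<psi>s g \<and> concat (map (src X) \<psi>s) = rs \<and> map (tgt X) \<psi>s = qs"

lemma path_Nil: "f \<in> Tight X \<Longrightarrow> path f [] [] [] f"
  by (simp add: path_def)

lemma path_Cons:
  "cell X \<psi> f ps q h \<Longrightarrow> path h \<psi>s rs qs g \<Longrightarrow> path f (\<psi> # \<psi>s) (ps @ rs) (q # qs) g"
  by (auto simp: path_def dest: cellD)

lemma path_single: "cell X \<psi> f ps q g \<Longrightarrow> path f [\<psi>] ps [q] g"
  using path_Cons[OF _ path_Nil, of \<psi> f ps q g] by (auto dest: cellD)

lemma path_append:
  "path f \<psi>s rs qs h \<Longrightarrow> path h \<xi>s rs' qs' g \<Longrightarrow> path f (\<psi>s @ \<xi>s) (rs @ rs') (qs @ qs') g"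
proof (induction \<psi>s arbitrary: f rs qs)
  case (Cons \<psi> \<psi>s)
  then show ?case by (auto simp: path_def dest: cell_tight)
qed (auto simp: path_def)

lemma path_cids: "chain X ps A B \<Longrightarrow> path (tid X B) (map (cid X) ps) ps ps (tid X A)"
proof (induction ps arbitrary: B)
  case Nil
  then show ?case by (auto intro: path_Nil)
next
  case (Cons p ps)
  then show ?case using path_Cons[OF cell_cid Cons.IH, of p] by auto
qed

lemma cell_ccomp:
  assumes "cell X \<phi> f qs q g" "path f' \<psi>s rs qs g'" "tcod X f' = tdom X f"
  shows "cell X (ccomp X \<phi> f' \<psi>s) (tcomp X f f') rs q (tcomp X g g')"
  using ccomp_cell[of \<phi> f' \<psi>s g'] assms cellD[OF assms(1)] by (auto simp: path_def)

lemma ccomp_assoc_path: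
  assumes "cell X \<phi> f qs q g" "path f' \<psi>s rs qs g'" "path h \<xi>s ss rs k"
    "tcod X f' = tdom X f" "tcod X h = tdom X f'"
  shows "ccomp X (ccomp X \<phi> f' \<psi>s) h \<xi>s = ccomp X \<phi> (tcomp X f' h) (comp_path X \<psi>s h \<xi>s)"
  using ccomp_assoc[of \<phi> f' \<psi>s g' h \<xi>s k] assms cellD[OF assms(1)] by (auto simp: path_def)

text \<open>Needed to evaluate \<open>comp_path\<close>: the tight-cell that it hands on after
  consuming a block is the right end of that block, also when the block is empty.\<close>

lemma path_end:
  "path f \<psi>s rs qs g \<Longrightarrow> (if \<psi>s = [] then f else cright X (last \<psi>s)) = g"
proof (induction \<psi>s arbitrary: f rs qs)
  case (Cons \<psi> \<psi>s)
  then have "path (cright X \<psi>) \<psi>s (concat (map (src X) \<psi>s)) (map (tgt X) \<psi>s) g"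
    by (auto simp: path_def dest: cell_tight)
  with Cons.IH show ?case by fastforce
qed (simp add: path_def)

text \<open>The codomains of \<open>\<xi>s\<close> form the domain of \<open>\<psi>\<close>, so the
  lengths agree and \<open>comp_path\<close> cuts exactly between \<open>\<xi>s\<close> and
  \<open>\<xi>s'\<close>.\<close>

lemma comp_path_Cons:
  assumes "cell X \<psi> f ps q g" "path h \<xi>s ss ps h'"
  shows "comp_path X (\<psi> # \<psi>s) h (\<xi>s @ \<xi>s') = ccomp X \<psi> h \<xi>s # comp_path X \<psi>s h' \<xi>s'"
proof -
  have "length \<xi>s = length (src X \<psi>)"
    using assms cellD[OF assms(1)] unfolding path_def by (metis length_map)
  with path_end[OF assms(2)] show ?thesis by (auto simp: Let_def comp_path.simps(2))
qed

lemma comp_path_cids_left: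
  "path h \<xi>s ss ps k \<Longrightarrow> comp_path X (map (cid X) ps) h \<xi>s = \<xi>s"
proof (induction \<xi>s arbitrary: h ss ps)
  case Nil
  then show ?case by (simp add: path_def)
next
  case (Cons \<xi> \<xi>s)
  then have \<xi>: "cell X \<xi> h (src X \<xi>) (tgt X \<xi>) (cright X \<xi>)"
    and p: "path (cright X \<xi>) \<xi>s (concat (map (src X) \<xi>s)) (map (tgt X) \<xi>s) k"
    and ps: "ps = tgt X \<xi> # map (tgt X) \<xi>s"
    by (auto simp: path_def cell_def dest: cell_tight)
  have "comp_path X (map (cid X) ps) h ([\<xi>] @ \<xi>s)
    = ccomp X (cid X (tgt X \<xi>)) h [\<xi>] # comp_path X (map (cid X) (map (tgt X) \<xi>s)) (cright X \<xi>) \<xi>s"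
    using comp_path_Cons[OF cell_cid path_single[OF \<xi>]] cellD[OF \<xi>] ps by auto
  with Cons.IH[OF p] ccomp_cid_left[of \<xi>] cellD[OF \<xi>] show ?case by auto
qed

lemma comp_path_append:
  "path f \<psi>s ps qs g \<Longrightarrow> path h \<xi>s ss ps h' \<Longrightarrow>
    comp_path X (\<psi>s @ \<psi>s') h (\<xi>s @ \<xi>s') = comp_path X \<psi>s h \<xi>s @ comp_path X \<psi>s' h' \<xi>s'"
proof (induction \<psi>s arbitrary: f ps qs h \<xi>s ss)
  case Nil
  then show ?case by (auto simp: path_def)
next
  case (Cons \<psi> \<psi>s)
  then have \<psi>: "cell X \<psi> f (src X \<psi>) (tgt X \<psi>) (cright X \<psi>)"
    and p: "path (cright X \<psi>) \<psi>s (concat (map (src X) \<psi>s)) (map (tgt X) \<psi>s) g"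
    and ps: "map (tgt X) \<xi>s = src X \<psi> @ concat (map (src X) \<psi>s)"
    by (auto simp: path_def cell_def dest: cell_tight)
  then obtain us vs where uv: "\<xi>s = us @ vs" "map (tgt X) us = src X \<psi>"
      "map (tgt X) vs = concat (map (src X) \<psi>s)"
    by (auto simp: map_eq_append_conv)
  \<comment> \<open>Cutting a path requires the tight-cell \<open>m\<close> at the cut. It is found
    by walking along \<open>us\<close>; for empty \<open>us\<close> it is \<open>h\<close>.\<close>
  have split: "\<exists>m. path h us (concat (map (src X) us)) (map (tgt X) us) m
      \<and> path m vs (concat (map (src X) vs)) (map (tgt X) vs) h'"
    if "cell_path X h (us @ vs) h'" "h \<in> Tight X" for h us
    using that
  proof (induction us arbitrary: h)
    case (Cons u us)
    then have "cell X u h (src X u) (tgt X u) (cright X u)" by (auto simp: cell_def)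
    moreover obtain m where "path (cright X u) us (concat (map (src X) us)) (map (tgt X) us) m"
      "path m vs (concat (map (src X) vs)) (map (tgt X) vs) h'"
      using Cons.IH[of "cright X u"] Cons.prems cell_tight by auto
    ultimately show ?case using path_Cons by fastforce
  qed (auto simp: path_def)
  obtain m where m: "path h us (concat (map (src X) us)) (src X \<psi>) m"
    "path m vs (concat (map (src X) vs)) (concat (map (src X) \<psi>s)) h'"
    using split[of h us] Cons.prems(2) uv by (auto simp: path_def)
  show ?case
    using comp_path_Cons[OF \<psi> m(1)] Cons.IH[OF p m(2)] unfolding uv(1) append_assoc append_Cons by simp
qed

lemma comp_path_single:
  assumes "cell X \<psi> f ps q g" "path h \<xi>s ss ps h'"
  shows "comp_path X [\<psi>] h \<xi>s = [ccomp X \<psi> h \<xi>s]"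
  using comp_path_Cons[OF assms, of "[]" "[]"] by simp

lemma cell_ccomp1:
  assumes "cell X \<phi> f [p] q g" "cell X \<psi> f' rs p g'"
  shows "cell X (ccomp X \<phi> f' [\<psi>]) (tcomp X f f') rs q (tcomp X g g')"
  using cell_ccomp[OF assms(1) path_single[OF assms(2)]] cellD[OF assms(1)] cellD[OF assms(2)] by simp

lemma ccomp_assoc1:
  assumes "cell X \<phi> f [p] q g" "cell X \<psi> f' ps p g'" "path h \<xi>s rs ps k" "tcod X h = tdom X f'"
  shows "ccomp X (ccomp X \<phi> f' [\<psi>]) h \<xi>s = ccomp X \<phi> (tcomp X f' h) [ccomp X \<psi> h \<xi>s]"
  using ccomp_assoc_path[OF assms(1) path_single[OF assms(2)] assms(3)]
    comp_path_single[OF assms(2,3)] cellD[OF assms(1)] cellD[OF assms(2)] assms(4) by simp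

lemma ccomp_cid:
  assumes "cell X \<phi> f rs q g"
  shows "ccomp X (cid X q) f [\<phi>] = \<phi>" "ccomp X \<phi> (tid X (tdom X f)) (map (cid X) rs) = \<phi>"
  using ccomp_cid_left[of \<phi>] ccomp_cid_right[of \<phi>] cellD[OF assms] by auto

lemma ccomp_assoc2:
  assumes "cell X \<phi> f [p,p'] q g" "cell X \<psi> f' ps p m" "cell X \<psi>' m ps' p' g'"
    "path h \<xi>s rs ps h'" "path h' \<xi>s' rs' ps' k" "tcod X h = tdom X f'"
  shows "ccomp X (ccomp X \<phi> f' [\<psi>,\<psi>']) h (\<xi>s @ \<xi>s')
    = ccomp X \<phi> (tcomp X f' h) [ccomp X \<psi> h \<xi>s, ccomp X \<psi>' h' \<xi>s']"
proof -
  have 1: "path f' [\<psi>,\<psi>'] (ps @ ps') [p,p'] g'"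
    using path_Cons[OF assms(2) path_single[OF assms(3)]] by simp
  show ?thesis
    using ccomp_assoc_path[OF assms(1) 1 path_append[OF assms(4,5)]]
      comp_path_Cons[OF assms(2,4)] comp_path_single[OF assms(3,5)]
      cellD[OF assms(1)] cellD[OF assms(2)] assms(6) by simp
qed

end

section \<open>Loose-identities\<close>

context virtual_equipment
begin

lemma lid_cell:
  assumes "A \<in> Obj X"
  shows "cell X (lid_cell X A) (tid X A) [] (lid X A) (tid X A)"
    "lid X A \<in> Loose X" "ldom X (lid X A) = A" "lcod X (lid X A) = A" "opcartesian X (lid_cell X A)"
proof -
  have "\<exists>p. loose X p A A \<and> globular X (lid_cell X A) [] p \<and> opcartesian X (lid_cell X A)"
    unfolding lid_cell_def using someI_ex[OF has_loose_identities[OF assms]] .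
  then show "cell X (lid_cell X A) (tid X A) [] (lid X A) (tid X A)"
    "lid X A \<in> Loose X" "ldom X (lid X A) = A" "lcod X (lid X A) = A" "opcartesian X (lid_cell X A)"
    by (auto simp: lid_def globular_def loose_def cell_def)
qed

lemmas [simp] = lid_cell(2,3,4)

lemma path_lid_cell:
  assumes "A \<in> Obj X" "chain X ps A B" "chain X rs C A"
  shows "path (tid X B) (map (cid X) ps @ [lid_cell X A] @ map (cid X) rs) (ps @ rs)
    (ps @ [lid X A] @ rs) (tid X C)"
  using path_append[OF path_cids[OF assms(2)] path_append[OF path_single[OF lid_cell(1)[OF assms(1)]]
      path_cids[OF assms(3)]]] by simp

lemma vcomp_cell: "cell X \<phi> f ps q g \<Longrightarrow> \<phi> \<star>\<^bsub>X\<^esub> \<psi>s = ccomp X \<phi> (tid X (tdom X f)) \<psi>s"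
  by (simp add: vcomp_def cellD(2))

lemma lid_cell_factor:
  assumes A: "A \<in> Obj X" and \<chi>: "cell X \<chi> f (ps @ rs) q g" and ps: "chain X ps A (tdom X f)"
  shows "\<exists>!\<psi>. cell X \<psi> f (ps @ [lid X A] @ rs) q g
    \<and> \<psi> \<star>\<^bsub>X\<^esub> (map (cid X) ps @ [lid_cell X A] @ map (cid X) rs) = \<chi>"
proof -
  note l = lid_cell(1,2,3,4)[OF A] lid_cell(5)[OF A]
  have \<iota>: "src X (lid_cell X A) = []" "tgt X (lid_cell X A) = lid X A"
    using cellD[OF l(1)] by auto
  show ?thesis
    using l(5)[unfolded opcartesian_def \<iota>, THEN conjunct2, rule_format, of \<chi> ps rs]
      ps cellD[OF \<chi>] l(4) by simp
qed

text \<open>Extensionality for loose-identities: both 2-cells factor the same composite through the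
  opcartesian \<open>lid_cell\<close>. The equations below between 2-cells with a loose-identity in
  the domain are tested by inserting \<open>lid_cell\<close> there.\<close>

lemma lid_cell_unique:
  assumes A: "A \<in> Obj X"
    and \<psi>: "cell X \<psi> f (ps @ [lid X A] @ rs) q g" "cell X \<psi>' f (ps @ [lid X A] @ rs) q g"
    and eq: "ccomp X \<psi> (tid X (tdom X f)) (map (cid X) ps @ [lid_cell X A] @ map (cid X) rs)
      = ccomp X \<psi>' (tid X (tdom X f)) (map (cid X) ps @ [lid_cell X A] @ map (cid X) rs)"
  shows "\<psi> = \<psi>'"
proof -
  have ps: "chain X ps A (tdom X f)" and rs: "chain X rs (tdom X g) A"
    using cellD(10)[OF \<psi>(1)] A by (auto simp: chain_append)
  let ?c = "ccomp X \<psi>' (tid X (tdom X f)) (map (cid X) ps @ [lid_cell X A] @ map (cid X) rs)"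
  have "cell X ?c f (ps @ rs) q g"
    using cell_ccomp[OF \<psi>(2) path_lid_cell[OF A ps rs]] cellD[OF \<psi>(2)] by simp
  note ex = lid_cell_factor[OF A this ps]
  have "cell X \<psi> f (ps @ [lid X A] @ rs) q g
      \<and> \<psi> \<star>\<^bsub>X\<^esub> (map (cid X) ps @ [lid_cell X A] @ map (cid X) rs) = ?c"
    unfolding vcomp_cell[OF \<psi>(1)] using \<psi>(1) eq by blast
  moreover have "cell X \<psi>' f (ps @ [lid X A] @ rs) q g
      \<and> \<psi>' \<star>\<^bsub>X\<^esub> (map (cid X) ps @ [lid_cell X A] @ map (cid X) rs) = ?c"
    unfolding vcomp_cell[OF \<psi>(2)] using \<psi>(2) by blast
  ultimately show ?thesis
    using the1_equality[OF ex] by blast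
qed

lemma unitor:
  assumes "p \<in> Loose X"
  shows "cell X (unitor X p) (tid X (lcod X p)) [p, lid X (ldom X p)] p (tid X (ldom X p))"
    "ccomp X (unitor X p) (tid X (lcod X p)) [cid X p, lid_cell X (ldom X p)] = cid X p"
proof -
  have "\<exists>!\<rho>. globular X \<rho> [p, lid X (ldom X p)] p
      \<and> \<rho> \<star>\<^bsub>X\<^esub> [cid X p, lid_cell X (ldom X p)] = cid X p"
    using lid_cell_factor[of "ldom X p" "cid X p" "tid X (lcod X p)" "[p]" "[]" p "tid X (ldom X p)"]
      cell_cid[OF assms] assms
    unfolding globular_def by simp
  from theI'[OF this]
  have "globular X (unitor X p) [p, lid X (ldom X p)] p
      \<and> unitor X p \<star>\<^bsub>X\<^esub> [cid X p, lid_cell X (ldom X p)] = cid X p"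
    unfolding unitor_def .
  then show "cell X (unitor X p) (tid X (lcod X p)) [p, lid X (ldom X p)] p (tid X (ldom X p))"
    "ccomp X (unitor X p) (tid X (lcod X p)) [cid X p, lid_cell X (ldom X p)] = cid X p"
    using assms vcomp_cell[of "unitor X p"] by (auto simp: globular_def)
qed

text \<open>The identity of \<open>f\<close> in transposed form: a nullary 2-cell into the
  loose-identity with \<open>f\<close> on both sides. It is the unit for \<open>\<bullet>\<close> at
  \<open>f\<close>, and \<open>frown f\<close> is the globular 2-cell that it induces.\<close>

definition uid where "uid f = ccomp X (lid_cell X (tcod X f)) f []"

lemma cell_uid:
  assumes "f \<in> Tight X"
  shows "cell X (uid f) f [] (lid X (tcod X f)) f"
  using cell_ccomp[OF lid_cell(1) path_Nil[OF assms], of "tcod X f"] assms by (simp add: uid_def)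

lemma uid_ccomp:
  assumes "f \<in> Tight X" "h \<in> Tight X" "tcod X h = tdom X f"
  shows "ccomp X (uid f) h [] = uid (tcomp X f h)"
  using ccomp_assoc_path[OF lid_cell(1) path_Nil[OF assms(1)] path_Nil[OF assms(2)], of "tcod X f"] assms
  by (simp add: uid_def)

lemma lid_map:
  assumes "c \<in> Tight X"
  shows "cell X (lid_map X c) c [lid X (tdom X c)] (lid X (tcod X c)) c"
    "ccomp X (lid_map X c) (tid X (tdom X c)) [lid_cell X (tdom X c)] = uid c"
proof -
  have "\<exists>!\<gamma>. cell X \<gamma> c [lid X (tdom X c)] (lid X (tcod X c)) c
      \<and> \<gamma> \<star>\<^bsub>X\<^esub> [lid_cell X (tdom X c)] = ccomp X (lid_cell X (tcod X c)) c []"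
    using lid_cell_factor[of "tdom X c" "uid c" c "[]" "[]" "lid X (tcod X c)" c] cell_uid[OF assms] assms
    unfolding uid_def by simp
  from theI'[OF this]
  have "cell X (lid_map X c) c [lid X (tdom X c)] (lid X (tcod X c)) c
      \<and> lid_map X c \<star>\<^bsub>X\<^esub> [lid_cell X (tdom X c)] = uid c"
    unfolding lid_map_def uid_def .
  then show "cell X (lid_map X c) c [lid X (tdom X c)] (lid X (tcod X c)) c"
    "ccomp X (lid_map X c) (tid X (tdom X c)) [lid_cell X (tdom X c)] = uid c"
    using vcomp_cell[of "lid_map X c"] by auto
qed

lemma lid_map_uid:
  assumes "f \<in> Tight X" "c \<in> Tight X" "tcod X f = tdom X c"
  shows "ccomp X (lid_map X c) f [uid f] = uid (tcomp X c f)"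
proof -
  have "ccomp X (lid_map X c) f [uid f]
      = ccomp X (ccomp X (lid_map X c) (tid X (tdom X c)) [lid_cell X (tdom X c)]) f []"
    using ccomp_assoc1[OF lid_map(1)[OF assms(2)] lid_cell(1) path_Nil[OF assms(1)]] assms
    by (simp add: uid_def)
  with assms show ?thesis by (simp add: lid_map uid_ccomp)
qed

lemma lid_map_tid:
  assumes "A \<in> Obj X"
  shows "lid_map X (tid X A) = cid X (lid X A)"
proof (rule lid_cell_unique[OF assms, where ps="[]" and rs="[]"])
  show "cell X (lid_map X (tid X A)) (tid X A) ([] @ [lid X A] @ []) (lid X A) (tid X A)"
    using lid_map(1)[of "tid X A"] assms by simp
  show "cell X (cid X (lid X A)) (tid X A) ([] @ [lid X A] @ []) (lid X A) (tid X A)"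
    using cell_cid[of "lid X A"] assms by simp
  show "ccomp X (lid_map X (tid X A)) (tid X (tdom X (tid X A)))
      (map (cid X) [] @ [lid_cell X A] @ map (cid X) [])
    = ccomp X (cid X (lid X A)) (tid X (tdom X (tid X A)))
      (map (cid X) [] @ [lid_cell X A] @ map (cid X) [])"
    using lid_map(2)[of "tid X A"] ccomp_cid(1)[OF lid_cell(1)[OF assms]]
      ccomp_cid(2)[OF lid_cell(1)[OF assms]] assms
    by (simp add: uid_def)
qed

text \<open>Both sides become \<open>uid (tcomp X d c)\<close> when \<open>lid_cell\<close> is
  inserted.\<close>

lemma lid_map_tcomp:
  assumes "c \<in> Tight X" "d \<in> Tight X" "tcod X c = tdom X d"
  shows "lid_map X (tcomp X d c) = ccomp X (lid_map X d) c [lid_map X c]"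
proof -
  note c = lid_map[OF assms(1)]
  have d: "cell X (lid_map X d) d [lid X (tcod X c)] (lid X (tcod X d)) d"
    using lid_map(1)[OF assms(2)] assms(3) by simp
  show ?thesis
  proof (rule lid_cell_unique[where ps="[]" and rs="[]"])
    show "tdom X c \<in> Obj X" using assms by simp
    show "cell X (lid_map X (tcomp X d c)) (tcomp X d c) ([] @ [lid X (tdom X c)] @ [])
        (lid X (tcod X d)) (tcomp X d c)"
      using lid_map(1)[of "tcomp X d c"] assms by simp
    show "cell X (ccomp X (lid_map X d) c [lid_map X c]) (tcomp X d c) ([] @ [lid X (tdom X c)] @ [])
        (lid X (tcod X d)) (tcomp X d c)"
      using cell_ccomp1[OF d c(1)] by simp
    show "ccomp X (lid_map X (tcomp X d c)) (tid X (tdom X (tcomp X d c)))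
        (map (cid X) [] @ [lid_cell X (tdom X c)] @ map (cid X) [])
      = ccomp X (ccomp X (lid_map X d) c [lid_map X c]) (tid X (tdom X (tcomp X d c)))
        (map (cid X) [] @ [lid_cell X (tdom X c)] @ map (cid X) [])"
      using lid_map(2)[of "tcomp X d c"] c(2) assms
        ccomp_assoc1[OF d c(1) path_single[OF lid_cell(1)]]
      by (simp add: lid_map_uid)
  qed
qed

text \<open>For \<open>\<psi>\<close> with codomain a loose-identity, \<open>\<phi> \<bullet> \<psi>\<close> is the right action of \<open>\<psi>\<close> on \<open>\<phi>\<close>. On 2-cells into
  \<open>E(1,1)\<close> this is the composition of \<open>E\<close>, with identities \<open>uid f\<close>.\<close>

definition rmul (infixl \<open>\<bullet>\<close> 75) where
  "\<phi> \<bullet> \<psi> = ccomp X (unitor X (tgt X \<phi>)) (cleft X \<phi>) [\<phi>, \<psi>]"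

lemma rmul_cell:
  assumes "cell X \<phi> f rs q g" 
  shows "\<phi> \<bullet> \<psi> = ccomp X (unitor X q) f [\<phi>, \<psi>]"
  using cellD[OF assms] by (simp add: rmul_def)

lemma path2: "cell X \<phi> f rs q g \<Longrightarrow> cell X \<psi> g ss p h \<Longrightarrow> path f [\<phi>,\<psi>] (rs @ ss) [q,p] h"
  using path_Cons[OF _ path_single] by simp

lemma cell_rmul:
  assumes "cell X \<phi> f rs q g" "cell X \<psi> g ss (lid X (ldom X q)) h"
  shows "cell X (\<phi> \<bullet> \<psi>) f (rs @ ss) q h"
proof -
  note q = cellD[OF assms(1)] cellD[OF assms(2)]
  show ?thesis
    using cell_ccomp[OF unitor(1) path2[OF assms]] q
    by (simp add: rmul_cell[OF assms(1)])
qed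

lemma rmul_uid:
  assumes "cell X \<phi> f rs q g"
  shows "\<phi> \<bullet> uid g = \<phi>"
proof -
  note q = cellD[OF assms]
  have "ccomp X (ccomp X (unitor X q) (tid X (lcod X q)) [cid X q, lid_cell X (ldom X q)]) f ([\<phi>] @ [])
     = ccomp X (unitor X q) (tcomp X (tid X (lcod X q)) f)
          [ccomp X (cid X q) f [\<phi>], ccomp X (lid_cell X (ldom X q)) g []]"
    using q by (intro ccomp_assoc2[OF unitor(1) cell_cid lid_cell(1) path_single[OF assms] path_Nil]) auto
  then show ?thesis using unitor(2)[of q] q ccomp_cid(1)[OF assms]
    by (simp add: rmul_cell[OF assms] uid_def)
qed

lemma rmul_ccomp:
  assumes "cell X \<phi> f rs q g" "cell X \<psi> g ss (lid X (ldom X q)) h"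
    "path f' \<xi>s us rs m" "path m \<xi>s' us' ss k" "tcod X f' = tdom X f"
  shows "ccomp X (\<phi> \<bullet> \<psi>) f' (\<xi>s @ \<xi>s') = ccomp X \<phi> f' \<xi>s \<bullet> ccomp X \<psi> m \<xi>s'"
  using ccomp_assoc2[OF unitor(1) assms] cellD[OF assms(1)]
    rmul_cell[OF assms(1)] rmul_cell[OF cell_ccomp[OF assms(1,3,5)]]
  by simp

text \<open>Inserting \<open>lid_cell\<close> in the last position turns both sides into
  \<open>\<kappa>\<close>: on the left by the defining equation of the unitor, on the right because
  \<open>lid_map g\<close> becomes \<open>uid g\<close>, a right unit for
  \<open>\<bullet>\<close>.\<close>

lemma unitor_natural_base:
  assumes \<kappa>: "cell X \<kappa> f (ps @ [p]) q g"
  shows "ccomp X \<kappa> (tid X (tdom X f)) (map (cid X) ps @ [unitor X p]) = \<kappa> \<bullet> lid_map X g"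
proof -
  note c = cellD[OF \<kappa>]
  have p: "p \<in> Loose X" "ldom X p = tdom X g" and ps: "chain X ps (lcod X p) (tdom X f)"
    using c(10) by (auto simp: chain_append)
  let ?A = "ldom X p" and ?l = "tid X (tdom X f)"
  have pps: "chain X (ps @ [p]) ?A (tdom X f)" using c(10) p by simp
  have A: "?A \<in> Obj X" using loose_Obj[OF p(1)] by blast
  note u = unitor[OF p(1)]
  have pu: "path ?l (map (cid X) ps @ [unitor X p]) (ps @ [p, lid X ?A]) (ps @ [p]) (tid X ?A)"
    using path_append[OF path_cids[OF ps] path_single[OF u(1)]] .
  have lg: "cell X (lid_map X g) g [lid X ?A] (lid X (tcod X g)) g"
    using lid_map(1)[OF c(7)] p by simp
  have pc: "path ?l (map (cid X) (ps @ [p])) (ps @ [p]) (ps @ [p]) (tid X ?A)"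
    using path_cids[OF pps] .
  have pl: "path (tid X ?A) [lid_cell X ?A] [] [lid X ?A] (tid X ?A)"
    using path_single[OF lid_cell(1)[OF A]] .
  have pcl: "path ?l (map (cid X) (ps @ [p]) @ [lid_cell X ?A]) (ps @ [p]) (ps @ [p, lid X ?A]) (tid X ?A)"
    using path_append[OF pc pl] by simp
  have lhs: "ccomp X (ccomp X \<kappa> ?l (map (cid X) ps @ [unitor X p])) ?l
      (map (cid X) (ps @ [p]) @ [lid_cell X ?A]) = \<kappa>"
  proof -
    have "comp_path X (map (cid X) ps @ [unitor X p]) ?l (map (cid X) ps @ [cid X p, lid_cell X ?A])
       = comp_path X (map (cid X) ps) ?l (map (cid X) ps)
         @ comp_path X [unitor X p] (tid X (lcod X p)) [cid X p, lid_cell X ?A]"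
      by (rule comp_path_append[OF path_cids[OF ps] path_cids[OF ps]])
    also have "\<dots> = map (cid X) (ps @ [p])"
      using comp_path_cids_left[OF path_cids[OF ps]]
        comp_path_single[OF u(1) path2[OF cell_cid[OF p(1)] lid_cell(1)[OF A]]] u(2) by simp
    finally show ?thesis
      using ccomp_assoc_path[OF \<kappa> pu pcl] c ccomp_cid(2)[OF \<kappa>] by simp
  qed
  have rhs: "ccomp X (\<kappa> \<bullet> lid_map X g) ?l (map (cid X) (ps @ [p]) @ [lid_cell X ?A]) = \<kappa>"
    using rmul_ccomp[OF \<kappa> _ pc pl] lg c p ccomp_cid(2)[OF \<kappa>] lid_map(2)[OF c(7)] rmul_uid[OF \<kappa>] by simp
  show ?thesis
  proof (rule lid_cell_unique[OF A, where ps="ps @ [p]" and rs="[]"])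
    show "cell X (ccomp X \<kappa> ?l (map (cid X) ps @ [unitor X p])) f ((ps @ [p]) @ [lid X ?A] @ []) q g"
      using cell_ccomp[OF \<kappa> pu] c p by simp
    show "cell X (\<kappa> \<bullet> lid_map X g) f ((ps @ [p]) @ [lid X ?A] @ []) q g"
      using cell_rmul[OF \<kappa>] lg c by simp
  qed (use lhs rhs in simp)
qed

text \<open>Taking \<open>\<kappa>\<close> to be a unitor gives associativity of \<open>\<bullet>\<close>, and taking it to be \<open>lid_map c\<close> shows that
  \<open>c\<close> preserves \<open>\<bullet>\<close>.\<close>

lemma rmul_natural:
  assumes \<kappa>: "cell X \<kappa> f (ps @ [p]) q g" and \<psi>s: "path f' \<psi>s ss ps h"
    and \<phi>: "cell X \<phi> h rs p k" and \<psi>: "cell X \<psi> k ts (lid X (ldom X p)) m"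
    and f': "tcod X f' = tdom X f"
  shows "ccomp X \<kappa> f' (\<psi>s @ [\<phi> \<bullet> \<psi>]) = ccomp X \<kappa> f' (\<psi>s @ [\<phi>]) \<bullet> ccomp X (lid_map X g) k [\<psi>]"
proof -
  note c = cellD[OF \<kappa>]
  have p: "p \<in> Loose X" "ldom X p = tdom X g" and ps: "chain X ps (lcod X p) (tdom X f)"
    using c(10) by (auto simp: chain_append)
  let ?A = "ldom X p" and ?l = "tid X (tdom X f)"
  have f'T: "f' \<in> Tight X" using \<psi>s by (simp add: path_def)
  note u = unitor[OF p(1)]
  have pu: "path ?l (map (cid X) ps @ [unitor X p]) (ps @ [p, lid X ?A]) (ps @ [p]) (tid X ?A)"
    using path_append[OF path_cids[OF ps] path_single[OF u(1)]] .
  have lg: "cell X (lid_map X g) g [lid X ?A] (lid X (ldom X q)) g"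
    using lid_map(1)[OF c(7)] p c by simp
  have p2: "path f' (\<psi>s @ [\<phi>]) (ss @ rs) (ps @ [p]) k" 
    using path_append[OF \<psi>s path_single[OF \<phi>]] .
  have p3: "path f' (\<psi>s @ [\<phi>,\<psi>]) (ss @ rs @ ts) (ps @ [p, lid X ?A]) m"
    using path_append[OF \<psi>s path2[OF \<phi> \<psi>]] .
  have cp: "comp_path X (map (cid X) ps @ [unitor X p]) f' (\<psi>s @ [\<phi>,\<psi>]) = \<psi>s @ [\<phi> \<bullet> \<psi>]"
    using comp_path_append[OF path_cids[OF ps] \<psi>s] comp_path_cids_left[OF \<psi>s]
      comp_path_single[OF u(1) path2[OF \<phi> \<psi>]] by (simp add: rmul_cell[OF \<phi>])
  have "ccomp X \<kappa> f' (\<psi>s @ [\<phi> \<bullet> \<psi>])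
      = ccomp X (ccomp X \<kappa> ?l (map (cid X) ps @ [unitor X p])) f' (\<psi>s @ [\<phi>,\<psi>])"
    using ccomp_assoc_path[OF \<kappa> pu p3] cp f' f'T c(6) by simp
  also have "\<dots> = ccomp X (\<kappa> \<bullet> lid_map X g) f' ((\<psi>s @ [\<phi>]) @ [\<psi>])"
    by (simp add: unitor_natural_base[OF \<kappa>])
  also have "\<dots> = ccomp X \<kappa> f' (\<psi>s @ [\<phi>]) \<bullet> ccomp X (lid_map X g) k [\<psi>]"
    by (rule rmul_ccomp[OF \<kappa> lg p2 path_single[OF \<psi>] f'])
  finally show ?thesis .
qed

lemma rmul_assoc:
  assumes \<phi>: "cell X \<phi> f rs q g" and \<psi>: "cell X \<psi> g ss (lid X (ldom X q)) h"
    and \<chi>: "cell X \<chi> h ts (lid X (ldom X q)) k"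
  shows "\<phi> \<bullet> \<psi> \<bullet> \<chi> = \<phi> \<bullet> (\<psi> \<bullet> \<chi>)"
proof -
  note c = cellD[OF \<phi>]
  have "cell X (unitor X q) (tid X (lcod X q)) ([q] @ [lid X (ldom X q)]) q (tid X (ldom X q))"
    using unitor(1) c by simp
  from rmul_natural[OF this path_single[OF \<phi>] \<psi>, of \<chi> ts k] \<chi> c
  show ?thesis
    by (simp add: rmul_cell[OF \<phi>] rmul_cell[OF cell_rmul[OF \<phi> \<psi>, unfolded rmul_cell[OF \<phi>]]]
        lid_map_tid ccomp_cid(1)[OF \<chi>])
qed

text \<open>The defining equation of the unitor gives only the right unit law. The left one is
  proved first for the identity 2-cell of the loose-identity, by inserting \<open>lid_cell\<close>,
  and then transported to \<open>\<psi>\<close> by precomposition.\<close>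

lemma uid_rmul:
  assumes \<psi>: "cell X \<psi> f ss (lid X (tcod X f)) g"
  shows "uid f \<bullet> \<psi> = \<psi>"
proof -
  note c = cellD[OF \<psi>]
  let ?A = "tcod X f"
  have A: "?A \<in> Obj X" using c by simp
  note l = lid_cell(1)[OF A]
  have i: "cell X (cid X (lid X ?A)) (tid X ?A) [lid X ?A] (lid X ?A) (tid X ?A)"
    using cell_cid[of "lid X ?A"] A by simp
  have il: "cell X (lid_cell X ?A \<bullet> cid X (lid X ?A)) (tid X ?A) [lid X ?A] (lid X ?A) (tid X ?A)"
    using cell_rmul[OF l] i A by simp
  have "lid_cell X ?A \<bullet> cid X (lid X ?A) = cid X (lid X ?A)"
  proof (rule lid_cell_unique[OF A, where ps="[]" and rs="[]"])
    have "ccomp X (lid_cell X ?A \<bullet> cid X (lid X ?A)) (tid X ?A) ([] @ [lid_cell X ?A])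
      = ccomp X (lid_cell X ?A) (tid X ?A) [] \<bullet> ccomp X (cid X (lid X ?A)) (tid X ?A) [lid_cell X ?A]"
      using A i by (intro rmul_ccomp[OF l _ path_Nil path_single[OF l]]) auto
    also have "\<dots> = lid_cell X ?A"
      using ccomp_cid[OF l] rmul_uid[OF l] A by (simp add: uid_def)
    finally show "ccomp X (lid_cell X ?A \<bullet> cid X (lid X ?A)) (tid X (tdom X (tid X ?A)))
        (map (cid X) [] @ [lid_cell X ?A] @ map (cid X) [])
      = ccomp X (cid X (lid X ?A)) (tid X (tdom X (tid X ?A)))
        (map (cid X) [] @ [lid_cell X ?A] @ map (cid X) [])"
      using ccomp_cid[OF l] A by simp
  qed (use i il in simp_all)
  moreover have "ccomp X (lid_cell X ?A \<bullet> cid X (lid X ?A)) f ([] @ [\<psi>])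
      = ccomp X (lid_cell X ?A) f [] \<bullet> ccomp X (cid X (lid X ?A)) f [\<psi>]"
    using A i c(6) by (intro rmul_ccomp[OF l _ path_Nil path_single[OF \<psi>]]) auto
  ultimately show ?thesis by (simp add: uid_def ccomp_cid(1)[OF \<psi>])
qed

section \<open>2-cells into restrictions of loose-identities\<close>

definition cospan where
  "cospan f g \<longleftrightarrow> f \<in> Tight X \<and> g \<in> Tight X \<and> tcod X f = tcod X g"

lemma cospanD:
  assumes "cospan f g"
  shows "f \<in> Tight X" "g \<in> Tight X" "tcod X f = tcod X g"
  using assms by (auto simp: cospan_def)

lemma hom_cell:
  assumes "cospan f g"
  shows "cell X (hom_cell X f g) f [loose_hom X f g] (lid X (tcod X f)) g"
    "cartesian X (hom_cell X f g)"
proof -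
  let ?q = "lid X (tcod X f)"
  have "\<exists>\<kappa> p. cell X \<kappa> f [p] ?q g \<and> cartesian X \<kappa>"
    using assms by (intro has_restrictions) (auto simp: cospan_def)
  from someI_ex[OF this]
  obtain p where "cell X (hom_cell X f g) f [p] ?q g" "cartesian X (hom_cell X f g)"
    unfolding restr_cell_def[symmetric] hom_cell_def[symmetric] by blast
  moreover from this have "p = loose_hom X f g"
    using cellD(4) by (fastforce simp: loose_hom_def restr_def hom_cell_def)
  ultimately show "cell X (hom_cell X f g) f [loose_hom X f g] ?q g"
    "cartesian X (hom_cell X f g)" by auto
qed

lemma loose_hom [simp]:
  assumes "cospan f g"
  shows "loose_hom X f g \<in> Loose X" "ldom X (loose_hom X f g) = tdom X g"
    "lcod X (loose_hom X f g) = tdom X f"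
  using cellD(10)[OF hom_cell(1)[OF assms]] by auto

text \<open>The bijection between 2-cells into \<open>E(f,g)\<close> and 2-cells into \<open>E(1,1)\<close> given by the universal
  property of restrictions.\<close>

definition hat where "hat f g \<phi> = ccomp X (hom_cell X f g) (cleft X \<phi>) [\<phi>]"

lemma hat_eq: "cell X \<phi> f' rs q g' \<Longrightarrow> hat f g \<phi> = ccomp X (hom_cell X f g) f' [\<phi>]"
  by (simp add: hat_def cellD(2))

lemma cell_hat:
  assumes "cospan f g" "cell X \<phi> f' rs (loose_hom X f g) g'"
  shows "cell X (hat f g \<phi>) (tcomp X f f') rs (lid X (tcod X f)) (tcomp X g g')"
  using cell_ccomp1[OF hom_cell(1)[OF assms(1)] assms(2)] by (simp add: hat_eq[OF assms(2)])

lemma hat_factor: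
  assumes c: "cospan f g" and f': "f' \<in> Tight X" "tcod X f' = tdom X f"
    and g': "g' \<in> Tight X" "tcod X g' = tdom X g"
    and \<chi>: "cell X \<chi> (tcomp X f f') rs (lid X (tcod X f)) (tcomp X g g')"
  shows "\<exists>!\<psi>. cell X \<psi> f' rs (loose_hom X f g) g' \<and> ccomp X (hom_cell X f g) f' [\<psi>] = \<chi>"
proof -
  note h = cellD(1-5)[OF hom_cell(1)[OF c]] and d = cellD(1-5)[OF \<chi>]
  obtain p where "src X (hom_cell X f g) = [p]"
    and u: "\<forall>\<chi> f' g'. \<chi> \<in> Cell X \<and> tgt X \<chi> = tgt X (hom_cell X f g)
        \<and> tight X f' (tdom X (cleft X \<chi>)) (tdom X (cleft X (hom_cell X f g)))
        \<and> tight X g' (tdom X (cright X \<chi>)) (tdom X (cright X (hom_cell X f g)))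
        \<and> cleft X \<chi> = tcomp X (cleft X (hom_cell X f g)) f'
        \<and> cright X \<chi> = tcomp X (cright X (hom_cell X f g)) g' \<longrightarrow>
      (\<exists>!\<psi>. cell X \<psi> f' (src X \<chi>) p g' \<and> ccomp X (hom_cell X f g) f' [\<psi>] = \<chi>)"
    using hom_cell(2)[OF c] unfolding cartesian_def by blast
  then have p: "p = loose_hom X f g" using h by simp
  show ?thesis
    using u[rule_format, of \<chi> f' g'] h d c f' g' unfolding p by (simp add: tight_def cospan_def)
qed

lemma hat_inj:
  assumes "cospan f g" "cell X \<phi> f' rs (loose_hom X f g) g'" "cell X \<psi> f' rs (loose_hom X f g) g'"
    "hat f g \<phi> = hat f g \<psi>"
  shows "\<phi> = \<psi>"
proof -
  note d = cellD[OF assms(2)]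
  have "\<exists>!\<psi>'. cell X \<psi>' f' rs (loose_hom X f g) g' \<and> ccomp X (hom_cell X f g) f' [\<psi>'] = hat f g \<psi>"
    using d assms(1) by (intro hat_factor cell_hat[OF assms(1,3)]) auto
  moreover have "ccomp X (hom_cell X f g) f' [\<phi>] = hat f g \<psi>" "ccomp X (hom_cell X f g) f' [\<psi>] = hat f g \<psi>"
    using assms(4) hat_eq[OF assms(2)] hat_eq[OF assms(3)] by simp_all
  ultimately show ?thesis using assms(2,3) by (blast dest: the1_equality)
qed

lemma hat_ex:
  assumes "cospan f g" "f' \<in> Tight X" "tcod X f' = tdom X f" "g' \<in> Tight X" "tcod X g' = tdom X g"
    "cell X \<chi> (tcomp X f f') rs (lid X (tcod X f)) (tcomp X g g')"
  obtains \<psi> where "cell X \<psi> f' rs (loose_hom X f g) g'" "hat f g \<psi> = \<chi>"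
  using ex1_implies_ex[OF hat_factor[OF assms]] hat_eq by blast

lemma hat_ccomp:
  assumes "cospan f g" "cell X \<phi> f' rs (loose_hom X f g) g'" "path h \<xi>s ss rs k" "tcod X h = tdom X f'"
  shows "hat f g (ccomp X \<phi> h \<xi>s) = ccomp X (hat f g \<phi>) h \<xi>s"
  using ccomp_assoc1[OF hom_cell(1)[OF assms(1)] assms(2,3,4)]
    hat_eq[OF cell_ccomp[OF assms(2,3,4)]] hat_eq[OF assms(2)] by simp

lemma hat_cid: "cospan f g \<Longrightarrow> hat f g (cid X (loose_hom X f g)) = hom_cell X f g"
  using hat_eq[OF cell_cid] ccomp_cid(2)[OF hom_cell(1)] by auto

text \<open>\<open>frown\<close>, \<open>smile\<close> and \<open>act\<close> are all definite
  descriptions of a globular 2-cell with a prescribed composite with \<open>hom_cell\<close>. This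
  resolves the three descriptions uniformly, turning each into an equation for
  \<open>hat\<close>.\<close>

lemma hom_THE:
  assumes c: "cospan f g" and \<chi>: "cell X \<chi> f rs (lid X (tcod X f)) g"
    and \<gamma>: "\<gamma> = (THE \<gamma>. globular X \<gamma> rs (loose_hom X f g) \<and> hom_cell X f g \<star>\<^bsub>X\<^esub> [\<gamma>] = \<chi>)"
  shows "cell X \<gamma> (tid X (tdom X f)) rs (loose_hom X f g) (tid X (tdom X g)) \<and> hat f g \<gamma> = \<chi>"
proof -
  have "\<exists>!\<gamma>. globular X \<gamma> rs (loose_hom X f g) \<and> hom_cell X f g \<star>\<^bsub>X\<^esub> [\<gamma>] = \<chi>"
    using hat_factor[OF c, of "tid X (tdom X f)" "tid X (tdom X g)" \<chi> rs] \<chi> cospanD[OF c] c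
    by (simp add: globular_def vcomp_cell[OF hom_cell(1)[OF c]])
  from theI'[OF this] show ?thesis
    unfolding \<gamma>[symmetric]
    using c by (auto simp: globular_def vcomp_cell[OF hom_cell(1)[OF c]] hat_eq)
qed

lemma frown:
  assumes "f \<in> Tight X"
  shows "cell X (frown X f) (tid X (tdom X f)) [] (loose_hom X f f) (tid X (tdom X f))"
    "hat f f (frown X f) = uid f"
  using hom_THE[of f f "uid f" "[]" "frown X f"] cell_uid[OF assms] assms frown_def[of X f, folded uid_def]
  by (simp_all add: cospan_def)

lemma smile:
  assumes "cospan x f" "cospan f y"
  shows "cell X (smile X x f y) (tid X (tdom X x)) [loose_hom X x f, loose_hom X f y]
      (loose_hom X x y) (tid X (tdom X y))"
    "hat x y (smile X x f y) = hom_cell X x f \<bullet> hom_cell X f y"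
proof -
  have xy: "cospan x y" using assms by (auto simp: cospan_def)
  have c: "cell X (hom_cell X f y) f [loose_hom X f y] (lid X (ldom X (lid X (tcod X x)))) y"
    using hom_cell(1)[OF assms(2)] assms by (auto simp: cospan_def)
  note r = cell_rmul[OF hom_cell(1)[OF assms(1)] c]
  show "cell X (smile X x f y) (tid X (tdom X x)) [loose_hom X x f, loose_hom X f y]
      (loose_hom X x y) (tid X (tdom X y))"
    "hat x y (smile X x f y) = hom_cell X x f \<bullet> hom_cell X f y"
    using hom_THE[OF xy r] smile_def[of X x f y] rmul_cell[OF hom_cell(1)[OF assms(1)]]
    by simp_all
qed

lemma cospan_tcomp:
  assumes "cospan x y" "c \<in> Tight X" "tcod X x = tdom X c"
  shows "cospan (tcomp X c x) (tcomp X c y)"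
  using assms by (auto simp: cospan_def)

lemma act:
  assumes "cospan x y" "c \<in> Tight X" "tcod X x = tdom X c"
  shows "cell X (act X c x y) (tid X (tdom X x)) [loose_hom X x y]
      (loose_hom X (tcomp X c x) (tcomp X c y)) (tid X (tdom X y))"
    "hat (tcomp X c x) (tcomp X c y) (act X c x y) = ccomp X (lid_map X c) x [hom_cell X x y]"
proof -
  have "cell X (ccomp X (lid_map X c) x [hom_cell X x y]) (tcomp X c x) [loose_hom X x y]
      (lid X (tcod X c)) (tcomp X c y)"
    using cell_ccomp1[OF lid_map(1)[OF assms(2)]] hom_cell(1)[OF assms(1)] assms(3) by simp
  with hom_THE[OF cospan_tcomp[OF assms], of _ "[loose_hom X x y]"] act_def[of X c x y] assms
  show "cell X (act X c x y) (tid X (tdom X x)) [loose_hom X x y]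
      (loose_hom X (tcomp X c x) (tcomp X c y)) (tid X (tdom X y))"
    "hat (tcomp X c x) (tcomp X c y) (act X c x y) = ccomp X (lid_map X c) x [hom_cell X x y]"
    by (auto simp: cospan_def)
qed

lemma hat_smile:
  assumes x: "cospan x f" and y: "cospan f y"
    and \<phi>: "cell X \<phi> h rs (loose_hom X x f) m" and \<psi>: "cell X \<psi> m ss (loose_hom X f y) k"
  shows "hat x y (ccomp X (smile X x f y) h [\<phi>,\<psi>]) = hat x f \<phi> \<bullet> hat f y \<psi>"
proof -
  have xy: "cospan x y" using x y by (auto simp: cospan_def)
  note s = smile[OF x y]
  have h: "tcod X h = tdom X x" "h \<in> Tight X" using cellD[OF \<phi>] x by auto
  have c: "cell X (hom_cell X f y) f [loose_hom X f y] (lid X (ldom X (lid X (tcod X x)))) y"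
    using hom_cell(1)[OF y] x y by (auto simp: cospan_def)
  have "hat x y (ccomp X (smile X x f y) h [\<phi>,\<psi>]) = ccomp X (hom_cell X x f \<bullet> hom_cell X f y) h ([\<phi>] @ [\<psi>])"
    using hat_ccomp[OF xy s(1) path2[OF \<phi> \<psi>]] h s(2) cospanD[OF x] by simp
  also have "\<dots> = hat x f \<phi> \<bullet> hat f y \<psi>"
    using rmul_ccomp[OF hom_cell(1)[OF x] c path_single[OF \<phi>] path_single[OF \<psi>] h(1)]
    by (simp add: hat_eq[OF \<phi>] hat_eq[OF \<psi>])
  finally show ?thesis .
qed

lemma hat_act:
  assumes x: "cospan x y" "c \<in> Tight X" "tcod X x = tdom X c"
    and \<phi>: "cell X \<phi> h rs (loose_hom X x y) m"
  shows "hat (tcomp X c x) (tcomp X c y) (ccomp X (act X c x y) h [\<phi>])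
    = ccomp X (lid_map X c) (tcomp X x h) [hat x y \<phi>]"
proof -
  note a = act[OF x]
  have h: "tcod X h = tdom X x" "h \<in> Tight X" using cellD[OF \<phi>] x by auto
  have m: "cell X (lid_map X c) c [lid X (tcod X x)] (lid X (tcod X c)) c"
    using lid_map(1)[OF x(2)] x(3) by simp
  show ?thesis
    using hat_ccomp[OF cospan_tcomp[OF x] a(1) path_single[OF \<phi>]] a(2) h cospanD[OF x(1)]
      ccomp_assoc1[OF m hom_cell(1)[OF x(1)] path_single[OF \<phi>] h(1)]
    by (simp add: hat_eq[OF \<phi>])
qed

text \<open>Typed by the tight-cells \<open>f\<close> and \<open>g\<close> and not by the
  loose-cell, because transposition refers to them and the chosen restriction need not determine
  them. Such an \<open>x\<close> is read as a generalised element of \<open>E(f,g)\<close>.\<close>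

definition hcell where
  "hcell x f rs g \<longleftrightarrow> cospan f g
    \<and> cell X x (tid X (tdom X f)) rs (loose_hom X f g) (tid X (tdom X g))"

lemma hcellD:
  assumes "hcell x f rs g"
  shows "cospan f g" "cell X x (tid X (tdom X f)) rs (loose_hom X f g) (tid X (tdom X g))"
    "f \<in> Tight X" "g \<in> Tight X" "tcod X f = tcod X g" "chain X rs (tdom X g) (tdom X f)"
  using assms cellD(10)[of x "tid X (tdom X f)" rs "loose_hom X f g" "tid X (tdom X g)"]
  by (auto simp: hcell_def cospan_def)

lemma hcell_globular: "cospan f g \<Longrightarrow> hcell x f rs g \<longleftrightarrow> globular X x rs (loose_hom X f g)"
  by (auto simp: hcell_def globular_def)

lemma hcell_hat: "hcell x f rs g \<Longrightarrow> cell X (hat f g x) f rs (lid X (tcod X f)) g"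
  using cell_hat[of f g x "tid X (tdom X f)" rs "tid X (tdom X g)"] by (simp add: hcell_def cospan_def)

lemma hcell_inj: "hcell x f rs g \<Longrightarrow> hcell y f rs g \<Longrightarrow> hat f g x = hat f g y \<Longrightarrow> x = y"
  using hat_inj unfolding hcell_def by blast

lemma hcell_ex:
  assumes "cospan f g" "cell X \<chi> f rs (lid X (tcod X f)) g"
  obtains x where "hcell x f rs g" "hat f g x = \<chi>"
  using hat_ex[of f g "tid X (tdom X f)" "tid X (tdom X g)" \<chi> rs] assms
  by (auto simp: hcell_def cospan_def)

lemma vcomp_hcell: "hcell x f rs g \<Longrightarrow> x \<star>\<^bsub>X\<^esub> \<xi>s = ccomp X x (tid X (tdom X f)) \<xi>s"
  using vcomp_cell[OF hcellD(2)] hcellD(3) by simp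

lemma hcell_vcomp:
  assumes "hcell d f qs g" "path (tid X (tdom X f)) \<xi>s rs qs (tid X (tdom X g))"
  shows "hcell (d \<star>\<^bsub>X\<^esub> \<xi>s) f rs g"
  using cell_ccomp[OF hcellD(2)[OF assms(1)] assms(2)] hcellD[OF assms(1)]
  by (simp add: vcomp_hcell[OF assms(1)] hcell_def)

lemma hat_vcomp:
  assumes "hcell d f qs g" "path (tid X (tdom X f)) \<xi>s rs qs (tid X (tdom X g))"
  shows "hat f g (d \<star>\<^bsub>X\<^esub> \<xi>s) = ccomp X (hat f g d) (tid X (tdom X f)) \<xi>s"
  using hat_ccomp[OF hcellD(1,2)[OF assms(1)] assms(2)] hcellD[OF assms(1)]
  by (simp add: vcomp_hcell[OF assms(1)])

lemma vcomp_cids [simp]: "hcell x f rs g \<Longrightarrow> x \<star>\<^bsub>X\<^esub> map (cid X) rs = x"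
  using ccomp_cid(2)[OF hcellD(2)] hcellD(3) by (simp add: vcomp_hcell)

lemma hcell_cid: "cospan f g \<Longrightarrow> hcell (cid X (loose_hom X f g)) f [loose_hom X f g] g"
  using cell_cid[of "loose_hom X f g"] by (simp add: hcell_def)

lemma cid_vcomp: "hcell x f rs g \<Longrightarrow> cid X (loose_hom X f g) \<star>\<^bsub>X\<^esub> [x] = x"
  using vcomp_hcell[OF hcell_cid[OF hcellD(1)]] ccomp_cid(1)[OF hcellD(2)] by auto

lemma hcell_path: "hcell x f rs g \<Longrightarrow> path (tid X (tdom X f)) [x] rs [loose_hom X f g] (tid X (tdom X g))"
  using path_single[OF hcellD(2)] .

lemma hcell_path2: "hcell x f rs g \<Longrightarrow> hcell y g ss h \<Longrightarrow>
    path (tid X (tdom X f)) [x,y] (rs @ ss) [loose_hom X f g, loose_hom X g h] (tid X (tdom X h))"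
  using path2[OF hcellD(2) hcellD(2)] .

text \<open>The ends of the chain \<open>[E(x,y)]\<close> are the domains of \<open>y\<close> and
  \<open>x\<close>, while the tight-cells of \<open>d\<close> force them to be those of
  \<open>g\<close> and \<open>f\<close>.\<close>

lemma op_tdom:
  assumes "hcell d f [loose_hom X x y] g" "cospan x y"
  shows "tdom X x = tdom X f" "tdom X y = tdom X g"
  using hcellD(6)[OF assms(1)] assms(2) by auto

lemma hcell_app:
  assumes "hcell d f [loose_hom X x y] g" "hcell z x rs y"
  shows "hcell (d \<star>\<^bsub>X\<^esub> [z]) f rs g"
  using hcell_vcomp[OF assms(1)] hcell_path[OF assms(2)] op_tdom[OF assms(1) hcellD(1)[OF assms(2)]] by simp

lemma vcomp_assoc:
  assumes d: "hcell d f [loose_hom X x y] g" and e: "hcell e x qs y"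
    and p: "path (tid X (tdom X x)) \<xi>s rs qs (tid X (tdom X y))"
  shows "(d \<star>\<^bsub>X\<^esub> [e]) \<star>\<^bsub>X\<^esub> \<xi>s = d \<star>\<^bsub>X\<^esub> [e \<star>\<^bsub>X\<^esub> \<xi>s]"
proof -
  have "(d \<star>\<^bsub>X\<^esub> [e]) \<star>\<^bsub>X\<^esub> \<xi>s = ccomp X (d \<star>\<^bsub>X\<^esub> [e]) (tid X (tdom X f)) \<xi>s"
    by (rule vcomp_hcell[OF hcell_app[OF d e]])
  then show ?thesis
    using ccomp_assoc1[OF hcellD(2)[OF d] hcellD(2)[OF e] p] op_tdom[OF d hcellD(1)[OF e]]
      hcellD(3)[OF e] hcellD(3)[OF d]
    by (simp add: vcomp_hcell[OF d] vcomp_hcell[OF e])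
qed

text \<open>Composition in diagrammatic order, \<open>x\<close> before \<open>y\<close>. Its
  transpose is \<open>hat f g x \<bullet> hat g h y\<close>, from which its laws are
  obtained.\<close>

definition mul where "mul f g h x y = smile X f g h \<star>\<^bsub>X\<^esub> [x, y]"

lemma hcell_smile:
  assumes "cospan f g" "cospan g h"
  shows "hcell (smile X f g h) f [loose_hom X f g, loose_hom X g h] h"
  using smile(1)[OF assms] assms by (auto simp: hcell_def cospan_def)

lemma hcell_mul:
  assumes "hcell x f rs g" "hcell y g ss h"
  shows "hcell (mul f g h x y) f (rs @ ss) h"
  unfolding mul_def
  by (rule hcell_vcomp[OF hcell_smile[OF hcellD(1)[OF assms(1)] hcellD(1)[OF assms(2)]] hcell_path2[OF assms]])

lemma hat_mul:
  assumes "hcell x f rs g" "hcell y g ss h"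
  shows "hat f h (mul f g h x y) = hat f g x \<bullet> hat g h y"
  using hat_smile[OF hcellD(1)[OF assms(1)] hcellD(1)[OF assms(2)] hcellD(2)[OF assms(1)] hcellD(2)[OF assms(2)]]
    vcomp_hcell[OF hcell_smile[OF hcellD(1)[OF assms(1)] hcellD(1)[OF assms(2)]]]
  by (simp add: mul_def)

lemma hcell_hat':
  assumes "hcell x f rs g" "tcod X f = A"
  shows "cell X (hat f g x) f rs (lid X (ldom X (lid X A))) g"
  using hcell_hat[OF assms(1)] hcellD[OF assms(1)] assms(2) by auto

lemma mul_assoc:
  assumes x: "hcell x f rs g" and y: "hcell y g ss h" and z: "hcell z h ts k"
  shows "mul f h k (mul f g h x y) z = mul f g k x (mul g h k y z)"
proof (rule hcell_inj)
  show "hcell (mul f h k (mul f g h x y) z) f (rs @ ss @ ts) k"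
    using hcell_mul[OF hcell_mul[OF x y] z] by simp
  show "hcell (mul f g k x (mul g h k y z)) f (rs @ ss @ ts) k"
    using hcell_mul[OF x hcell_mul[OF y z]] .
  have "tcod X g = tcod X f" "tcod X h = tcod X f" using hcellD(5)[OF x] hcellD(5)[OF y] by simp_all
  then show "hat f k (mul f h k (mul f g h x y) z) = hat f k (mul f g k x (mul g h k y z))"
    using rmul_assoc[OF hcell_hat[OF x] hcell_hat'[OF y] hcell_hat'[OF z]]
    by (simp add: hat_mul[OF hcell_mul[OF x y] z] hat_mul[OF x y] hat_mul[OF y z]
        hat_mul[OF x hcell_mul[OF y z]])
qed

lemma hcell_frown: "f \<in> Tight X \<Longrightarrow> hcell (frown X f) f [] f"
  using frown(1) by (simp add: hcell_def cospan_def)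

lemma mul_frown:
  assumes x: "hcell x f rs g"
  shows "mul f f g (frown X f) x = x" "mul f g g x (frown X g) = x"
proof -
  note f = hcell_frown[OF hcellD(3)[OF x]] and g = hcell_frown[OF hcellD(4)[OF x]]
  show "mul f f g (frown X f) x = x"
    using hcell_inj[OF _ x] hcell_mul[OF f x] hat_mul[OF f x] uid_rmul[OF hcell_hat[OF x]]
    by (simp add: frown(2)[OF hcellD(3)[OF x]])
  show "mul f g g x (frown X g) = x"
    using hcell_inj[OF _ x] hcell_mul[OF x g] hat_mul[OF x g] rmul_uid[OF hcell_hat[OF x]]
    by (simp add: frown(2)[OF hcellD(4)[OF x]])
qed

text \<open>Interchange with precomposition, inherited from \<open>\<bullet>\<close>. The special
  cases that follow evaluate at single elements; a nullary factor is matched with the empty path,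
  which leaves it unchanged.\<close>

lemma mul_vcomp:
  assumes x: "hcell x f rs g" and y: "hcell y g ss h"
    and p: "path (tid X (tdom X f)) \<xi>s us rs (tid X (tdom X g))"
    and q: "path (tid X (tdom X g)) \<xi>s' us' ss (tid X (tdom X h))"
  shows "mul f g h x y \<star>\<^bsub>X\<^esub> (\<xi>s @ \<xi>s') = mul f g h (x \<star>\<^bsub>X\<^esub> \<xi>s) (y \<star>\<^bsub>X\<^esub> \<xi>s')"
proof (rule hcell_inj)
  show "hcell (mul f g h x y \<star>\<^bsub>X\<^esub> (\<xi>s @ \<xi>s')) f (us @ us') h"
    by (rule hcell_vcomp[OF hcell_mul[OF x y] path_append[OF p q]])
  show "hcell (mul f g h (x \<star>\<^bsub>X\<^esub> \<xi>s) (y \<star>\<^bsub>X\<^esub> \<xi>s')) f (us @ us') h"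
    by (rule hcell_mul[OF hcell_vcomp[OF x p] hcell_vcomp[OF y q]])
  have "ccomp X (hat f g x \<bullet> hat g h y) (tid X (tdom X f)) (\<xi>s @ \<xi>s')
      = ccomp X (hat f g x) (tid X (tdom X f)) \<xi>s \<bullet> ccomp X (hat g h y) (tid X (tdom X g)) \<xi>s'"
    using hcellD(3)[OF x] by (intro rmul_ccomp[OF hcell_hat[OF x] hcell_hat'[OF y] p q])
      (use hcellD(5)[OF x] in auto)
  then show "hat f h (mul f g h x y \<star>\<^bsub>X\<^esub> (\<xi>s @ \<xi>s')) = hat f h (mul f g h (x \<star>\<^bsub>X\<^esub> \<xi>s) (y \<star>\<^bsub>X\<^esub> \<xi>s'))"
    using hat_vcomp[OF hcell_mul[OF x y] path_append[OF p q]] hat_mul[OF x y]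
      hat_mul[OF hcell_vcomp[OF x p] hcell_vcomp[OF y q]] hat_vcomp[OF x p] hat_vcomp[OF y q]
    by simp
qed

lemma mul_app2:
  assumes a: "hcell a f [loose_hom X x y] g" and b: "hcell b g [loose_hom X x' y'] h"
    and z: "hcell z x rs y" and z': "hcell z' x' rs' y'"
  shows "mul f g h a b \<star>\<^bsub>X\<^esub> [z,z'] = mul f g h (a \<star>\<^bsub>X\<^esub> [z]) (b \<star>\<^bsub>X\<^esub> [z'])"
  using mul_vcomp[OF a b, of "[z]" rs "[z']" rs'] hcell_path[OF z] hcell_path[OF z']
    op_tdom[OF a hcellD(1)[OF z]] op_tdom[OF b hcellD(1)[OF z']] by simp

lemma mul_app_left:
  assumes a: "hcell a f [loose_hom X x y] g" and b: "hcell b g [] h" and z: "hcell z x rs y"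
  shows "mul f g h a b \<star>\<^bsub>X\<^esub> [z] = mul f g h (a \<star>\<^bsub>X\<^esub> [z]) b"
proof -
  have "tdom X g = tdom X h" using hcellD(6)[OF b] by simp
  then show ?thesis
    using mul_vcomp[OF a b, of "[z]" rs "[]" "[]"] hcell_path[OF z] path_Nil[of "tid X (tdom X g)"]
      op_tdom[OF a hcellD(1)[OF z]] vcomp_cids[OF b] hcellD(4)[OF b] by simp
qed

lemma mul_app_right:
  assumes a: "hcell a f [] g" and b: "hcell b g [loose_hom X x y] h" and z: "hcell z x rs y"
  shows "mul f g h a b \<star>\<^bsub>X\<^esub> [z] = mul f g h a (b \<star>\<^bsub>X\<^esub> [z])"
proof -
  have "tdom X f = tdom X g" using hcellD(6)[OF a] by simp
  then show ?thesis
    using mul_vcomp[OF a b, of "[]" "[]" "[z]" rs] hcell_path[OF z] path_Nil[of "tid X (tdom X g)"]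
      op_tdom[OF b hcellD(1)[OF z]] vcomp_cids[OF a] hcellD(4)[OF a] by simp
qed

section \<open>The action of a tight-cell on 2-cells into \<open>E(x,y)\<close>\<close>

lemma hcell_act:
  assumes "cospan x y" "c \<in> Tight X" "tcod X x = tdom X c"
  shows "hcell (act X c x y) (tcomp X c x) [loose_hom X x y] (tcomp X c y)"
  using act(1)[OF assms] cospan_tcomp[OF assms] assms by (simp add: hcell_def cospan_def)

lemma hat_act_app:
  assumes "hcell z x rs y" "c \<in> Tight X" "tcod X x = tdom X c"
  shows "hat (tcomp X c x) (tcomp X c y) (act X c x y \<star>\<^bsub>X\<^esub> [z]) = ccomp X (lid_map X c) x [hat x y z]"
  using hat_act[OF hcellD(1)[OF assms(1)] assms(2,3) hcellD(2)[OF assms(1)]] hcellD[OF assms(1)] assms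
    vcomp_hcell[OF hcell_act[OF hcellD(1)[OF assms(1)] assms(2,3)]]
  by simp

lemma act_frown:
  assumes "x \<in> Tight X" "c \<in> Tight X" "tcod X x = tdom X c"
  shows "act X c x x \<star>\<^bsub>X\<^esub> [frown X x] = frown X (tcomp X c x)"
proof (rule hcell_inj)
  have x: "cospan x x" using assms by (simp add: cospan_def)
  show "hcell (act X c x x \<star>\<^bsub>X\<^esub> [frown X x]) (tcomp X c x) [] (tcomp X c x)"
    by (rule hcell_app[OF hcell_act[OF x assms(2,3)] hcell_frown[OF assms(1)]])
  show "hcell (frown X (tcomp X c x)) (tcomp X c x) [] (tcomp X c x)"
    by (rule hcell_frown) (use assms in simp)
  show "hat (tcomp X c x) (tcomp X c x) (act X c x x \<star>\<^bsub>X\<^esub> [frown X x])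
      = hat (tcomp X c x) (tcomp X c x) (frown X (tcomp X c x))"
    using hat_act_app[OF hcell_frown assms(2,3)] assms by (simp add: frown lid_map_uid)
qed

text \<open>After transposition this is \<open>rmul_natural\<close> for \<open>lid_map c\<close>,
  with no arguments to the left of the product.\<close>

lemma act_mul:
  assumes a: "hcell a x rs y" and b: "hcell b y ss z" and c: "c \<in> Tight X" "tcod X x = tdom X c"
  shows "act X c x z \<star>\<^bsub>X\<^esub> [mul x y z a b]
    = mul (tcomp X c x) (tcomp X c y) (tcomp X c z) (act X c x y \<star>\<^bsub>X\<^esub> [a]) (act X c y z \<star>\<^bsub>X\<^esub> [b])"
proof (rule hcell_inj)
  have c': "tcod X y = tdom X c" using c hcellD[OF a] by simp
  note xy = hcellD(1)[OF a] and yz = hcellD(1)[OF b]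
  have xz: "cospan x z" using xy yz by (auto simp: cospan_def)
  note A = hcell_app[OF hcell_act[OF xy c] a] and B = hcell_app[OF hcell_act[OF yz c(1) c'] b]
  note ab = hcell_mul[OF a b]
  show "hcell (act X c x z \<star>\<^bsub>X\<^esub> [mul x y z a b]) (tcomp X c x) (rs @ ss) (tcomp X c z)"
    by (rule hcell_app[OF hcell_act[OF xz c] ab])
  show "hcell (mul (tcomp X c x) (tcomp X c y) (tcomp X c z) (act X c x y \<star>\<^bsub>X\<^esub> [a])
      (act X c y z \<star>\<^bsub>X\<^esub> [b])) (tcomp X c x) (rs @ ss) (tcomp X c z)"
    by (rule hcell_mul[OF A B])
  have m: "cell X (lid_map X c) c ([] @ [lid X (tcod X x)]) (lid X (tcod X c)) c"
    using lid_map(1)[OF c(1)] c(2) by simp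
  have "path x [] [] [] x" using path_Nil hcellD(3)[OF a] .
  from rmul_natural[OF m this hcell_hat[OF a] hcell_hat'[OF b]] hcellD[OF a]
  have "ccomp X (lid_map X c) x [hat x y a \<bullet> hat y z b]
      = ccomp X (lid_map X c) x [hat x y a] \<bullet> ccomp X (lid_map X c) y [hat y z b]"
    using c by simp
  then show "hat (tcomp X c x) (tcomp X c z) (act X c x z \<star>\<^bsub>X\<^esub> [mul x y z a b])
    = hat (tcomp X c x) (tcomp X c z)
      (mul (tcomp X c x) (tcomp X c y) (tcomp X c z) (act X c x y \<star>\<^bsub>X\<^esub> [a]) (act X c y z \<star>\<^bsub>X\<^esub> [b]))"
    by (simp add: hat_act_app[OF ab c] hat_mul[OF A B] hat_act_app[OF a c] hat_act_app[OF b c(1) c']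
        hat_mul[OF a b])
qed

lemma act_tid:
  assumes "cospan x y"
  shows "act X (tid X (tcod X x)) x y = cid X (loose_hom X x y)"
proof -
  have t: "tid X (tcod X x) \<in> Tight X" "tcod X x = tdom X (tid X (tcod X x))"
    "tcomp X (tid X (tcod X x)) x = x" "tcomp X (tid X (tcod X x)) y = y"
    using cospanD[OF assms] by simp_all
  have h: "hcell (act X (tid X (tcod X x)) x y) x [loose_hom X x y] y"
    using hcell_act[OF assms t(1,2)] t by simp
  have "hat x y (act X (tid X (tcod X x)) x y) = hat x y (cid X (loose_hom X x y))"
    using act(2)[OF assms t(1,2)] t cospanD[OF assms] ccomp_cid(1)[OF hom_cell(1)[OF assms]]
    by (simp add: hat_cid[OF assms] lid_map_tid)
  with hcell_inj[OF h hcell_cid[OF assms]] show ?thesis .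
qed

lemma act_tcomp:
  assumes z: "hcell z x rs y" and c: "c \<in> Tight X" "tcod X x = tdom X c"
    and d: "d \<in> Tight X" "tcod X c = tdom X d"
  shows "act X d (tcomp X c x) (tcomp X c y) \<star>\<^bsub>X\<^esub> [act X c x y \<star>\<^bsub>X\<^esub> [z]] = act X (tcomp X d c) x y \<star>\<^bsub>X\<^esub> [z]"
proof (rule hcell_inj)
  note xy = hcellD(1)[OF z]
  note cz = hcell_app[OF hcell_act[OF xy c] z]
  have d': "tcod X (tcomp X c x) = tdom X d" using c d hcellD[OF z] by simp
  have dc: "tcomp X d c \<in> Tight X" "tcod X x = tdom X (tcomp X d c)" using c d by simp_all
  have e: "tcomp X (tcomp X d c) x = tcomp X d (tcomp X c x)"
    "tcomp X (tcomp X d c) y = tcomp X d (tcomp X c y)"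
    using c d hcellD[OF z] by (simp_all add: tcomp_assoc')
  show "hcell (act X d (tcomp X c x) (tcomp X c y) \<star>\<^bsub>X\<^esub> [act X c x y \<star>\<^bsub>X\<^esub> [z]])
      (tcomp X d (tcomp X c x)) rs (tcomp X d (tcomp X c y))"
    by (rule hcell_app[OF hcell_act[OF hcellD(1)[OF cz] d(1) d'] cz])
  show "hcell (act X (tcomp X d c) x y \<star>\<^bsub>X\<^esub> [z]) (tcomp X d (tcomp X c x)) rs (tcomp X d (tcomp X c y))"
    using hcell_app[OF hcell_act[OF xy dc] z] e by simp
  have m: "cell X (lid_map X d) d [lid X (tcod X c)] (lid X (tcod X d)) d"
    using lid_map(1)[OF d(1)] d by simp
  have m': "cell X (lid_map X c) c [lid X (tcod X x)] (lid X (tcod X c)) c"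
    using lid_map(1)[OF c(1)] c by simp
  show "hat (tcomp X d (tcomp X c x)) (tcomp X d (tcomp X c y))
      (act X d (tcomp X c x) (tcomp X c y) \<star>\<^bsub>X\<^esub> [act X c x y \<star>\<^bsub>X\<^esub> [z]])
    = hat (tcomp X d (tcomp X c x)) (tcomp X d (tcomp X c y)) (act X (tcomp X d c) x y \<star>\<^bsub>X\<^esub> [z])"
    using hat_act_app[OF z dc] e ccomp_assoc1[OF m m' path_single[OF hcell_hat[OF z]]] c(2)
    by (simp add: hat_act_app[OF cz d(1) d'] hat_act_app[OF z c] lid_map_tcomp[OF c(1) d])
qed

end

section \<open>Relative monads and the functor \<open>k\<close>\<close>

lemma category_full_subcategory:
  assumes "category C"
  shows "category (full_subcategory C P)"
  using assms unfolding category_def full_subcategory_def by simp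

lemma (in virtual_double_category) category_under: "category (under X A)"
  by standard (auto simp: under_def tight_def tcomp_assoc')

context virtual_equipment
begin

lemma app_assoc:
  assumes d: "hcell d f [loose_hom X x y] g" and e: "hcell e x [loose_hom X x' y'] y" and z: "hcell z x' rs y'"
  shows "(d \<star>\<^bsub>X\<^esub> [e]) \<star>\<^bsub>X\<^esub> [z] = d \<star>\<^bsub>X\<^esub> [e \<star>\<^bsub>X\<^esub> [z]]"
  using vcomp_assoc[OF d e] hcell_path[OF z] op_tdom[OF e hcellD(1)[OF z]] by simp

section \<open>Monad and opalgebra laws as equations for \<open>mul\<close>\<close>

lemma mediates_iff: "mediates X K (a, l) u \<longleftrightarrow>
    tight X u (tcod X (fst K)) (tcod X a) \<and> tcomp X u (fst K) = a \<and> act X u (fst K) (fst K) \<star>\<^bsub>X\<^esub> [snd K] = l"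
  by (cases K) (simp add: mediates.simps)

text \<open>\<open>E(j,\<eta>)\<close> applied to the identity of \<open>j\<close> is
  \<open>\<eta>\<close> itself, and \<open>E(\<eta>,t)\<close> after \<open>\<dagger>\<close> is
  left multiplication by \<open>\<eta>\<close>; this removes \<open>covar\<close> and
  \<open>contra\<close> from the laws. The rewriting needs well-typed data, hence the case
  distinction.\<close>

lemma relative_monad_iff:
  assumes j: "j \<in> Tight X"
  shows "relative_monad X j (t, d, e) \<longleftrightarrow>
    tight X t (tdom X j) (tcod X j) \<and> hcell d t [loose_hom X j t] t \<and> hcell e j [] t
    \<and> mul j t t e d = cid X (loose_hom X j t)
    \<and> d \<star>\<^bsub>X\<^esub> [e] = frown X t
    \<and> mul t t t d d = d \<star>\<^bsub>X\<^esub> [mul j t t (cid X (loose_hom X j t)) d]"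
proof (cases "tight X t (tdom X j) (tcod X j) \<and> hcell d t [loose_hom X j t] t \<and> hcell e j [] t")
  case True
  then have d: "hcell d t [loose_hom X j t] t" and e: "hcell e j [] t" by auto
  have t: "cospan t t" "cospan j t" "cospan j j" using hcellD(1)[OF d] hcellD(1)[OF e] j
    by (auto simp: cospan_def)
  have "contra X j t e t \<star>\<^bsub>X\<^esub> [d] = mul j t t e d"
    using mul_app_right[OF e hcell_cid[OF t(1)] d] cid_vcomp[OF d]
    by (simp add: contra_def mul_def)
  moreover have "covar X j j t e \<star>\<^bsub>X\<^esub> [frown X j] = e"
    using mul_app_left[OF hcell_cid[OF t(3)] e hcell_frown[OF j]] cid_vcomp[OF hcell_frown[OF j]]
      mul_frown(1)[OF e]
    by (simp add: covar_def mul_def)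
  moreover have "globular X d [loose_hom X j t] (loose_hom X t t)" "tcell X e j t"
    using d e t by (simp_all add: hcell_globular tcell_def)
  ultimately show ?thesis using True by (simp add: mul_def relative_monad.simps)
next
  case False
  then show ?thesis using j by (auto simp: relative_monad.simps tcell_def tight_def hcell_globular cospan_def)
qed

lemma relative_monadD:
  assumes j: "j \<in> Tight X" and T: "relative_monad X j (t, d, e)"
  shows "t \<in> Tight X" "tdom X t = tdom X j" "tcod X t = tcod X j"
    "hcell d t [loose_hom X j t] t" "hcell e j [] t" "d \<star>\<^bsub>X\<^esub> [e] = frown X t"
    "mul j t t e d = cid X (loose_hom X j t)"
    "mul t t t d d = d \<star>\<^bsub>X\<^esub> [mul j t t (cid X (loose_hom X j t)) d]"
    "cospan j t"
  using T relative_monad_iff[OF j, of t d e] j by (auto simp: tight_def cospan_def)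

text \<open>The first monad law precomposed with \<open>x\<close>. It is the source of the
  injectivity of the structure 2-cell of an opalgebra object.\<close>

lemma unit_ext:
  assumes "j \<in> Tight X" "relative_monad X j (t, d, e)" "hcell x j rs t"
  shows "mul j t t e (d \<star>\<^bsub>X\<^esub> [x]) = x"
  using mul_app_right[OF relative_monadD(5,4)[OF assms(1,2)] assms(3)] cid_vcomp[OF assms(3)]
    relative_monadD(7)[OF assms(1,2)] by simp

lemma opalgebra_iff:
  assumes j: "j \<in> Tight X" and T: "relative_monad X j (t, d, e)"
  shows "opalgebra X j (t, d, e) (a, l) \<longleftrightarrow>
    a \<in> Tight X \<and> tdom X a = tdom X j \<and> hcell l a [loose_hom X j t] a \<and> l \<star>\<^bsub>X\<^esub> [e] = frown X a
    \<and> mul a a a l l = l \<star>\<^bsub>X\<^esub> [mul j t t (cid X (loose_hom X j t)) d]"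
proof -
  note T' = relative_monadD[OF j T]
  have jj: "cospan j j" using j by (simp add: cospan_def)
  have "covar X j j t e \<star>\<^bsub>X\<^esub> [frown X j] = e"
    using mul_app_left[OF hcell_cid[OF jj] T'(5) hcell_frown[OF j]] cid_vcomp[OF hcell_frown[OF j]]
      mul_frown(1)[OF T'(5)]
    by (simp add: covar_def mul_def)
  moreover have "a \<in> Tight X \<Longrightarrow> cospan a a" by (simp add: cospan_def)
  ultimately show ?thesis
    by (auto simp: opalgebra.simps tight_def mul_def hcell_globular)
qed

lemma opalgebraD:
  assumes "j \<in> Tight X" "relative_monad X j (t, d, e)" "opalgebra X j (t, d, e) (a, l)"
  shows "a \<in> Tight X" "tdom X a = tdom X j" "hcell l a [loose_hom X j t] a"
    "l \<star>\<^bsub>X\<^esub> [e] = frown X a"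
    "mul a a a l l = l \<star>\<^bsub>X\<^esub> [mul j t t (cid X (loose_hom X j t)) d]"
  using assms opalgebra_iff by auto

lemma opalgebra_self:
  assumes "j \<in> Tight X" "relative_monad X j (t, d, e)"
  shows "opalgebra X j (t, d, e) (t, d)"
  using relative_monadD[OF assms] opalgebra_iff[OF assms] by simp

text \<open>The second opalgebra law precomposed with the pair \<open>x\<close>, \<open>y\<close>.
  The argument of \<open>l\<close> on the right is the Kleisli composite of \<open>x\<close> and
  \<open>y\<close>, so \<open>l\<close> turns Kleisli composition into composition.\<close>

lemma opalgebra_mul:
  assumes j: "j \<in> Tight X" and T: "relative_monad X j (t, d, e)" and a: "opalgebra X j (t, d, e) (a, l)"
    and x: "hcell x j rs t" and y: "hcell y j ss t"
  shows "mul a a a (l \<star>\<^bsub>X\<^esub> [x]) (l \<star>\<^bsub>X\<^esub> [y]) = l \<star>\<^bsub>X\<^esub> [mul j t t x (d \<star>\<^bsub>X\<^esub> [y])]"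
proof -
  note T' = relative_monadD[OF j T] and a' = opalgebraD[OF j T a]
  note i = hcell_cid[OF T'(9)]
  have "mul a a a (l \<star>\<^bsub>X\<^esub> [x]) (l \<star>\<^bsub>X\<^esub> [y]) = mul a a a l l \<star>\<^bsub>X\<^esub> [x,y]"
    using mul_app2[OF a'(3) a'(3) x y] by simp
  also have "\<dots> = l \<star>\<^bsub>X\<^esub> [mul j t t (cid X (loose_hom X j t)) d \<star>\<^bsub>X\<^esub> [x,y]]"
    using vcomp_assoc[OF a'(3) hcell_mul[OF i T'(4)], of "[x,y]" "rs @ ss"] path2[OF hcellD(2)[OF x] hcellD(2)[OF y, folded T'(2)]]
      T' by (simp add: a'(5))
  also have "mul j t t (cid X (loose_hom X j t)) d \<star>\<^bsub>X\<^esub> [x,y] = mul j t t x (d \<star>\<^bsub>X\<^esub> [y])"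
    using mul_app2[OF i T'(4) x y] cid_vcomp[OF x] by simp
  finally show ?thesis .
qed

section \<open>Postcomposition with a 2-cell between tight-cells, and morphisms of monads\<close>

lemma covar_mul: "covar X x f g \<tau> = mul x f g (cid X (loose_hom X x f)) \<tau>"
  by (simp add: covar_def mul_def)

lemma hcell_covar:
  assumes "cospan x f" "hcell \<tau> f [] g"
  shows "hcell (covar X x f g \<tau>) x [loose_hom X x f] g"
  using hcell_mul[OF hcell_cid[OF assms(1)] assms(2)] by (simp add: covar_mul)

lemma covar_app:
  assumes "hcell \<tau> f [] g" "hcell z x rs f"
  shows "covar X x f g \<tau> \<star>\<^bsub>X\<^esub> [z] = mul x f g z \<tau>"
  using mul_app_left[OF hcell_cid[OF hcellD(1)[OF assms(2)]] assms] cid_vcomp[OF assms(2)]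
  by (simp add: covar_mul)

lemma relative_monad_morphism_iff:
  assumes j: "j \<in> Tight X" and T: "relative_monad X j (t, d, e)" and T': "relative_monad X j (t', d', e')"
  shows "relative_monad_morphism X j (t, d, e) (t', d', e') \<tau> \<longleftrightarrow>
    hcell \<tau> t [] t' \<and> mul j t t' e \<tau> = e'
    \<and> mul t t t' d \<tau> = mul t t' t' \<tau> (d' \<star>\<^bsub>X\<^esub> [covar X j t t' \<tau>])"
proof (cases "hcell \<tau> t [] t'")
  case True
  note D = relative_monadD[OF j T] and D' = relative_monadD[OF j T']
  have c: "hcell (d' \<star>\<^bsub>X\<^esub> [covar X j t t' \<tau>]) t' [loose_hom X j t] t'"
    by (rule hcell_app[OF D'(4) hcell_covar[OF D(9) True]])
  have "contra X t t' \<tau> t' \<star>\<^bsub>X\<^esub> [d' \<star>\<^bsub>X\<^esub> [covar X j t t' \<tau>]] = mul t t' t' \<tau> (d' \<star>\<^bsub>X\<^esub> [covar X j t t' \<tau>])"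
    using mul_app_right[OF True hcell_cid c] hcellD(1)[OF D'(4)] cid_vcomp[OF c]
    by (simp add: contra_def mul_def)
  then show ?thesis
    using True covar_app[OF True D(4)] hcell_globular[OF hcellD(1)[OF True]]
    by (simp add: relative_monad_morphism.simps tcell_def tcell_comp_def mul_def)
next
  case False
  have "cospan t t'" using relative_monadD[OF j T] relative_monadD[OF j T'] by (simp add: cospan_def)
  with False show ?thesis by (simp add: relative_monad_morphism.simps tcell_def hcell_globular)
qed

lemma tcell_comp_mul: "tcell_comp X f g h \<tau>' \<tau> = mul f g h \<tau> \<tau>'"
  by (simp add: tcell_comp_def mul_def)

lemma covar_comp:
  assumes "cospan x f" "hcell \<tau> f [] g" "hcell \<tau>' g [] h"
  shows "covar X x g h \<tau>' \<star>\<^bsub>X\<^esub> [covar X x f g \<tau>] = covar X x f h (mul f g h \<tau> \<tau>')"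
  using covar_app[OF assms(3) hcell_covar[OF assms(1,2)]]
    mul_assoc[OF hcell_cid[OF assms(1)] assms(2,3)] by (simp add: covar_mul)

lemma covar_frown:
  assumes "cospan x f"
  shows "covar X x f f (frown X f) = cid X (loose_hom X x f)"
  using mul_frown(2)[OF hcell_cid[OF assms]] by (simp add: covar_mul)

lemma category_RMnd:
  assumes j: "j \<in> Tight X"
  shows "category (RMnd X j)"
proof -
  note D = relative_monadD[OF j] and iff = relative_monad_morphism_iff[OF j]
  have id: "relative_monad_morphism X j (t, d, e) (t, d, e) (frown X t)"
    if T: "relative_monad X j (t, d, e)" for t d e
    using mul_frown(2)[OF D(5)[OF T]] mul_frown[OF D(4)[OF T]] D(4)[OF T]
      hcell_frown[OF D(1)[OF T]] covar_frown[OF D(9)[OF T]] vcomp_cids[OF D(4)[OF T]]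
    by (simp add: iff[OF T T])
  have comp: "relative_monad_morphism X j (t, d, e) (t'', d'', e'') (mul t t' t'' \<tau> \<tau>')"
    if T: "relative_monad X j (t, d, e)" and T': "relative_monad X j (t', d', e')"
      and T'': "relative_monad X j (t'', d'', e'')"
      and m: "relative_monad_morphism X j (t, d, e) (t', d', e') \<tau>"
      and m': "relative_monad_morphism X j (t', d', e') (t'', d'', e'') \<tau>'"
    for t d e t' d' e' t'' d'' e'' \<tau> \<tau>'
  proof -
    note m = m[unfolded iff[OF T T']] and m' = m'[unfolded iff[OF T' T'']]
    have \<tau>: "hcell \<tau> t [] t'" and \<tau>': "hcell \<tau>' t' [] t''" using m m' by auto
    note c = hcell_covar[OF D(9)[OF T] \<tau>] and c' = hcell_covar[OF D(9)[OF T'] \<tau>']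
    note d'c = hcell_app[OF D(4)[OF T'] c]
    note d''c = hcell_app[OF D(4)[OF T''] c']
    have e: "mul j t t'' e (mul t t' t'' \<tau> \<tau>') = e''"
      using mul_assoc[OF D(5)[OF T] \<tau> \<tau>'] m m' by simp
    \<comment> \<open>The two compatibility squares are pasted: the one for \<open>\<tau>\<close>
      moves \<open>d\<close> past \<open>\<tau>\<close>, and the one for \<open>\<tau>'\<close>,
      precomposed with \<open>E(j,\<tau>)\<close>, moves \<open>d'\<close> past
      \<open>\<tau>'\<close>.\<close>
    have "mul t t t'' d (mul t t' t'' \<tau> \<tau>') = mul t t' t'' (mul t t t' d \<tau>) \<tau>'"
      using mul_assoc[OF D(4)[OF T] \<tau> \<tau>'] by simp
    also have "\<dots> = mul t t' t'' \<tau> (mul t' t' t'' (d' \<star>\<^bsub>X\<^esub> [covar X j t t' \<tau>]) \<tau>')"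
      using mul_assoc[OF \<tau> d'c \<tau>'] m by simp
    also have "mul t' t' t'' (d' \<star>\<^bsub>X\<^esub> [covar X j t t' \<tau>]) \<tau>' = mul t' t' t'' d' \<tau>' \<star>\<^bsub>X\<^esub> [covar X j t t' \<tau>]"
      using mul_app_left[OF D(4)[OF T'] \<tau>' c] by simp
    also have "\<dots> = mul t' t'' t'' \<tau>' (d'' \<star>\<^bsub>X\<^esub> [covar X j t' t'' \<tau>']) \<star>\<^bsub>X\<^esub> [covar X j t t' \<tau>]"
      using m' by simp
    also have "\<dots> = mul t' t'' t'' \<tau>' ((d'' \<star>\<^bsub>X\<^esub> [covar X j t' t'' \<tau>']) \<star>\<^bsub>X\<^esub> [covar X j t t' \<tau>])"
      by (rule mul_app_right[OF \<tau>' d''c c])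
    also have "(d'' \<star>\<^bsub>X\<^esub> [covar X j t' t'' \<tau>']) \<star>\<^bsub>X\<^esub> [covar X j t t' \<tau>]
        = d'' \<star>\<^bsub>X\<^esub> [covar X j t t'' (mul t t' t'' \<tau> \<tau>')]"
      using app_assoc[OF D(4)[OF T''] c' c] covar_comp[OF D(9)[OF T] \<tau> \<tau>'] by simp
    also have "mul t t' t'' \<tau> (mul t' t'' t'' \<tau>' (d'' \<star>\<^bsub>X\<^esub> [covar X j t t'' (mul t t' t'' \<tau> \<tau>')]))
        = mul t t'' t'' (mul t t' t'' \<tau> \<tau>') (d'' \<star>\<^bsub>X\<^esub> [covar X j t t'' (mul t t' t'' \<tau> \<tau>')])"
      using mul_assoc[OF \<tau> \<tau>' hcell_app[OF D(4)[OF T''] hcell_covar[OF D(9)[OF T]]]]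
        hcell_mul[OF \<tau> \<tau>'] by simp
    finally show ?thesis
      using e hcell_mul[OF \<tau> \<tau>'] by (simp add: iff[OF T T''])
  qed
  have \<tau>: "hcell \<tau> t [] t'" if "relative_monad X j (t, d, e)" "relative_monad X j (t', d', e')"
    "relative_monad_morphism X j (t, d, e) (t', d', e') \<tau>" for t d e t' d' e' \<tau>
    using that iff by simp
  note r = RMnd_def tcell_comp_mul
  show ?thesis
    by standard
      (auto simp: r intro: id,
       meson comp, metis \<tau> mul_frown(2), metis \<tau> mul_frown(1), metis \<tau> mul_assoc)
qed

lemma mediator:
  assumes "opalgebra_object X j T K" "opalgebra X j T al"
  shows "mediates X K al u \<longleftrightarrow> u = mediator X K al"
proof -
  have "\<exists>!u. mediates X K al u" using assms unfolding opalgebra_object_def by blast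
  then show ?thesis unfolding mediator_def by (metis theI)
qed

text \<open>\<open>E(j,\<tau>)\<close> preserves the unit because \<open>\<tau>\<close> does, and
  preserves Kleisli composites by the compatibility of \<open>\<tau>\<close> with the extension
  operators; the opalgebra laws for \<open>l\<close> therefore restrict along it.\<close>

lemma opalgebra_reindex:
  assumes j: "j \<in> Tight X" and T: "relative_monad X j (t, d, e)" and T': "relative_monad X j (t', d', e')"
    and a: "opalgebra X j (t', d', e') (a, l)"
    and m: "relative_monad_morphism X j (t, d, e) (t', d', e') \<tau>"
  shows "opalgebra X j (t, d, e) (a, l \<star>\<^bsub>X\<^esub> [covar X j t t' \<tau>])"
proof -
  note D = relative_monadD[OF j T] and D' = relative_monadD[OF j T'] and A = opalgebraD[OF j T' a]
  note m = m[unfolded relative_monad_morphism_iff[OF j T T']]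
  have \<tau>: "hcell \<tau> t [] t'" using m by auto
  note c = hcell_covar[OF D(9) \<tau>]
  note i = hcell_cid[OF D(9)]
  let ?c = "covar X j t t' \<tau>" and ?i = "cid X (loose_hom X j t)"
  note w = hcell_mul[OF i D(4)]
  note d'c = hcell_app[OF D'(4) c]
  have "(l \<star>\<^bsub>X\<^esub> [?c]) \<star>\<^bsub>X\<^esub> [e] = l \<star>\<^bsub>X\<^esub> [?c \<star>\<^bsub>X\<^esub> [e]]"
    using vcomp_assoc[OF A(3) c, of "[e]" "[]"] hcell_path[OF D(5)] D(2) D'(2) by simp
  also have "\<dots> = frown X a"
    using covar_app[OF \<tau> D(5)] m A(4) by simp
  finally have unit: "(l \<star>\<^bsub>X\<^esub> [?c]) \<star>\<^bsub>X\<^esub> [e] = frown X a" .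
  have "mul a a a (l \<star>\<^bsub>X\<^esub> [?c]) (l \<star>\<^bsub>X\<^esub> [?c]) = l \<star>\<^bsub>X\<^esub> [mul j t' t' ?c (d' \<star>\<^bsub>X\<^esub> [?c])]"
    by (rule opalgebra_mul[OF j T' a c c])
  \<comment> \<open>\<open>?c\<close> is right multiplication of the identity by
    \<open>\<tau>\<close>, so reassociating exposes exactly the right-hand side of the morphism
    law.\<close>
  also have "mul j t' t' ?c (d' \<star>\<^bsub>X\<^esub> [?c]) = mul j t t' ?i (mul t t' t' \<tau> (d' \<star>\<^bsub>X\<^esub> [?c]))"
    using mul_assoc[OF i \<tau> d'c] by (simp add: covar_mul)
  also have "\<dots> = ?c \<star>\<^bsub>X\<^esub> [mul j t t ?i d]"
    using m covar_app[OF \<tau> w] mul_assoc[OF i D(4) \<tau>] by simp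
  also have "l \<star>\<^bsub>X\<^esub> [\<dots>] = (l \<star>\<^bsub>X\<^esub> [?c]) \<star>\<^bsub>X\<^esub> [mul j t t ?i d]"
    using vcomp_assoc[OF A(3) c] hcell_path[OF w] D(2) D'(2) by simp
  finally show ?thesis
    using A unit hcell_app[OF A(3) c] by (simp add: opalgebra_iff[OF j T])
qed

text \<open>Functoriality is uniqueness of mediators: the identity tight-cell mediates the opalgebra
  reindexed along an identity, and a composite of mediators mediates the one reindexed along a
  composite.\<close>

lemma cat_functor_k:
  assumes j: "j \<in> Tight X"
    and K: "\<And>T. relative_monad X j T \<Longrightarrow> admits_opalgebra_object X j T \<Longrightarrow> opalgebra_object X j T (K T)"
  shows "cat_functor (full_subcategory (RMnd X j) (admits_opalgebra_object X j)) (under X (tdom X j))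
    (k_ob K) (k_mor X K j)"
proof -
  let ?C = "full_subcategory (RMnd X j) (admits_opalgebra_object X j)"
  have ob: "T \<in> ob ?C \<longleftrightarrow> relative_monad X j T \<and> admits_opalgebra_object X j T" for T
    by (auto simp: full_subcategory_def RMnd_def)
  have hom: "\<tau> \<in> hom ?C T T' \<longleftrightarrow> relative_monad_morphism X j T T' \<tau>" for \<tau> T T'
    by (auto simp: full_subcategory_def RMnd_def)
  have opalg: "opalgebra X j T (fst (K T), snd (K T))" if "T \<in> ob ?C" for T
    using K[of T] that unfolding ob opalgebra_object_def by simp
  have med: "mediates X (K T) (fst (K T'), snd (K T') \<star>\<^bsub>X\<^esub> [covar X j (fst T) (fst T') \<tau>]) u
      \<longleftrightarrow> u = k_mor X K j T T' \<tau>"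
    if T: "T \<in> ob ?C" and T': "T' \<in> ob ?C" and m: "\<tau> \<in> hom ?C T T'" for T T' \<tau> u
  proof -
    obtain t d e t' d' e' where e: "T = (t, d, e)" "T' = (t', d', e')" by (metis prod_cases3)
    have "opalgebra X j T (fst (K T'), snd (K T') \<star>\<^bsub>X\<^esub> [covar X j (fst T) (fst T') \<tau>])"
      using opalgebra_reindex[OF j, of t d e t' d' e'] opalg[OF T'] T T' m e unfolding ob hom by simp
    with mediator[OF K] T show ?thesis unfolding ob k_mor_def by blast
  qed
  interpret C: category ?C by (rule category_full_subcategory[OF category_RMnd[OF j]])
  interpret D: category "under X (tdom X j)" by (rule category_under)
  show ?thesis
  proof
    fix T assume T: "T \<in> ob ?C"
    obtain t d e where e: "T = (t, d, e)" by (metis prod_cases3)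
    have rm: "relative_monad X j (t, d, e)" using T e unfolding ob by simp
    note o = opalgebraD[OF j rm opalg[OF T, unfolded e]]
    show "k_ob K T \<in> ob (under X (tdom X j))"
      using o e by (simp add: k_ob_def under_def)
    have i: "idt ?C T \<in> hom ?C T T" by (rule C.idt_in_hom[OF T])
    have f: "idt ?C T = frown X t" by (simp add: e full_subcategory_def RMnd_def)
    let ?k = "fst (K T)" and ?m = "snd (K T)"
    have m: "hcell ?m ?k [loose_hom X j t] ?k" using o e by simp
    have k: "?k \<in> Tight X" using o e by simp
    have "?m \<star>\<^bsub>X\<^esub> [covar X j t t (frown X t)] = ?m"
      using covar_frown[OF relative_monadD(9)[OF j rm]] vcomp_cids[OF m] by simp
    moreover have "act X (tid X (tcod X ?k)) ?k ?k \<star>\<^bsub>X\<^esub> [?m] = ?m"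
      using act_tid[OF hcellD(1)[OF m]] cid_vcomp[OF m] by simp
    ultimately have "mediates X (K T) (?k, ?m \<star>\<^bsub>X\<^esub> [covar X j t t (frown X t)]) (tid X (tcod X ?k))"
      unfolding mediates_iff using k by (simp add: tight_def)
    with med[OF T T i] e f show "k_mor X K j T T (idt ?C T) = idt (under X (tdom X j)) (k_ob K T)"
      by (simp add: under_def k_ob_def)
  next
    fix T T' \<tau> assume T: "T \<in> ob ?C" "T' \<in> ob ?C" "\<tau> \<in> hom ?C T T'"
    have "mediates X (K T) (fst (K T'), snd (K T') \<star>\<^bsub>X\<^esub> [covar X j (fst T) (fst T') \<tau>])
      (k_mor X K j T T' \<tau>)"
      using med[OF T] by simp
    then show "k_mor X K j T T' \<tau> \<in> hom (under X (tdom X j)) (k_ob K T) (k_ob K T')"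
      by (simp add: mediates_iff under_def k_ob_def)
  next
    fix T T' T'' \<tau> \<tau>'
    assume T: "T \<in> ob ?C" and T': "T' \<in> ob ?C" and T'': "T'' \<in> ob ?C"
      and \<tau>: "\<tau> \<in> hom ?C T T'" and \<tau>': "\<tau>' \<in> hom ?C T' T''"
    obtain t d e t' d' e' t'' d'' e'' where e: "T = (t, d, e)" "T' = (t', d', e')" "T'' = (t'', d'', e'')"
      by (metis prod_cases3)
    have rm: "relative_monad X j (t, d, e)" "relative_monad X j (t', d', e')" "relative_monad X j (t'', d'', e'')"
      using T T' T'' e unfolding ob by auto
    have c: "cmp ?C T T' T'' \<tau>' \<tau> = mul t t' t'' \<tau> \<tau>'"
      by (simp add: e full_subcategory_def RMnd_def tcell_comp_mul)
    have h: "hcell \<tau> t [] t'" "hcell \<tau>' t' [] t''"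
      using \<tau> \<tau>' e relative_monad_morphism_iff[OF j rm(1,2)] relative_monad_morphism_iff[OF j rm(2,3)]
      unfolding hom by auto
    have comp: "cmp ?C T T' T'' \<tau>' \<tau> \<in> hom ?C T T''" by (rule C.cmp_in_hom[OF T T' T'' \<tau> \<tau>'])
    let ?k = "fst (K T)" and ?m = "snd (K T)" and ?k' = "fst (K T')" and ?m' = "snd (K T')"
      and ?k'' = "fst (K T'')" and ?m'' = "snd (K T'')"
    let ?u = "k_mor X K j T T' \<tau>" and ?u' = "k_mor X K j T' T'' \<tau>'"
    note o = opalgebraD[OF j rm(1) opalg[OF T, unfolded e]]
    have m: "hcell ?m ?k [loose_hom X j t] ?k" using o e by simp
    note o' = opalgebraD[OF j rm(2) opalg[OF T', unfolded e]]
    have m': "hcell ?m' ?k' [loose_hom X j t'] ?k'" using o' e by simp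
    note o'' = opalgebraD[OF j rm(3) opalg[OF T'', unfolded e]]
    have m'': "hcell ?m'' ?k'' [loose_hom X j t''] ?k''" using o'' e by simp
    have "mediates X (K T) (?k', ?m' \<star>\<^bsub>X\<^esub> [covar X j t t' \<tau>]) ?u"
      using med[OF T T' \<tau>] e by simp
    then have u: "?u \<in> Tight X" "tdom X ?u = tcod X ?k" "tcod X ?u = tcod X ?k'" "tcomp X ?u ?k = ?k'"
      "act X ?u ?k ?k \<star>\<^bsub>X\<^esub> [?m] = ?m' \<star>\<^bsub>X\<^esub> [covar X j t t' \<tau>]" by (auto simp: mediates_iff tight_def)
    have "mediates X (K T') (?k'', ?m'' \<star>\<^bsub>X\<^esub> [covar X j t' t'' \<tau>']) ?u'"
      using med[OF T' T'' \<tau>'] e by simp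
    then have u': "?u' \<in> Tight X" "tdom X ?u' = tcod X ?k'" "tcod X ?u' = tcod X ?k''" "tcomp X ?u' ?k' = ?k''"
      "act X ?u' ?k' ?k' \<star>\<^bsub>X\<^esub> [?m'] = ?m'' \<star>\<^bsub>X\<^esub> [covar X j t' t'' \<tau>']" by (auto simp: mediates_iff tight_def)
    have k: "?k \<in> Tight X" using o e by simp
    have uu: "tcomp X (tcomp X ?u' ?u) ?k = ?k''"
      using u u' k by (simp add: tcomp_assoc')
    note t = relative_monadD[OF j rm(1)] and t' = relative_monadD[OF j rm(2)] and t'' = relative_monadD[OF j rm(3)]
    note cv = hcell_covar[OF t(9) h(1)] and cv' = hcell_covar[OF t'(9) h(2)]
    \<comment> \<open>\<open>?u\<close> carries \<open>?m\<close> to \<open>?m'\<close> and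
      \<open>?u'\<close> carries \<open>?m'\<close> to \<open>?m''\<close>. Each passage leaves one
      \<open>covar\<close> behind, and the two compose.\<close>
    have "act X (tcomp X ?u' ?u) ?k ?k \<star>\<^bsub>X\<^esub> [?m]
        = act X ?u' ?k' ?k' \<star>\<^bsub>X\<^esub> [?m' \<star>\<^bsub>X\<^esub> [covar X j t t' \<tau>]]"
      using act_tcomp[OF m, of ?u ?u'] u u' by simp
    also have "\<dots> = (act X ?u' ?k' ?k' \<star>\<^bsub>X\<^esub> [?m']) \<star>\<^bsub>X\<^esub> [covar X j t t' \<tau>]"
      using app_assoc[OF hcell_act[OF hcellD(1)[OF m'], of ?u'] m' cv] u' by simp
    also have "\<dots> = ?m'' \<star>\<^bsub>X\<^esub> [covar X j t' t'' \<tau>' \<star>\<^bsub>X\<^esub> [covar X j t t' \<tau>]]"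
      using app_assoc[OF m'' cv' cv] u' by simp
    also have "\<dots> = ?m'' \<star>\<^bsub>X\<^esub> [covar X j t t'' (mul t t' t'' \<tau> \<tau>')]"
      using covar_comp[OF t(9) h] by simp
    finally have "mediates X (K T) (?k'', ?m'' \<star>\<^bsub>X\<^esub> [covar X j t t'' (mul t t' t'' \<tau> \<tau>')]) (tcomp X ?u' ?u)"
      using uu u u' k by (simp add: mediates_iff tight_def)
    with med[OF T T'' comp] c e
    show "k_mor X K j T T'' (cmp ?C T T' T'' \<tau>' \<tau>)
      = cmp (under X (tdom X j)) (k_ob K T) (k_ob K T') (k_ob K T'') ?u' ?u"
      by (simp add: under_def)
  qed
qed

section \<open>Density\<close>

text \<open>An instance of \<open>rmul_natural\<close> for \<open>hom_cell f g\<close>: a right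
  factor living at the domain of \<open>g\<close> is pushed forward by \<open>g\<close> under
  transposition. With \<open>g\<close> an identity it serves density; with \<open>g\<close> the
  mediator \<open>v\<close> it produces the action of \<open>v\<close> in
  \<open>opalgebra_object_section\<close>.\<close>

lemma hat_rmul:
  assumes c: "cospan f g" and \<phi>: "cell X \<phi> f' rs (loose_hom X f g) k" and \<psi>: "cell X \<psi> k ss (lid X (tdom X g)) m"
  shows "hat f g (\<phi> \<bullet> \<psi>) = hat f g \<phi> \<bullet> ccomp X (lid_map X g) k [\<psi>]"
proof -
  have f': "f' \<in> Tight X" "tcod X f' = tdom X f" using cellD[OF \<phi>] c by auto
  have \<psi>': "cell X \<psi> k ss (lid X (ldom X (loose_hom X f g))) m" using \<psi> c by simp
  have h: "cell X (hom_cell X f g) f ([] @ [loose_hom X f g]) (lid X (tcod X f)) g"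
    using hom_cell(1)[OF c] by simp
  show ?thesis
    using rmul_natural[OF h path_Nil[OF f'(1)] \<phi> \<psi>' f'(2)]
    by (simp add: hat_eq[OF cell_rmul[OF \<phi> \<psi>']] hat_eq[OF \<phi>])
qed

lemma ccomp_rmul_split:
  assumes "cell X \<phi> f rs (lid X E) g" "cell X \<psi> g ss (lid X E) h" "E \<in> Obj X"
    "path f' \<xi>s us rs m" "path m \<xi>s' us' ss k" "tcod X f' = tdom X f"
  shows "ccomp X (\<phi> \<bullet> \<psi>) f' (\<xi>s @ \<xi>s') = ccomp X \<phi> f' \<xi>s \<bullet> ccomp X \<psi> m \<xi>s'"
  using rmul_ccomp[OF assms(1) _ assms(4,5,6)] assms(2,3) by simp

text \<open>The unit of the companion \<open>E(1,f)\<close>, used to instantiate an argument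
  \<open>E(1,f)\<close> at the identity of \<open>f\<close>.\<close>

lemma left_unit_cell:
  assumes "f \<in> Tight X"
  obtains i where "cell X i f [] (loose_hom X (tid X (tcod X f)) f) (tid X (tdom X f))"
    "hat (tid X (tcod X f)) f i = uid f"
  using hat_ex[of "tid X (tcod X f)" f f "tid X (tdom X f)" "uid f" "[]"] cell_uid[OF assms] assms
  by (auto simp: cospan_def)

text \<open>The corresponding unit of the conjoint \<open>E(f,1)\<close>, now with \<open>f\<close>
  on the right.\<close>

lemma right_unit_cell:
  assumes "f \<in> Tight X"
  obtains i where "cell X i (tid X (tdom X f)) [] (loose_hom X f (tid X (tcod X f))) f"
    "hat f (tid X (tcod X f)) i = uid f"
  using hat_ex[of f "tid X (tcod X f)" "tid X (tdom X f)" f "uid f" "[]"] cell_uid[OF assms] assms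
  by (auto simp: cospan_def)

text \<open>Recasts the map in the definition of density: in transposed form it sends
  \<open>\<phi>\<close> to its product with the fixed left factor
  \<open>hom_cell X j (tid X E)\<close>.\<close>

lemma dense_transpose:
  assumes j: "j \<in> Tight X" and E: "E = tcod X j"
    and \<phi>: "cell X \<phi> (tid X E) rs (lid X E) (tid X E)"
  shows "hcell (unitor X (loose_hom X j (tid X E)) \<star>\<^bsub>X\<^esub> [cid X (loose_hom X j (tid X E)), \<phi>])
      j (loose_hom X j (tid X E) # rs) (tid X E)"
    "hat j (tid X E) (unitor X (loose_hom X j (tid X E)) \<star>\<^bsub>X\<^esub> [cid X (loose_hom X j (tid X E)), \<phi>])
      = hom_cell X j (tid X E) \<bullet> \<phi>"
proof -
  let ?p = "loose_hom X j (tid X E)"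
  have c: "cospan j (tid X E)" and E': "E \<in> Obj X" using j E by (auto simp: cospan_def)
  have i: "cell X (cid X ?p) (tid X (tdom X j)) [?p] ?p (tid X E)"
    using hcellD(2)[OF hcell_cid[OF c]] E' by simp
  have \<phi>': "cell X \<phi> (tid X E) rs (lid X (ldom X ?p)) (tid X E)" using \<phi> c E' by simp
  have e: "unitor X ?p \<star>\<^bsub>X\<^esub> [cid X ?p, \<phi>] = cid X ?p \<bullet> \<phi>"
    using vcomp_cell[OF unitor(1)] c j by (simp add: rmul_cell[OF i])
  show "hcell (unitor X ?p \<star>\<^bsub>X\<^esub> [cid X ?p, \<phi>]) j (?p # rs) (tid X E)"
    unfolding e using cell_rmul[OF i \<phi>'] c E' by (simp add: hcell_def)
  show "hat j (tid X E) (unitor X ?p \<star>\<^bsub>X\<^esub> [cid X ?p, \<phi>]) = hom_cell X j (tid X E) \<bullet> \<phi>"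
    unfolding e using hat_rmul[OF c i] \<phi> E' ccomp_cid(1)[OF \<phi>] by (simp add: hat_cid[OF c] lid_map_tid)
qed

lemma dense_bij:
  assumes "dense X j" "E = tcod X j" "chain X rs E E"
  shows "bij_betw (\<lambda>\<phi>. unitor X (loose_hom X j (tid X E)) \<star>\<^bsub>X\<^esub> [cid X (loose_hom X j (tid X E)), \<phi>])
    {\<phi>. cell X \<phi> (tid X E) rs (lid X E) (tid X E)} {\<psi>. hcell \<psi> j (loose_hom X j (tid X E) # rs) (tid X E)}"
proof -
  have j: "j \<in> Tight X" using assms by (simp add: dense_def)
  then have "cospan j (tid X E)" "E \<in> Obj X" using assms(2) by (auto simp: cospan_def)
  then have "{\<phi>. cell X \<phi> (tid X E) rs (lid X E) (tid X E)} = {\<phi>. globular X \<phi> rs (lid X E)}"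
    "{\<psi>. hcell \<psi> j (loose_hom X j (tid X E) # rs) (tid X E)}
      = {\<psi>. globular X \<psi> (loose_hom X j (tid X E) # rs) (loose_hom X j (tid X E))}"
    by (simp_all add: globular_def hcell_def)
  then show ?thesis
    using assms unfolding dense_def Let_def by simp
qed

text \<open>\<open>\<sigma> : rs \<Rightarrow> E(f,g)\<close> is transposed to a globular 2-cell \<open>H \<sigma> : E(1,f), rs, E(g,1) \<Rightarrow> E(1,1)\<close>, to which
  density applies; \<open>\<sigma>\<close> is recovered from it by inserting identities.\<close>

lemma dense_faithful:
  assumes dense: "dense X j" and f: "tcod X f = tcod X j"
    and \<tau>: "hcell \<tau> f rs g" and \<tau>': "hcell \<tau>' f rs g"
    and eq: "mul j f g (cid X (loose_hom X j f)) \<tau> = mul j f g (cid X (loose_hom X j f)) \<tau>'"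
  shows "\<tau> = \<tau>'"
proof -
  define E where "E = tcod X j"
  let ?I = "tid X E"
  have j: "j \<in> Tight X" using dense by (simp add: dense_def)
  have E: "E \<in> Obj X" using j by (simp add: E_def)
  have fg: "f \<in> Tight X" "g \<in> Tight X" "tcod X f = E" "tcod X g = E"
    using hcellD[OF \<tau>] f by (simp_all add: E_def)
  have c: "cospan j ?I" "cospan ?I f" "cospan g ?I" "cospan j f" "cospan ?I ?I"
    using fg j E by (simp_all add: cospan_def E_def)
  let ?a = "cid X (loose_hom X ?I f)" and ?b = "cid X (loose_hom X g ?I)" and ?i = "cid X (loose_hom X j ?I)"
  note a = hcell_cid[OF c(2)] and b = hcell_cid[OF c(3)] and i = hcell_cid[OF c(1)]
  let ?rs = "[loose_hom X ?I f] @ rs @ [loose_hom X g ?I]"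
  define H where "H \<sigma> = hom_cell X ?I f \<bullet> hat f g \<sigma> \<bullet> hom_cell X g ?I" for \<sigma>
  have h1: "cell X (hom_cell X ?I f) ?I [loose_hom X ?I f] (lid X E) f"
    and h2: "cell X (hom_cell X g ?I) g [loose_hom X g ?I] (lid X E) ?I"
    using hom_cell(1)[OF c(2)] hom_cell(1)[OF c(3)] E fg by simp_all
  obtain i1 where i1: "cell X i1 f [] (loose_hom X ?I f) (tid X (tdom X f))" "hat ?I f i1 = uid f"
    using left_unit_cell[OF fg(1)] fg by auto
  obtain i2 where i2: "cell X i2 (tid X (tdom X g)) [] (loose_hom X g ?I) g" "hat g ?I i2 = uid g"
    using right_unit_cell[OF fg(2)] fg by auto
  note m = hcell_mul[OF i a]
  \<comment> \<open>The second and third clauses show that the image of \<open>H \<sigma>\<close>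
    under the density map depends on \<open>\<sigma>\<close> only through its product with the
    identity of \<open>E(j,f)\<close>, which is what \<open>eq\<close> compares.\<close>
  have H: "cell X (H \<sigma>) ?I ?rs (lid X E) ?I"
    "hom_cell X j ?I \<bullet> H \<sigma> = hat j ?I (mul j g ?I (mul j f g (mul j ?I f ?i ?a) \<sigma>) ?b)"
    "mul j f g (mul j ?I f ?i ?a) \<sigma>
      = mul j f g (cid X (loose_hom X j f)) \<sigma> \<star>\<^bsub>X\<^esub> ([mul j ?I f ?i ?a] @ map (cid X) rs)"
    "hat f g \<sigma> = ccomp X (H \<sigma>) f (([i1] @ map (cid X) rs) @ [i2])"
    if \<sigma>: "hcell \<sigma> f rs g" for \<sigma>
  proof -
    have hs: "cell X (hat f g \<sigma>) f rs (lid X E) g" using hcell_hat[OF \<sigma>] fg by simp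
    have p: "cell X (hom_cell X ?I f \<bullet> hat f g \<sigma>) ?I ([loose_hom X ?I f] @ rs) (lid X E) g"
      using cell_rmul[OF h1, of "hat f g \<sigma>" rs g] hs E by simp
    have q: "cell X (H \<sigma>) ?I (([loose_hom X ?I f] @ rs) @ [loose_hom X g ?I]) (lid X E) ?I"
      unfolding H_def using cell_rmul[OF p, of "hom_cell X g ?I"] h2 E by simp
    then show "cell X (H \<sigma>) ?I ?rs (lid X E) ?I" by simp
    note as = hcell_mul[OF a \<sigma>] and ias = hcell_mul[OF m \<sigma>]
    have "hom_cell X j ?I \<bullet> H \<sigma> = hat j ?I (mul j ?I ?I ?i (mul ?I g ?I (mul ?I f g ?a \<sigma>) ?b))"
      unfolding hat_mul[OF i hcell_mul[OF as b]] hat_mul[OF as b] hat_mul[OF a \<sigma>]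
      by (simp add: H_def hat_cid c)
    also have "mul j ?I ?I ?i (mul ?I g ?I (mul ?I f g ?a \<sigma>) ?b)
       = mul j g ?I (mul j f g (mul j ?I f ?i ?a) \<sigma>) ?b"
      unfolding mul_assoc[OF i as b, symmetric] mul_assoc[OF i a \<sigma>] ..
    finally show "hom_cell X j ?I \<bullet> H \<sigma> = hat j ?I (mul j g ?I (mul j f g (mul j ?I f ?i ?a) \<sigma>) ?b)" .
    show "mul j f g (mul j ?I f ?i ?a) \<sigma>
      = mul j f g (cid X (loose_hom X j f)) \<sigma> \<star>\<^bsub>X\<^esub> ([mul j ?I f ?i ?a] @ map (cid X) rs)"
      using mul_vcomp[OF hcell_cid[OF c(4)] \<sigma> hcell_path[OF m] path_cids[OF hcellD(6)[OF \<sigma>]]]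
        cid_vcomp[OF m] vcomp_cids[OF \<sigma>] by simp
    have pc: "path (tid X (tdom X f)) (map (cid X) rs) rs rs (tid X (tdom X g))"
      using path_cids[OF hcellD(6)[OF \<sigma>]] .
    have "ccomp X (H \<sigma>) f (([i1] @ map (cid X) rs) @ [i2])
      = ccomp X (hom_cell X ?I f \<bullet> hat f g \<sigma>) f ([i1] @ map (cid X) rs)
        \<bullet> ccomp X (hom_cell X g ?I) (tid X (tdom X g)) [i2]"
      unfolding H_def
      by (rule ccomp_rmul_split[OF p h2 E path_append[OF path_single[OF i1(1)] pc] path_single[OF i2(1)]])
        (use fg E in simp)
    also have "ccomp X (hom_cell X ?I f \<bullet> hat f g \<sigma>) f ([i1] @ map (cid X) rs)
      = ccomp X (hom_cell X ?I f) f [i1] \<bullet> ccomp X (hat f g \<sigma>) (tid X (tdom X f)) (map (cid X) rs)"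
      by (rule ccomp_rmul_split[OF h1 hs E path_single[OF i1(1)] pc]) (use fg E in simp)
    also have "\<dots> = uid f \<bullet> hat f g \<sigma>"
      using i1(2) ccomp_cid(2)[OF hs] by (simp add: hat_eq[OF i1(1)])
    also have "\<dots> = hat f g \<sigma>" using uid_rmul[of "hat f g \<sigma>" f rs g] hs fg by simp
    also have "hat f g \<sigma> \<bullet> ccomp X (hom_cell X g ?I) (tid X (tdom X g)) [i2] = hat f g \<sigma>"
      using i2(2) rmul_uid[OF hs] by (simp add: hat_eq[OF i2(1)])
    finally show "hat f g \<sigma> = ccomp X (H \<sigma>) f (([i1] @ map (cid X) rs) @ [i2])" ..
  qed
  have ch: "chain X ?rs E E" using cellD(10)[OF H(1)[OF \<tau>]] E by simp
  have "hom_cell X j ?I \<bullet> H \<tau> = hom_cell X j ?I \<bullet> H \<tau>'"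
    unfolding H(2)[OF \<tau>] H(2)[OF \<tau>'] H(3)[OF \<tau>] H(3)[OF \<tau>'] eq ..
  then have "unitor X (loose_hom X j ?I) \<star>\<^bsub>X\<^esub> [?i, H \<tau>] = unitor X (loose_hom X j ?I) \<star>\<^bsub>X\<^esub> [?i, H \<tau>']"
    using hcell_inj[OF dense_transpose(1)[OF j E_def H(1)[OF \<tau>]] dense_transpose(1)[OF j E_def H(1)[OF \<tau>']]]
    unfolding dense_transpose(2)[OF j E_def H(1)[OF \<tau>]] dense_transpose(2)[OF j E_def H(1)[OF \<tau>']]
    by blast
  with bij_betw_imp_inj_on[OF dense_bij[OF dense E_def ch]] H(1)[OF \<tau>] H(1)[OF \<tau>']
  have "H \<tau> = H \<tau>'" unfolding inj_on_def by blast
  with H(4)[OF \<tau>] H(4)[OF \<tau>'] have "hat f g \<tau> = hat f g \<tau>'" by simp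
  with hcell_inj[OF \<tau> \<tau>'] show ?thesis .
qed

text \<open>Precomposing \<open>\<theta>\<close> with the composition
  \<open>m : E(j,1), E(1,f) \<Rightarrow> E(j,f)\<close> and multiplying by \<open>E(g,1)\<close>
  gives a 2-cell to which density applies. It comes from some
  \<open>\<phi> : E(1,f), E(g,1) \<Rightarrow> E(1,1)\<close>, whose value at the identities of
  \<open>f\<close> and \<open>g\<close> is \<open>\<tau>\<close>.\<close>

lemma dense_full:
  assumes dense: "dense X j" and f: "f \<in> Tight X" "tcod X f = tcod X j"
    and \<theta>: "hcell \<theta> j [loose_hom X j f] g"
  obtains \<tau> where "hcell \<tau> f [] g" "covar X j f g \<tau> = \<theta>"
proof -
  define E where "E = tcod X j"
  let ?I = "tid X E"
  have j: "j \<in> Tight X" using dense by (simp add: dense_def)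
  have E: "E \<in> Obj X" using j by (simp add: E_def)
  have fg: "f \<in> Tight X" "g \<in> Tight X" "tcod X f = E" "tcod X g = E"
    using hcellD[OF \<theta>] f by (simp_all add: E_def)
  have c: "cospan j ?I" "cospan ?I f" "cospan g ?I" "cospan j f" "cospan f g" "cospan j g"
    using fg j E by (simp_all add: cospan_def E_def)
  have dom: "tdom X g = tdom X f" using op_tdom[OF \<theta> c(4)] by simp
  let ?a = "cid X (loose_hom X ?I f)" and ?b = "cid X (loose_hom X g ?I)" and ?i = "cid X (loose_hom X j ?I)"
  note a = hcell_cid[OF c(2)] and b = hcell_cid[OF c(3)] and i = hcell_cid[OF c(1)]
  define m where "m = mul j ?I f ?i ?a"
  have m: "hcell m j [loose_hom X j ?I, loose_hom X ?I f] f" using hcell_mul[OF i a] by (simp add: m_def)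
  note \<theta>m = hcell_app[OF \<theta> m]
  have \<psi>: "hcell (mul j g ?I (\<theta> \<star>\<^bsub>X\<^esub> [m]) ?b) j (loose_hom X j ?I # [loose_hom X ?I f, loose_hom X g ?I]) ?I"
    using hcell_mul[OF \<theta>m b] by simp
  have ch: "chain X [loose_hom X ?I f, loose_hom X g ?I] E E" using c E dom by simp
  from bij_betw_imp_surj_on[OF dense_bij[OF dense E_def ch]] \<psi>
  have "mul j g ?I (\<theta> \<star>\<^bsub>X\<^esub> [m]) ?b \<in> (\<lambda>\<phi>. unitor X (loose_hom X j ?I) \<star>\<^bsub>X\<^esub> [?i, \<phi>])
      ` {\<phi>. cell X \<phi> ?I [loose_hom X ?I f, loose_hom X g ?I] (lid X E) ?I}"
    by simp
  then obtain \<phi> where \<phi>: "cell X \<phi> ?I [loose_hom X ?I f, loose_hom X g ?I] (lid X E) ?I"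
    "unitor X (loose_hom X j ?I) \<star>\<^bsub>X\<^esub> [?i, \<phi>] = mul j g ?I (\<theta> \<star>\<^bsub>X\<^esub> [m]) ?b"
    by auto
  have \<phi>': "hom_cell X j ?I \<bullet> \<phi> = hat j g (\<theta> \<star>\<^bsub>X\<^esub> [m]) \<bullet> hom_cell X g ?I"
    using dense_transpose(2)[OF j E_def \<phi>(1)] \<phi>(2) hat_mul[OF \<theta>m b] c by (simp add: hat_cid)
  have h1: "cell X (hom_cell X j ?I) j [loose_hom X j ?I] (lid X E) ?I"
    and h2: "cell X (hom_cell X g ?I) g [loose_hom X g ?I] (lid X E) ?I"
    and h3: "cell X (hom_cell X ?I f) ?I [loose_hom X ?I f] (lid X E) f"
    and h4: "cell X (hom_cell X j f) j [loose_hom X j f] (lid X E) f"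
    using hom_cell(1)[OF c(1)] hom_cell(1)[OF c(2)] hom_cell(1)[OF c(3)] hom_cell(1)[OF c(4)] E fg
    by (simp_all add: E_def[symmetric])
  obtain i1 where i1: "cell X i1 f [] (loose_hom X ?I f) (tid X (tdom X f))" "hat ?I f i1 = uid f"
    using left_unit_cell[OF fg(1)] fg by auto
  obtain i2 where i2: "cell X i2 (tid X (tdom X f)) [] (loose_hom X g ?I) g" "hat g ?I i2 = uid g"
    using right_unit_cell[OF fg(2)] fg dom by auto
  let ?A = "tid X (tdom X j)"
  \<comment> \<open>\<open>i3\<close> presents \<open>E(j,f)\<close> as the restriction of
    \<open>E(j,1)\<close> along \<open>f\<close>. Inserting \<open>i3\<close> and \<open>i1\<close>
    into \<open>m\<close> gives the identity of \<open>E(j,f)\<close>, which cancels the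
    precomposition with \<open>m\<close>.\<close>
  obtain i3 where i3: "cell X i3 ?A [loose_hom X j f] (loose_hom X j ?I) f" "hat j ?I i3 = hom_cell X j f"
    using hat_ex[OF c(1), of ?A f "hom_cell X j f" "[loose_hom X j f]"] h4 j E fg by (auto simp: E_def[symmetric])
  have p12: "path f [i1,i2] [] [loose_hom X ?I f, loose_hom X g ?I] g"
    using path2[OF i1(1) i2(1)] by simp
  have "cell X (ccomp X \<phi> f [i1,i2]) f [] (lid X (tcod X f)) g"
    using cell_ccomp[OF \<phi>(1) p12] fg E by simp
  then obtain \<tau> where \<tau>: "hcell \<tau> f [] g" "hat f g \<tau> = ccomp X \<phi> f [i1,i2]"
    using hcell_ex[OF c(5)] by blast
  have p31: "path ?A [i3,i1] [loose_hom X j f] [loose_hom X j ?I, loose_hom X ?I f] (tid X (tdom X f))"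
    using path2[OF i3(1) i1(1)] by simp
  have jA: "tcod X ?A = tdom X j" "tdom X ?A = tdom X j" "?A \<in> Tight X" using j by simp_all
  have md: "cell X m ?A [loose_hom X j ?I, loose_hom X ?I f] (loose_hom X j f) (tid X (tdom X f))"
    using hcellD(2)[OF m] .
  have "hat j f (ccomp X m ?A [i3,i1]) = ccomp X (hat j f m) ?A [i3,i1]"
    by (rule hat_ccomp[OF c(4) md p31]) (use j in simp)
  also have "hat j f m = hom_cell X j ?I \<bullet> hom_cell X ?I f"
    using hat_mul[OF i a] c by (simp add: m_def hat_cid)
  also have "ccomp X (hom_cell X j ?I \<bullet> hom_cell X ?I f) ?A [i3,i1] = ccomp X (hom_cell X j ?I) ?A [i3] \<bullet> ccomp X (hom_cell X ?I f) f [i1]"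
    using ccomp_rmul_split[OF h1 h3 E path_single[OF i3(1)] path_single[OF i1(1)] jA(1)] by simp
  also have "\<dots> = hat j f (cid X (loose_hom X j f))"
    using i1(2) i3(2) rmul_uid[OF h4] by (simp add: hat_eq[OF i1(1)] hat_eq[OF i3(1)] hat_cid[OF c(4)])
  finally have m31: "ccomp X m ?A [i3,i1] = cid X (loose_hom X j f)"
    using hat_inj[OF c(4), of _ ?A "[loose_hom X j f]" "tid X (tdom X f)"] cell_ccomp[OF md p31] jA
      hcellD(2)[OF hcell_cid[OF c(4)]] fg by simp
  \<comment> \<open>The insertions are regrouped by means of \<open>\<phi>'\<close>: on one side
    \<open>i1\<close> and \<open>i2\<close> go into \<open>\<phi>\<close>, on the other
    \<open>i3\<close> and \<open>i1\<close> go into \<open>m\<close> and \<open>i2\<close> into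
    \<open>E(g,1)\<close>.\<close>
  have "hat j g (covar X j f g \<tau>) = hom_cell X j f \<bullet> ccomp X \<phi> f [i1,i2]"
    using hat_mul[OF hcell_cid[OF c(4)] \<tau>(1)] \<tau>(2) by (simp add: covar_mul hat_cid[OF c(4)])
  also have "\<dots> = ccomp X (hom_cell X j ?I \<bullet> \<phi>) ?A ([i3] @ [i1,i2])"
    using ccomp_rmul_split[OF h1 \<phi>(1) E path_single[OF i3(1)] p12 jA(1)] i3(2) by (simp add: hat_eq[OF i3(1)])
  also have "\<dots> = ccomp X (hat j g (\<theta> \<star>\<^bsub>X\<^esub> [m]) \<bullet> hom_cell X g ?I) ?A ([i3,i1] @ [i2])"
    by (simp add: \<phi>')
  also have "\<dots> = ccomp X (hat j g (\<theta> \<star>\<^bsub>X\<^esub> [m])) ?A [i3,i1] \<bullet> uid g"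
    using ccomp_rmul_split[OF _ h2 E p31 path_single[OF i2(1)] jA(1)] hcell_hat[OF \<theta>m] i2(2)
    by (simp add: hat_eq[OF i2(1)] E_def[symmetric])
  also have "ccomp X (hat j g (\<theta> \<star>\<^bsub>X\<^esub> [m])) ?A [i3,i1] = hat j g \<theta>"
  proof -
    have \<theta>d: "cell X \<theta> ?A [loose_hom X j f] (loose_hom X j g) (tid X (tdom X g))" using hcellD(2)[OF \<theta>] .
    have "hat j g (\<theta> \<star>\<^bsub>X\<^esub> [m]) = hat j g (ccomp X \<theta> ?A [m])" by (simp add: vcomp_hcell[OF \<theta>])
    moreover have "ccomp X (hat j g (ccomp X \<theta> ?A [m])) ?A [i3,i1] = hat j g (ccomp X (ccomp X \<theta> ?A [m]) ?A [i3,i1])"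
      using hat_ccomp[OF c(6) hcellD(2)[OF \<theta>m, unfolded vcomp_hcell[OF \<theta>]] p31] jA by simp
    moreover have "ccomp X (ccomp X \<theta> ?A [m]) ?A [i3,i1] = \<theta>"
      using ccomp_assoc1[OF \<theta>d md p31] jA m31 ccomp_cid(2)[OF \<theta>d] by simp
    ultimately show ?thesis by simp
  qed
  also have "hat j g \<theta> \<bullet> uid g = hat j g \<theta>" by (rule rmul_uid[OF hcell_hat[OF \<theta>]])
  finally have "covar X j f g \<tau> = \<theta>"
    using hcell_inj[OF hcell_covar[OF c(4) \<tau>(1)] \<theta>] by blast
  with \<tau>(1) that show ?thesis by blast
qed

section \<open>Opalgebra objects\<close>

lemma rep_cell:
  assumes u: "u \<in> Tight X" and k: "k \<in> Tight X" "tcod X k = tdom X u"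
  shows "cell X (rep_cell X u k) (tid X (tcod X u)) [rep X (tcomp X u k)] (rep X u) k"
    "hat (tid X (tcod X u)) u (rep_cell X u k) = hom_cell X (tid X (tcod X u)) (tcomp X u k)"
proof -
  let ?I = "tid X (tcod X u)"
  have c: "cospan ?I u" "cospan ?I (tcomp X u k)" using u k by (auto simp: cospan_def)
  have "\<exists>!\<kappa>. cell X \<kappa> ?I [rep X (tcomp X u k)] (rep X u) k
      \<and> hom_cell X ?I u \<star>\<^bsub>X\<^esub> [\<kappa>] = hom_cell X ?I (tcomp X u k)"
    using hat_factor[OF c(1), of ?I k "hom_cell X ?I (tcomp X u k)" "[rep X (tcomp X u k)]"]
      hom_cell(1)[OF c(2)] vcomp_cell[OF hom_cell(1)[OF c(1)]] u k by simp
  from theI'[OF this]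
  show "cell X (rep_cell X u k) ?I [rep X (tcomp X u k)] (rep X u) k"
    "hat ?I u (rep_cell X u k) = hom_cell X ?I (tcomp X u k)"
    unfolding rep_cell_def[symmetric] using hat_eq vcomp_cell[OF hom_cell(1)[OF c(1)]] u by auto
qed

text \<open>Composing with \<open>rep_cell X u' k\<close> preserves transposes. The defining
  equation of \<open>restr_right\<close> thus prescribes its transpose, and existence and uniqueness
  reduce to the universal property of a restriction.\<close>

lemma restr_right:
  assumes u: "u \<in> Tight X" and u': "u' \<in> Tight X" "tdom X u' = tdom X u"
    and k: "k \<in> Tight X" "tcod X k = tdom X u"
    and \<beta>: "hcell \<beta> (tid X (tcod X u')) (ps @ [rep X u]) u'"
  shows "hcell (restr_right X ps u u' k \<beta>) (tid X (tcod X u')) (ps @ [rep X (tcomp X u k)]) (tcomp X u' k)"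
    "hat (tid X (tcod X u')) (tcomp X u' k) (restr_right X ps u u' k \<beta>)
      = ccomp X (hat (tid X (tcod X u')) u' \<beta>) (tid X (tcod X u')) (map (cid X) ps @ [rep_cell X u k])"
proof -
  let ?I = "tid X (tcod X u')"
  have c: "cospan ?I u'" "cospan ?I (tcomp X u' k)" using u' k by (auto simp: cospan_def)
  note r = rep_cell[OF u k] and r' = rep_cell[OF u'(1) k(1) k(2)[folded u'(2)]]
  have ch: "chain X ps (tcod X u) (tcod X u')"
    using hcellD(6)[OF \<beta>] u u' by (auto simp: chain_append cospan_def)
  have p: "path ?I (map (cid X) ps @ [rep_cell X u k]) (ps @ [rep X (tcomp X u k)]) (ps @ [rep X u]) k"
    using path_append[OF path_cids[OF ch] path_single[OF r(1)]] .
  have \<beta>': "cell X \<beta> ?I (ps @ [rep X u]) (rep X u') (tid X (tdom X u))"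
    using hcellD(2)[OF \<beta>] u' by simp
  define \<omega> where "\<omega> = \<beta> \<star>\<^bsub>X\<^esub> (map (cid X) ps @ [rep_cell X u k])"
  have \<omega>_eq: "\<omega> = ccomp X \<beta> ?I (map (cid X) ps @ [rep_cell X u k])"
    using vcomp_cell[OF \<beta>'] u' by (simp add: \<omega>_def)
  have \<omega>: "cell X \<omega> ?I (ps @ [rep X (tcomp X u k)]) (rep X u') k"
    unfolding \<omega>_eq using cell_ccomp[OF \<beta>' p] u' k by simp
  have hat_\<omega>: "hat ?I u' \<omega> = ccomp X (hat ?I u' \<beta>) ?I (map (cid X) ps @ [rep_cell X u k])"
    unfolding \<omega>_eq by (rule hat_ccomp[OF c(1) \<beta>' p]) (use u' in simp)
  have hr: "hat ?I u' (rep_cell X u' k \<star>\<^bsub>X\<^esub> [\<gamma>]) = hat ?I (tcomp X u' k) \<gamma>"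
    "cell X (rep_cell X u' k \<star>\<^bsub>X\<^esub> [\<gamma>]) ?I rs (rep X u') k"
    if \<gamma>: "hcell \<gamma> ?I rs (tcomp X u' k)" for \<gamma> rs
  proof -
    have \<gamma>': "cell X \<gamma> ?I rs (rep X (tcomp X u' k)) (tid X (tdom X k))" using hcellD(2)[OF \<gamma>] u' k by simp
    have e: "rep_cell X u' k \<star>\<^bsub>X\<^esub> [\<gamma>] = ccomp X (rep_cell X u' k) ?I [\<gamma>]"
      using vcomp_cell[OF r'(1)] u' by simp
    show "hat ?I u' (rep_cell X u' k \<star>\<^bsub>X\<^esub> [\<gamma>]) = hat ?I (tcomp X u' k) \<gamma>"
      unfolding e using hat_ccomp[OF c(1) r'(1), of ?I "[\<gamma>]"] path_single[OF \<gamma>'] u' k r'(2)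
      by (simp add: hat_eq[OF \<gamma>'])
    show "cell X (rep_cell X u' k \<star>\<^bsub>X\<^esub> [\<gamma>]) ?I rs (rep X u') k"
      unfolding e using cell_ccomp1[OF r'(1) \<gamma>'] u' k by simp
  qed
  have ex: "\<exists>!\<gamma>. hcell \<gamma> ?I (ps @ [rep X (tcomp X u k)]) (tcomp X u' k) \<and> rep_cell X u' k \<star>\<^bsub>X\<^esub> [\<gamma>] = \<omega>"
  proof -
    have "cell X (hat ?I u' \<omega>) ?I (ps @ [rep X (tcomp X u k)]) (lid X (tcod X ?I)) (tcomp X u' k)"
      using cell_hat[OF c(1) \<omega>] u' by simp
    then obtain \<gamma> where \<gamma>: "hcell \<gamma> ?I (ps @ [rep X (tcomp X u k)]) (tcomp X u' k)"
      "hat ?I (tcomp X u' k) \<gamma> = hat ?I u' \<omega>"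
      using hcell_ex[OF c(2)] by blast
    have "rep_cell X u' k \<star>\<^bsub>X\<^esub> [\<gamma>] = \<omega>"
      using hat_inj[OF c(1) hr(2)[OF \<gamma>(1)] \<omega>] hr(1)[OF \<gamma>(1)] \<gamma>(2) by simp
    moreover have "\<gamma>' = \<gamma>"
      if "hcell \<gamma>' ?I (ps @ [rep X (tcomp X u k)]) (tcomp X u' k)" "rep_cell X u' k \<star>\<^bsub>X\<^esub> [\<gamma>'] = \<omega>" for \<gamma>'
      using hcell_inj[OF that(1) \<gamma>(1)] hr(1)[OF that(1)] that(2) \<gamma>(2) by simp
    ultimately show ?thesis using \<gamma>(1) by blast
  qed
  have "restr_right X ps u u' k \<beta>
      = (THE \<gamma>. hcell \<gamma> ?I (ps @ [rep X (tcomp X u k)]) (tcomp X u' k) \<and> rep_cell X u' k \<star>\<^bsub>X\<^esub> [\<gamma>] = \<omega>)"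
    unfolding restr_right_def \<omega>_def using c(2) u' k by (simp add: hcell_globular)
  with theI'[OF ex]
  have R: "hcell (restr_right X ps u u' k \<beta>) ?I (ps @ [rep X (tcomp X u k)]) (tcomp X u' k)"
    "rep_cell X u' k \<star>\<^bsub>X\<^esub> [restr_right X ps u u' k \<beta>] = \<omega>" by simp_all
  show "hcell (restr_right X ps u u' k \<beta>) ?I (ps @ [rep X (tcomp X u k)]) (tcomp X u' k)" by (fact R(1))
  show "hat ?I (tcomp X u' k) (restr_right X ps u u' k \<beta>)
      = ccomp X (hat ?I u' \<beta>) ?I (map (cid X) ps @ [rep_cell X u k])"
    using hr(1)[OF R(1)] R(2) hat_\<omega> by simp
qed

lemma opalgebra_object_mediator:
  assumes "opalgebra_object X j T K" "opalgebra X j T (a, l)"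
  shows "mediator X K (a, l) \<in> Tight X" "tdom X (mediator X K (a, l)) = tcod X (fst K)"
    "tcod X (mediator X K (a, l)) = tcod X a" "tcomp X (mediator X K (a, l)) (fst K) = a"
    "act X (mediator X K (a, l)) (fst K) (fst K) \<star>\<^bsub>X\<^esub> [snd K] = l"
  using mediator[OF assms, of "mediator X K (a, l)"] unfolding mediates_iff tight_def by auto

lemma mediator_self:
  assumes j: "j \<in> Tight X" and T: "relative_monad X j (t, d, e)"
    and K: "opalgebra_object X j (t, d, e) (k, m)"
  shows "mediator X (k, m) (k, m) = tid X (tcod X k)"
proof -
  have o: "opalgebra X j (t, d, e) (k, m)" using K by (simp add: opalgebra_object_def)
  note O = opalgebraD[OF j T o]
  have "mediates X (k, m) (k, m) (tid X (tcod X k))"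
    unfolding mediates_iff using O(1) act_tid[OF hcellD(1)[OF O(3)]] cid_vcomp[OF O(3)] by (simp add: tight_def)
  with mediator[OF K o] show ?thesis by simp
qed

text \<open>As \<open>v\<close> mediates \<open>(t, d)\<close>, its action after \<open>m\<close> is
  the extension operator \<open>d\<close>; what remains is \<open>unit_ext\<close>.\<close>

lemma opalgebra_object_retraction:
  assumes j: "j \<in> Tight X" and T: "relative_monad X j (t, d, e)"
    and K: "opalgebra_object X j (t, d, e) (k, m)" and x: "hcell x j rs t"
    and v: "v = mediator X (k, m) (t, d)"
  shows "mul j t t e (act X v k k \<star>\<^bsub>X\<^esub> [m \<star>\<^bsub>X\<^esub> [x]]) = x"
proof -
  have o: "opalgebra X j (t, d, e) (k, m)" using K by (simp add: opalgebra_object_def)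
  note O = opalgebraD[OF j T o] and V = opalgebra_object_mediator[OF K opalgebra_self[OF j T], folded v, simplified]
  have "act X v k k \<star>\<^bsub>X\<^esub> [m \<star>\<^bsub>X\<^esub> [x]] = d \<star>\<^bsub>X\<^esub> [x]"
    using app_assoc[OF hcell_act[OF hcellD(1)[OF O(3)] V(1) V(2)[symmetric]] O(3) x] V(5) by simp
  then show ?thesis using unit_ext[OF j T x] by simp
qed

text \<open>Since \<open>y\<close> is not known to lie in the image of \<open>m\<close>, the
  composition law of the opalgebra does not apply to it. The extension \<open>\<beta>\<close> has
  \<open>E(1,v)\<close> in place of \<open>E(1,t)\<close>, and there arbitrary 2-cells of
  \<open>Opalg(T)\<close> act through \<open>v\<close>. So \<open>y\<close> can be moved out of
  \<open>m\<close>, leaving the image of the unit, an identity, composed with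
  \<open>y\<close>.\<close>

lemma opalgebra_object_section:
  assumes j: "j \<in> Tight X" and T: "relative_monad X j (t, d, e)"
    and K: "opalgebra_object X j (t, d, e) (k, m)" and y: "hcell y k rs k"
    and v: "v = mediator X (k, m) (t, d)"
  shows "m \<star>\<^bsub>X\<^esub> [mul j t t e (act X v k k \<star>\<^bsub>X\<^esub> [y])] = y"
proof -
  have o: "opalgebra X j (t, d, e) (k, m)" using K by (simp add: opalgebra_object_def)
  note D = relative_monadD[OF j T]
  note O = opalgebraD[OF j T o] and V = opalgebra_object_mediator[OF K opalgebra_self[OF j T], folded v, simplified]
  define C E where "C = tcod X k" and "E = tcod X j"
  let ?C = "tid X C" and ?E = "tid X E"
  have CE: "C \<in> Obj X" "E \<in> Obj X" using O(1) j by (simp_all add: C_def E_def)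
  have dom: "tdom X k = tdom X j" "tdom X t = tdom X j" "tdom X v = C" "tcod X v = E" "tcod X t = E" "tcod X k = C"
    "tcod X j = E"
    using O(2) D V by (simp_all add: C_def E_def)
  have c: "cospan ?C k" "cospan j ?E" "cospan ?E t" "cospan ?E v" "cospan ?C ?C" "cospan k k" "cospan j t"
    using O(1) D V(1) j CE dom by (simp_all add: cospan_def)
  let ?ic = "cid X (loose_hom X ?C k)" and ?ij = "cid X (loose_hom X j ?E)" and ?it = "cid X (loose_hom X ?E t)"
  note ic = hcell_cid[OF c(1)] and ij = hcell_cid[OF c(2)] and it = hcell_cid[OF c(3)]
  let ?ps = "[loose_hom X ?C k, loose_hom X j ?E]"
  \<comment> \<open>\<open>m\<close> takes its argument from \<open>E(j,t)\<close>, while a graded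
    morphism out of \<open>(t, d)\<close> has last argument \<open>E(1,t)\<close>. The composition
    \<open>n\<close> splits \<open>E(j,t)\<close> into \<open>E(j,1)\<close>, which joins the
    grading, and \<open>E(1,t)\<close>.\<close>
  define n where "n = mul j ?E t ?ij ?it"
  have n: "hcell n j [loose_hom X j ?E, loose_hom X ?E t] t" using hcell_mul[OF ij it] by (simp add: n_def)
  note mn = hcell_app[OF O(3) n]
  define \<alpha> where "\<alpha> = mul ?C k k ?ic (m \<star>\<^bsub>X\<^esub> [n])"
  have \<alpha>: "hcell \<alpha> ?C (?ps @ [loose_hom X ?E t]) k" using hcell_mul[OF ic mn] by (simp add: \<alpha>_def)
  \<comment> \<open>By associativity both sides of the morphism law reduce to the same product, the
    opalgebra law of \<open>(k, m)\<close> being used at \<open>n\<close> and the identity of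
    \<open>E(j,t)\<close>.\<close>
  have gr: "graded_morphism X j (t, d, e) ?ps (t, d) (k, m) \<alpha>"
  proof -
    have rt: "hcell (mul ?E t t ?it d) ?E [loose_hom X ?E t, loose_hom X j t] t"
      using hcell_mul[OF it D(4)] by simp
    have pe: "path (tid X (tdom X j)) [?ij, mul ?E t t ?it d] [loose_hom X j ?E, loose_hom X ?E t, loose_hom X j t]
        [loose_hom X j ?E, loose_hom X ?E t] (tid X (tdom X t))"
      using hcell_path2[OF ij rt] by simp
    have nr: "n \<star>\<^bsub>X\<^esub> [?ij, mul ?E t t ?it d] = mul j t t n d"
      using mul_app2[OF ij it ij rt] cid_vcomp[OF ij] cid_vcomp[OF rt] mul_assoc[OF ij it D(4)]
      by (simp add: n_def)
    have "\<alpha> \<star>\<^bsub>X\<^esub> ([?ic] @ [?ij, mul ?E t t ?it d])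
        = mul ?C k k (?ic \<star>\<^bsub>X\<^esub> [?ic]) ((m \<star>\<^bsub>X\<^esub> [n]) \<star>\<^bsub>X\<^esub> [?ij, mul ?E t t ?it d])"
      unfolding \<alpha>_def using pe dom
      by (intro mul_vcomp[OF ic mn hcell_path[OF ic]]) simp
    also have "\<dots> = mul ?C k k ?ic (m \<star>\<^bsub>X\<^esub> [mul j t t n d])"
      using vcomp_assoc[OF O(3) n pe] cid_vcomp[OF ic] nr by simp
    finally have lhs: "\<alpha> \<star>\<^bsub>X\<^esub> [?ic, ?ij, mul ?E t t ?it d] = mul ?C k k ?ic (m \<star>\<^bsub>X\<^esub> [mul j t t n d])" by simp
    have "mul ?C k k ?ic m \<star>\<^bsub>X\<^esub> [\<alpha>, cid X (loose_hom X j t)] = mul ?C k k \<alpha> m"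
      using mul_app2[OF ic O(3) \<alpha> hcell_cid[OF c(7)]] cid_vcomp[OF \<alpha>] vcomp_cids[OF O(3)] by simp
    also have "\<dots> = mul ?C k k ?ic (mul k k k (m \<star>\<^bsub>X\<^esub> [n]) (m \<star>\<^bsub>X\<^esub> [cid X (loose_hom X j t)]))"
      using mul_assoc[OF ic mn O(3)] vcomp_cids[OF O(3)] by (simp add: \<alpha>_def)
    also have "\<dots> = mul ?C k k ?ic (m \<star>\<^bsub>X\<^esub> [mul j t t n d])"
      using opalgebra_mul[OF j T o n hcell_cid[OF c(7)]] vcomp_cids[OF D(4)] by simp
    finally show ?thesis
      using lhs \<alpha> c(1) dom CE c(2) hcell_globular[OF c(1)]
      by (simp add: graded_morphism.simps mul_def)
  qed
  \<comment> \<open>The target is the opalgebra object itself, so its mediator is an identity and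
    \<open>\<beta>\<close> ends in \<open>Opalg(T)(1,1)\<close>.\<close>
  have self: "mediator X (k, m) (k, m) = ?C" using mediator_self[OF j T K] by (simp add: C_def)
  have "\<exists>!\<beta>. globular X \<beta> (?ps @ [rep X v]) (rep X ?C) \<and> \<alpha> = restr_right X ?ps v ?C (fst (k, m)) \<beta>"
    using K opalgebra_self[OF j T] o gr unfolding opalgebra_object_def Let_def self[symmetric] v by blast
  then obtain \<beta> where "globular X \<beta> (?ps @ [rep X v]) (rep X ?C)" and \<alpha>\<beta>: "\<alpha> = restr_right X ?ps v ?C k \<beta>"
    by auto
  then have \<beta>: "hcell \<beta> ?C (?ps @ [rep X v]) ?C" using c(5) CE by (simp add: hcell_globular)
  define B where "B = hat ?C ?C \<beta>"
  have B: "cell X B ?C (?ps @ [loose_hom X ?E v]) (lid X C) ?C"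
    using hcell_hat[OF \<beta>] CE dom by (simp add: B_def)
  let ?r = "rep_cell X v k"
  have r: "cell X ?r ?E [loose_hom X ?E t] (loose_hom X ?E v) k" "hat ?E v ?r = hom_cell X ?E t"
    using rep_cell[OF V(1) O(1)] V dom by simp_all
  have hat_\<alpha>: "hat ?C k \<alpha> = ccomp X B ?C (map (cid X) ?ps @ [?r])"
    using restr_right(2)[OF V(1), of ?C k \<beta> ?ps] \<beta> CE dom O(1) by (simp add: \<alpha>\<beta> B_def)
  obtain ik where ik: "cell X ik k [] (loose_hom X ?C k) (tid X (tdom X k))" "hat ?C k ik = uid k"
    using left_unit_cell[OF O(1)] dom by auto
  obtain ih where ih: "cell X ih (tid X (tdom X j)) [] (loose_hom X j ?E) j" "hat j ?E ih = uid j"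
    using right_unit_cell[OF j] dom by auto
  let ?A = "tid X (tdom X j)"
  have A: "?A \<in> Tight X" "tdom X ?A = tdom X j" "tcod X ?A = tdom X j" using j by simp_all
  have ik': "cell X ik k [] (loose_hom X ?C k) ?A" using ik(1) dom by simp
  have pkh: "path k [ik,ih] [] ?ps j" using path2[OF ik' ih(1)] by simp
  have hck: "cell X (hom_cell X ?C k) ?C [loose_hom X ?C k] (lid X C) k"
    and hj: "cell X (hom_cell X j ?E) j [loose_hom X j ?E] (lid X E) ?E"
    and ht: "cell X (hom_cell X ?E t) ?E [loose_hom X ?E t] (lid X E) t"
    using hom_cell(1)[OF c(1)] hom_cell(1)[OF c(2)] hom_cell(1)[OF c(3)] CE dom by simp_all
  \<comment> \<open>Inserting identities of \<open>k\<close> and \<open>j\<close> in the first two arguments of \<open>\<beta>\<close> yields \<open>\<ltimes>\<^sub>T\<close>, with the third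
    argument ranging over 2-cells into \<open>E(1,v)\<close>, on which \<open>Opalg(T)\<close> acts.\<close>
  have key: "hat k k (m \<star>\<^bsub>X\<^esub> [x]) = ccomp X B k ([ik,ih] @ [z])"
    if x: "hcell x j ss t" and z: "cell X z j ss (loose_hom X ?E v) k" "hat ?E v z = hat j t x" for x z ss
  proof -
    have hx: "cell X (hat j t x) j ss (lid X E) t" using hcell_hat[OF x] dom by simp
    \<comment> \<open>\<open>w\<close> is \<open>x\<close> as a 2-cell into \<open>E(1,t)\<close>
      with \<open>j\<close> on the left. Passing it through \<open>?r\<close> gives
      \<open>z\<close>, and inserting it into \<open>n\<close> next to the identity
      \<open>ih\<close> of \<open>j\<close> returns \<open>x\<close>.\<close>
    obtain w where w: "cell X w j ss (loose_hom X ?E t) ?A" "hat ?E t w = hat j t x"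
      using hat_ex[OF c(3), of j ?A "hat j t x" ss] hx j A CE D(1) dom by auto
    have rw: "ccomp X ?r j [w] = z"
    proof (rule hat_inj[OF c(4)])
      show "cell X (ccomp X ?r j [w]) j ss (loose_hom X ?E v) k"
        using cell_ccomp1[OF r(1) w(1)] j CE O(1) dom by simp
      show "cell X z j ss (loose_hom X ?E v) k" by (fact z(1))
      have "hat ?E v (ccomp X ?r j [w]) = ccomp X (hom_cell X ?E t) j [w]"
        using hat_ccomp[OF c(4) r(1) path_single[OF w(1)]] r(2) CE dom by simp
      then show "hat ?E v (ccomp X ?r j [w]) = hat ?E v z"
        using w(2) z(2) by (simp add: hat_eq[OF w(1)])
    qed
    have phw: "path ?A [ih,w] ss [loose_hom X j ?E, loose_hom X ?E t] ?A"
      using path2[OF ih(1) w(1)] by simp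
    have nd: "cell X n ?A [loose_hom X j ?E, loose_hom X ?E t] (loose_hom X j t) ?A"
      using hcellD(2)[OF n] dom by simp
    have nw: "ccomp X n ?A [ih,w] = x"
    proof (rule hat_inj[OF c(7)])
      show "cell X (ccomp X n ?A [ih,w]) ?A ss (loose_hom X j t) ?A"
        using cell_ccomp[OF nd phw] A by simp
      show "cell X x ?A ss (loose_hom X j t) ?A" using hcellD(2)[OF x] dom by simp
      have "hat j t (ccomp X n ?A [ih,w]) = ccomp X (hat j t n) ?A ([ih] @ [w])"
        using hat_ccomp[OF c(7) nd phw] A by simp
      also have "hat j t n = hom_cell X j ?E \<bullet> hom_cell X ?E t"
        using hat_mul[OF ij it] c by (simp add: n_def hat_cid)
      also have "ccomp X (hom_cell X j ?E \<bullet> hom_cell X ?E t) ?A ([ih] @ [w])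
          = ccomp X (hom_cell X j ?E) ?A [ih] \<bullet> ccomp X (hom_cell X ?E t) j [w]"
        by (rule ccomp_rmul_split[OF hj ht CE(2) path_single[OF ih(1)] path_single[OF w(1)] A(3)])
      also have "\<dots> = hat j t x"
        using ih(2) w(2) uid_rmul[of "hat j t x" j ss t] hx dom
        by (simp add: hat_eq[OF ih(1)] hat_eq[OF w(1)])
      finally show "hat j t (ccomp X n ?A [ih,w]) = hat j t x" .
    qed
    have md: "cell X m ?A [loose_hom X j t] (loose_hom X k k) ?A" using hcellD(2)[OF O(3)] dom by simp
    have hm: "cell X (hat k k m) k [loose_hom X j t] (lid X C) k" using hcell_hat[OF O(3)] dom by simp
    have mne: "m \<star>\<^bsub>X\<^esub> [n] = ccomp X m ?A [n]" "m \<star>\<^bsub>X\<^esub> [x] = ccomp X m ?A [x]"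
      using vcomp_hcell[OF O(3)] dom by simp_all
    have mnd: "cell X (m \<star>\<^bsub>X\<^esub> [n]) ?A [loose_hom X j ?E, loose_hom X ?E t] (loose_hom X k k) ?A"
      using hcellD(2)[OF mn] dom by simp
    have hmn: "cell X (hat k k (m \<star>\<^bsub>X\<^esub> [n])) k [loose_hom X j ?E, loose_hom X ?E t] (lid X C) k"
      using hcell_hat[OF mn] dom by simp
    have "ccomp X (hat ?C k \<alpha>) k ([ik] @ [ih,w])
        = ccomp X (hom_cell X ?C k) k [ik] \<bullet> ccomp X (hat k k (m \<star>\<^bsub>X\<^esub> [n])) ?A [ih,w]"
      unfolding \<alpha>_def hat_mul[OF ic mn] hat_cid[OF c(1)]
      by (rule ccomp_rmul_split[OF hck hmn CE(1) path_single[OF ik'] phw]) (use CE dom in simp)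
    also have "ccomp X (hat k k (m \<star>\<^bsub>X\<^esub> [n])) ?A [ih,w] = hat k k (ccomp X (m \<star>\<^bsub>X\<^esub> [n]) ?A [ih,w])"
      using hat_ccomp[OF c(6) mnd phw] A by simp
    also have "ccomp X (m \<star>\<^bsub>X\<^esub> [n]) ?A [ih,w] = m \<star>\<^bsub>X\<^esub> [x]"
      unfolding mne using ccomp_assoc1[OF md nd phw] A nw by simp
    also have "ccomp X (hom_cell X ?C k) k [ik] \<bullet> hat k k (m \<star>\<^bsub>X\<^esub> [x]) = hat k k (m \<star>\<^bsub>X\<^esub> [x])"
      using ik(2) uid_rmul[OF hcell_hat[OF hcell_app[OF O(3) x]]] by (simp add: hat_eq[OF ik'])
    finally have lhs: "ccomp X (hat ?C k \<alpha>) k ([ik] @ [ih,w]) = hat k k (m \<star>\<^bsub>X\<^esub> [x])" .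
    have chp: "chain X ?ps E C" using c dom CE by simp
    have pcr: "path ?C (map (cid X) ?ps @ [?r]) (?ps @ [loose_hom X ?E t]) (?ps @ [loose_hom X ?E v]) k"
      using path_append[OF path_cids[OF chp] path_single[OF r(1)]] by simp
    have pw: "path k ([ik,ih] @ [w]) ss (?ps @ [loose_hom X ?E t]) ?A"
      using path_append[OF pkh path_single[OF w(1)]] by simp
    have "comp_path X (map (cid X) ?ps @ [?r]) k ([ik,ih] @ [w])
        = comp_path X (map (cid X) ?ps) k [ik,ih] @ comp_path X [?r] j [w]"
      by (rule comp_path_append[OF path_cids[OF chp] pkh])
    also have "\<dots> = [ik,ih] @ [z]"
      unfolding comp_path_cids_left[OF pkh] comp_path_single[OF r(1) path_single[OF w(1)]] rw ..
    finally have "ccomp X (ccomp X B ?C (map (cid X) ?ps @ [?r])) k ([ik,ih] @ [w]) = ccomp X B k ([ik,ih] @ [z])"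
      using ccomp_assoc_path[OF B pcr pw] CE O(1) dom by simp
    with lhs show ?thesis unfolding hat_\<alpha> by simp
  qed
  have he: "cell X (hat j t e) j [] (lid X E) t" using hcell_hat[OF D(5)] dom by simp
  \<comment> \<open>The unit, regarded as a 2-cell into \<open>E(1,v)\<close> with \<open>k\<close>
    on the right; this uses that \<open>v\<close> after \<open>k\<close> is \<open>t\<close>. Its
    right end now lies over \<open>Opalg(T)\<close>, so it can be multiplied by the transpose of
    \<open>y\<close>.\<close>
  obtain z where z: "cell X z j [] (loose_hom X ?E v) k" "hat ?E v z = hat j t e"
    using hat_ex[OF c(4), of j k "hat j t e" "[]"] he j CE O(1) V dom by auto
  have hy: "cell X (hat k k y) k rs (lid X C) k" using hcell_hat[OF y] dom by simp
  have hy': "cell X (hat k k y) k rs (lid X (tdom X v)) k" using hy dom by simp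
  have vk: "tcod X k = tdom X v" using dom by simp
  have vy: "hcell (act X v k k \<star>\<^bsub>X\<^esub> [y]) t rs t"
    using hcell_app[OF hcell_act[OF c(6) V(1) vk] y] V by simp
  have ev: "hcell (mul j t t e (act X v k k \<star>\<^bsub>X\<^esub> [y])) j rs t" using hcell_mul[OF D(5) vy] by simp
  have zy: "cell X (z \<bullet> hat k k y) j rs (loose_hom X ?E v) k"
    using cell_rmul[OF z(1)] hy' c(4) by simp
  have "hat ?E v (z \<bullet> hat k k y) = hat j t e \<bullet> ccomp X (lid_map X v) k [hat k k y]"
    using hat_rmul[OF c(4) z(1) hy'] z(2) by simp
  also have "\<dots> = hat j t (mul j t t e (act X v k k \<star>\<^bsub>X\<^esub> [y]))"
    using hat_mul[OF D(5) vy] hat_act_app[OF y V(1) vk] V by simp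
  finally have "hat k k (m \<star>\<^bsub>X\<^esub> [mul j t t e (act X v k k \<star>\<^bsub>X\<^esub> [y])]) = ccomp X B k ([ik,ih] @ [z \<bullet> hat k k y])"
    by (rule key[OF ev zy])
  \<comment> \<open>Naturality of \<open>\<bullet>\<close> pulls \<open>y\<close> out of the last
    argument of \<open>B\<close>, unchanged because the right tight-cell of \<open>B\<close> is an
    identity. What remains is \<open>key\<close> at the unit.\<close>
  also have "\<dots> = ccomp X B k ([ik,ih] @ [z]) \<bullet> ccomp X (lid_map X ?C) k [hat k k y]"
    using CE dom c(4) hy by (intro rmul_natural[OF B pkh z(1)]) auto
  also have "\<dots> = hat k k (m \<star>\<^bsub>X\<^esub> [e]) \<bullet> hat k k y"
    using key[OF D(5) z] ccomp_cid(1)[OF hy] CE by (simp add: lid_map_tid)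
  also have "\<dots> = hat k k y"
    using O(1,4) frown(2)[OF O(1)] uid_rmul[OF hcell_hat[OF y]] by simp
  finally show ?thesis
    using hcell_inj[OF hcell_app[OF O(3) ev] y] by blast
qed

lemma opalgebra_object_inj:
  assumes j: "j \<in> Tight X" and T: "relative_monad X j (t, d, e)"
    and K: "opalgebra_object X j (t, d, e) (k, m)"
    and x: "hcell x j rs t" and y: "hcell y j rs t" and eq: "m \<star>\<^bsub>X\<^esub> [x] = m \<star>\<^bsub>X\<^esub> [y]"
  shows "x = y"
  using opalgebra_object_retraction[OF j T K x refl, unfolded eq] opalgebra_object_retraction[OF j T K y refl]
  by (rule trans[OF sym])

section \<open>Monad morphisms compared with tight-cells under the base object\<close>

lemma k_faithful:
  assumes dense: "dense X j" and T: "relative_monad X j (t, d, e)" and T': "relative_monad X j (t', d', e')"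
    and K': "opalgebra_object X j (t', d', e') (k', m')"
    and \<tau>: "relative_monad_morphism X j (t, d, e) (t', d', e') \<tau>"
    and \<sigma>: "relative_monad_morphism X j (t, d, e) (t', d', e') \<sigma>"
    and eq: "m' \<star>\<^bsub>X\<^esub> [covar X j t t' \<tau>] = m' \<star>\<^bsub>X\<^esub> [covar X j t t' \<sigma>]"
  shows "\<tau> = \<sigma>"
proof -
  have j: "j \<in> Tight X" using dense by (simp add: dense_def)
  note D = relative_monadD[OF j T]
  have h: "hcell \<tau> t [] t'" "hcell \<sigma> t [] t'"
    using \<tau> \<sigma> unfolding relative_monad_morphism_iff[OF j T T'] by blast+
  note c = hcell_covar[OF D(9) h(1)] hcell_covar[OF D(9) h(2)]
  have "covar X j t t' \<tau> = covar X j t t' \<sigma>"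
    by (rule opalgebra_object_inj[OF j T' K' c eq])
  then show ?thesis
    using dense_faithful[OF dense D(3) h] by (simp add: covar_mul)
qed

lemma k_full:
  assumes dense: "dense X j" and T: "relative_monad X j (t, d, e)" and T': "relative_monad X j (t', d', e')"
    and K: "opalgebra_object X j (t, d, e) (k, m)" and K': "opalgebra_object X j (t', d', e') (k', m')"
    and u: "u \<in> Tight X" "tdom X u = tcod X k" "tcomp X u k = k'"
  obtains \<tau> where "relative_monad_morphism X j (t, d, e) (t', d', e') \<tau>"
    "act X u k k \<star>\<^bsub>X\<^esub> [m] = m' \<star>\<^bsub>X\<^esub> [covar X j t t' \<tau>]"
proof -
  have j: "j \<in> Tight X" using dense by (simp add: dense_def)
  note D = relative_monadD[OF j T] and D' = relative_monadD[OF j T']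
  have o: "opalgebra X j (t, d, e) (k, m)" and o': "opalgebra X j (t', d', e') (k', m')"
    using K K' unfolding opalgebra_object_def by blast+
  note O = opalgebraD[OF j T o] and O' = opalgebraD[OF j T' o']
  have ku: "tcod X k = tdom X u" using u by simp
  have act: "hcell (act X u k k) k' [loose_hom X k k] k'"
    using hcell_act[OF hcellD(1)[OF O(3)] u(1) ku] u by simp
  note um = hcell_app[OF act O(3)]
  define v where "v = mediator X (k', m') (t', d')"
  note V = opalgebra_object_mediator[OF K' opalgebra_self[OF j T'], folded v_def, simplified]
  \<comment> \<open>\<open>\<theta>\<close> is the inverse of \<open>m'\<close> applied to the
    action of \<open>u\<close> on \<open>m\<close>.\<close>
  define \<theta> where "\<theta> = mul j t' t' e' (act X v k' k' \<star>\<^bsub>X\<^esub> [act X u k k \<star>\<^bsub>X\<^esub> [m]])"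
  have "hcell (act X v k' k' \<star>\<^bsub>X\<^esub> [act X u k k \<star>\<^bsub>X\<^esub> [m]]) t' [loose_hom X j t] t'"
    using hcell_app[OF hcell_act[OF hcellD(1)[OF O'(3)] V(1) V(2)[symmetric]] um] V by simp
  from hcell_mul[OF D'(5) this] have \<theta>: "hcell \<theta> j [loose_hom X j t] t'" by (simp add: \<theta>_def)
  have m\<theta>: "m' \<star>\<^bsub>X\<^esub> [\<theta>] = act X u k k \<star>\<^bsub>X\<^esub> [m]"
    unfolding \<theta>_def by (rule opalgebra_object_section[OF j T' K' um v_def])
  obtain \<tau> where \<tau>: "hcell \<tau> t [] t'" and c\<tau>: "covar X j t t' \<tau> = \<theta>"
    using dense_full[OF dense D(1) D(3) \<theta>] .
  \<comment> \<open>The defining property of \<open>\<tau>\<close> at an arbitrary element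
    \<open>z\<close>. With injectivity of \<open>m'\<close> it reduces the morphism laws to the fact
    that the action of \<open>u\<close> preserves identities and composites.\<close>
  have app: "m' \<star>\<^bsub>X\<^esub> [mul j t t' z \<tau>] = act X u k k \<star>\<^bsub>X\<^esub> [m \<star>\<^bsub>X\<^esub> [z]]" if z: "hcell z j rs t" for z rs
    using app_assoc[OF O'(3) \<theta> z] app_assoc[OF act O(3) z] covar_app[OF \<tau> z]
    by (simp add: c\<tau> m\<theta>)
  have unit: "mul j t t' e \<tau> = e'"
    using opalgebra_object_inj[OF j T' K' hcell_mul[OF D(5) \<tau>]] D'(5) app[OF D(5)] O(4) O'(4)
      act_frown[OF O(1) u(1) ku] u(3) by simp
  let ?i = "cid X (loose_hom X j t)"
  note i = hcell_cid[OF D(9)]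
  note w = hcell_mul[OF i D(4)]
  note d\<theta> = hcell_app[OF D'(4) \<theta>]
  \<comment> \<open>Two tests in succession: density allows both sides to be compared after left
    multiplication by the identity of \<open>E(j,t)\<close>, and the results are compared under
    \<open>m'\<close>. There the composition laws of \<open>(k, m)\<close> and
    \<open>(k', m')\<close> meet.\<close>
  have "mul t t t' d \<tau> = mul t t' t' \<tau> (d' \<star>\<^bsub>X\<^esub> [\<theta>])"
  proof (rule dense_faithful[OF dense D(3)])
    show "hcell (mul t t t' d \<tau>) t [loose_hom X j t] t'" using hcell_mul[OF D(4) \<tau>] by simp
    show "hcell (mul t t' t' \<tau> (d' \<star>\<^bsub>X\<^esub> [\<theta>])) t [loose_hom X j t] t'" using hcell_mul[OF \<tau> d\<theta>] by simp
    have "m' \<star>\<^bsub>X\<^esub> [mul j t t' (mul j t t ?i d) \<tau>] = act X u k k \<star>\<^bsub>X\<^esub> [mul k k k m m]"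
      by (simp only: app[OF w] O(5))
    also have "\<dots> = mul k' k' k' (m' \<star>\<^bsub>X\<^esub> [\<theta>]) (m' \<star>\<^bsub>X\<^esub> [\<theta>])"
      using act_mul[OF O(3) O(3) u(1) ku] u(3) by (simp add: m\<theta>)
    also have "\<dots> = m' \<star>\<^bsub>X\<^esub> [mul j t' t' \<theta> (d' \<star>\<^bsub>X\<^esub> [\<theta>])]"
      by (rule opalgebra_mul[OF j T' o' \<theta> \<theta>])
    finally have "mul j t t' (mul j t t ?i d) \<tau> = mul j t' t' \<theta> (d' \<star>\<^bsub>X\<^esub> [\<theta>])"
      using opalgebra_object_inj[OF j T' K' hcell_mul[OF w \<tau>]] hcell_mul[OF \<theta> d\<theta>] by simp
    then show "mul j t t' ?i (mul t t t' d \<tau>) = mul j t t' ?i (mul t t' t' \<tau> (d' \<star>\<^bsub>X\<^esub> [\<theta>]))"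
      using mul_assoc[OF i D(4) \<tau>] mul_assoc[OF i \<tau> d\<theta>] c\<tau> by (simp add: covar_mul)
  qed
  then show ?thesis
    using that[of \<tau>] \<tau> unit by (simp add: relative_monad_morphism_iff[OF j T T'] c\<tau> m\<theta>)
qed

end

theorem corollary6p50:
  fixes X :: "('o, 't, 'l, 'c) vdc"
    and j :: 't
    and K :: "'t \<times> 'c \<times> 'c \<Rightarrow> 't \<times> 'c"
  assumes "virtual_equipment X"
    and "dense X j"
    and "\<And>T. relative_monad X j T \<Longrightarrow> admits_opalgebra_object X j T \<Longrightarrow> opalgebra_object X j T (K T)"
  shows "fully_faithful_functor
    (full_subcategory (RMnd X j) (admits_opalgebra_object X j))
    (under X (tdom X j))
    (k_ob K) (k_mor X K j)"
proof -
  interpret virtual_equipment X by fact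
  have j: "j \<in> Tight X" using assms(2) by (simp add: dense_def)
  let ?C = "full_subcategory (RMnd X j) (admits_opalgebra_object X j)"
  interpret cat_functor ?C "under X (tdom X j)" "k_ob K" "k_mor X K j"
    by (rule cat_functor_k[OF j assms(3)])
  show ?thesis
  proof
    fix T T' assume T: "T \<in> ob ?C" and T': "T' \<in> ob ?C"
    obtain t d e t' d' e' where e: "T = (t, d, e)" "T' = (t', d', e')" by (metis prod_cases3)
    obtain k m k' m' where k: "K T = (k, m)" "K T' = (k', m')" by (meson surj_pair)
    have rm: "relative_monad X j (t, d, e)" "relative_monad X j (t', d', e')"
      and obj: "opalgebra_object X j (t, d, e) (k, m)" "opalgebra_object X j (t', d', e') (k', m')"
      using T T' assms(3)[of T] assms(3)[of T'] unfolding e k[symmetric] by (simp_all add: full_subcategory_def RMnd_def)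
    have o': "opalgebra X j (t', d', e') (k', m')" using obj(2) unfolding opalgebra_object_def by blast
    have hom: "\<tau> \<in> hom ?C T T' \<longleftrightarrow> relative_monad_morphism X j (t, d, e) (t', d', e') \<tau>" for \<tau>
      by (simp add: e full_subcategory_def RMnd_def)
    have med: "mediates X (k, m) (k', m' \<star>\<^bsub>X\<^esub> [covar X j t t' \<tau>]) u \<longleftrightarrow> u = k_mor X K j T T' \<tau>"
      if "\<tau> \<in> hom ?C T T'" for \<tau> u
      using mediator[OF obj(1) opalgebra_reindex[OF j rm o' that[unfolded hom]], of u] e k
      by (simp add: k_mor_def)
    \<comment> \<open>A mediating tight-cell determines the structure 2-cell that it mediates, so
      equal values of \<open>k_mor\<close> give equal reindexed structures on
      \<open>k'\<close>.\<close>
    have "\<tau> = \<sigma>" if "\<tau> \<in> hom ?C T T'" "\<sigma> \<in> hom ?C T T'" "k_mor X K j T T' \<tau> = k_mor X K j T T' \<sigma>" for \<tau> \<sigma>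
    proof (rule k_faithful[OF assms(2) rm obj(2)])
      show "m' \<star>\<^bsub>X\<^esub> [covar X j t t' \<tau>] = m' \<star>\<^bsub>X\<^esub> [covar X j t t' \<sigma>]"
        using med[OF that(1), of "k_mor X K j T T' \<tau>"] med[OF that(2), of "k_mor X K j T T' \<tau>"] that(3)
        by (simp add: mediates_iff)
    qed (use that hom in blast)+
    moreover have "\<exists>\<tau>\<in>hom ?C T T'. u = k_mor X K j T T' \<tau>"
      if "u \<in> hom (under X (tdom X j)) (k_ob K T) (k_ob K T')" for u
    proof -
      have u: "u \<in> Tight X" "tdom X u = tcod X k" "tcod X u = tcod X k'" "tcomp X u k = k'"
        using that k by (auto simp: under_def k_ob_def tight_def)
      obtain \<tau> where \<tau>: "relative_monad_morphism X j (t, d, e) (t', d', e') \<tau>"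
        "act X u k k \<star>\<^bsub>X\<^esub> [m] = m' \<star>\<^bsub>X\<^esub> [covar X j t t' \<tau>]"
        using k_full[OF assms(2) rm obj u(1,2,4)] .
      then have "mediates X (k, m) (k', m' \<star>\<^bsub>X\<^esub> [covar X j t t' \<tau>]) u"
        using u by (simp add: mediates_iff tight_def)
      with med[of \<tau> u] \<tau>(1) hom show ?thesis by blast
    qed
    ultimately show "bij_betw (k_mor X K j T T') (hom ?C T T') (hom (under X (tdom X j)) (k_ob K T) (k_ob K T'))"
      using F_hom[OF T T'] unfolding bij_betw_def inj_on_def by blast
  qed
qed

end
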